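(* The resolvent of $A$ satisfies $\|R(is,A)\|=O(|s|^3)$ as $|s|\to\infty$, $s\in\mathbb R$.
   Context: Notation: $R(\lambda,A)=(\lambda-A)^{-1}$ for $\lambda\in\mathbb C\setminus\sigma(A)$, and $\|\cdot\|$ is the operator norm on the space $Z$ below. The spectrum $\sigma(A)$ of the operator $A$ below is contained in $\{\lambda\in\mathbb C:\operatorname{Re}\lambda<0\}$, so $R(is,A)$ is defined for all $s\in\mathbb R$. Let $\Omega_-=(-1,0)\times(0,1)$, $\Omega_+=(0,1)\times(0,1)$ and $\Gamma=\{(0,y):0\le y\le1\}=\partial\Omega_-\cap\partial\Omega_+$. All function spaces are complex. Let $H^1_\Gamma(\Omega_\mp)$ be the set of functions in $H^1(\Omega_\mp)$ whose trace vanishes on $\partial\Omega_\mp\setminus\Gamma$, endowed with the (equivalent, Poincaré) norm $\|u\|=\|\nabla u\|_{L^2}$. Let $Z$ be the Hilbert space $H^1_\Gamma(\Omega_-)\times L^2(\Omega_-)\times L^2(\Omega_+)$ with its natural inner product. Let $Z_0$ be the set of all $(u,v,w)\in Z$ with $\Delta u\in L^2(\Omega_-)$, $v\in H^1_\Gamma(\Omega_-)$, $w\in H^1_\Gamma(\Omega_+)$ and $\Delta w\in L^2(\Omega_+)$. Define $A(u,v,w)=(v,\Delta u,\Delta w)$ on the domain $$D(A)=\{(u,v,w)\in Z_0: v|_\Gamma=w|_\Gamma \text{ and } u_x|_\Gamma=w_x|_\Gamma\},$$ where the coupling conditions along $\Gamma$ are understood in the sense of traces; the condition $u_x|_\Gamma=w_x|_\Gamma$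 is understood in the sense of weak normal traces, i.e. $\int_{\Omega_-}(\nabla u\cdot\nabla\varphi+\varphi\,\Delta u)+\int_{\Omega_+}(\nabla w\cdot\nabla\varphi+\varphi\,\Delta w)=0$ for all $\varphi\in H^1_0((-1,1)\times(0,1))$. *)

theory Defs
  imports "HOL-Analysis.Analysis" "HOL-Library.Landau_Symbols"
begin

text \<open>
  Elements of the function spaces below are representatives: functions on the whole Euclidean
  space, Borel on the domain \<open>\<Omega>\<close>, of which only the values almost everywhere on
  \<open>\<Omega>\<close> matter. Equality in the spaces is almost-everywhere equality on \<open>\<Omega>\<close>. Weak
  derivatives are chosen representatives, unique up to this equality.
\<close>

section \<open>Sobolev spaces\<close>

abbreviation lborel_on :: "'a::euclidean_space set \<Rightarrow> 'a measure"
  where "lborel_on \<Omega> \<equiv> restrict_space lborel \<Omega>"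

definition L2 :: "'a::euclidean_space set \<Rightarrow> ('a \<Rightarrow> complex) set"
  where "L2 \<Omega> = {f \<in> borel_measurable (lborel_on \<Omega>). integrable (lborel_on \<Omega>) (\<lambda>x. (cmod (f x))\<^sup>2)}"

definition L2_norm :: "'a::euclidean_space set \<Rightarrow> ('a \<Rightarrow> complex) \<Rightarrow> real"
  where "L2_norm \<Omega> f = sqrt (LINT x|lborel_on \<Omega>. (cmod (f x))\<^sup>2)"

definition dderiv :: "'a::euclidean_space \<Rightarrow> ('a \<Rightarrow> complex) \<Rightarrow> 'a \<Rightarrow> complex"
  where "dderiv e f = (\<lambda>x. frechet_derivative f (at x) e)"

primrec Ck :: "nat \<Rightarrow> ('a::euclidean_space \<Rightarrow> complex) \<Rightarrow> bool"
  where
    "Ck 0 f \<longleftrightarrow> continuous_on UNIV f"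
  | "Ck (Suc k) f \<longleftrightarrow> f differentiable_on UNIV \<and> (\<forall>e\<in>Basis. Ck k (dderiv e f))"

definition smooth :: "('a::euclidean_space \<Rightarrow> complex) \<Rightarrow> bool"
  where "smooth f \<longleftrightarrow> (\<forall>k. Ck k f)"

definition test_functions :: "'a::euclidean_space set \<Rightarrow> ('a \<Rightarrow> complex) set"
  where "test_functions \<Omega> =
    {\<phi>. smooth \<phi> \<and> compact (closure {x. \<phi> x \<noteq> 0}) \<and> closure {x. \<phi> x \<noteq> 0} \<subseteq> \<Omega>}"

definition has_weak_deriv ::
    "'a::euclidean_space set \<Rightarrow> 'a \<Rightarrow> ('a \<Rightarrow> complex) \<Rightarrow> ('a \<Rightarrow> complex) \<Rightarrow> bool"
  where "has_weak_deriv \<Omega> e u g \<longleftrightarrow> g \<in> L2 \<Omega> \<and>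
    (\<forall>\<phi>\<in>test_functions \<Omega>.
      (LINT x|lborel_on \<Omega>. u x * dderiv e \<phi> x) = - (LINT x|lborel_on \<Omega>. g x * \<phi> x))"

definition weak_deriv :: "'a::euclidean_space set \<Rightarrow> 'a \<Rightarrow> ('a \<Rightarrow> complex) \<Rightarrow> 'a \<Rightarrow> complex"
  where "weak_deriv \<Omega> e u = (SOME g. has_weak_deriv \<Omega> e u g)"

definition has_weak_laplacian ::
    "'a::euclidean_space set \<Rightarrow> ('a \<Rightarrow> complex) \<Rightarrow> ('a \<Rightarrow> complex) \<Rightarrow> bool"
  where "has_weak_laplacian \<Omega> u g \<longleftrightarrow> g \<in> L2 \<Omega> \<and>
    (\<forall>\<phi>\<in>test_functions \<Omega>.
      (LINT x|lborel_on \<Omega>. u x * (\<Sum>e\<in>Basis. dderiv e (dderiv e \<phi>) x)) =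
      (LINT x|lborel_on \<Omega>. g x * \<phi> x))"

definition weak_laplacian :: "'a::euclidean_space set \<Rightarrow> ('a \<Rightarrow> complex) \<Rightarrow> 'a \<Rightarrow> complex"
  where "weak_laplacian \<Omega> u = (SOME g. has_weak_laplacian \<Omega> u g)"

definition H1 :: "'a::euclidean_space set \<Rightarrow> ('a \<Rightarrow> complex) set"
  where "H1 \<Omega> = {u \<in> L2 \<Omega>. \<forall>e\<in>Basis. \<exists>g. has_weak_deriv \<Omega> e u g}"

definition grad_norm :: "'a::euclidean_space set \<Rightarrow> ('a \<Rightarrow> complex) \<Rightarrow> real"
  where "grad_norm \<Omega> u = sqrt (\<Sum>e\<in>Basis. (L2_norm \<Omega> (weak_deriv \<Omega> e u))\<^sup>2)"

definition H1_norm :: "'a::euclidean_space set \<Rightarrow> ('a \<Rightarrow> complex) \<Rightarrow> real"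
  where "H1_norm \<Omega> u = sqrt ((L2_norm \<Omega> u)\<^sup>2 + (grad_norm \<Omega> u)\<^sup>2)"

definition H10 :: "'a::euclidean_space set \<Rightarrow> ('a \<Rightarrow> complex) set"
  where "H10 \<Omega> = {u \<in> H1 \<Omega>. \<exists>f. (\<forall>n. f n \<in> test_functions \<Omega>) \<and>
    (\<lambda>n::nat. H1_norm \<Omega> (\<lambda>x. f n x - u x)) \<longlonglongrightarrow> 0}"

text \<open>
  \<open>has_trace \<Omega> a b u g\<close>: the trace of \<open>u\<close> on the boundary segment from \<open>a\<close> to
  \<open>b\<close> is \<open>g\<close>, a function of the parameter in \<open>[0,1]\<close>. The trace operator is the continuous
  extension, from the \<open>H1\<close>-dense set of functions smooth up to the boundary, of the
  restriction to the segment. All segments used below have length one, so the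
  parameter is arc length.
\<close>

definition has_trace ::
    "'a::euclidean_space set \<Rightarrow> 'a \<Rightarrow> 'a \<Rightarrow> ('a \<Rightarrow> complex) \<Rightarrow> (real \<Rightarrow> complex) \<Rightarrow> bool"
  where "has_trace \<Omega> a b u g \<longleftrightarrow> u \<in> H1 \<Omega> \<and> g \<in> L2 {0..1} \<and>
    (\<exists>f. (\<forall>n. smooth (f n)) \<and>
      (\<lambda>n::nat. H1_norm \<Omega> (\<lambda>x. f n x - u x)) \<longlonglongrightarrow> 0 \<and>
      (\<lambda>n. L2_norm {0..1} (\<lambda>t. f n (linepath a b t) - g t)) \<longlonglongrightarrow> 0)"

definition H1_zero_on :: "'a::euclidean_space set \<Rightarrow> ('a \<times> 'a) set \<Rightarrow> ('a \<Rightarrow> complex) set"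
  where "H1_zero_on \<Omega> S = {u \<in> H1 \<Omega>. \<forall>(a, b)\<in>S. has_trace \<Omega> a b u (\<lambda>_. 0)}"


section \<open>The wave-heat system\<close>

definition Omega_minus :: "(real \<times> real) set"  (\<open>\<Omega>\<^sub>-\<close>)
  where "\<Omega>\<^sub>- = {-1<..<0} \<times> {0<..<1}"

definition Omega_plus :: "(real \<times> real) set"  (\<open>\<Omega>\<^sub>+\<close>)
  where "\<Omega>\<^sub>+ = {0<..<1} \<times> {0<..<1}"

definition Omega_full :: "(real \<times> real) set"  (\<open>\<Omega>\<^sub>0\<close>)
  where "\<Omega>\<^sub>0 = {-1<..<1} \<times> {0<..<1}"

text \<open>The sides of the two squares other than the common side from \<open>(0,0)\<close> to \<open>(0,1)\<close>.\<close>

definition HG_minus :: "(real \<times> real \<Rightarrow> complex) set"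
  where "HG_minus = H1_zero_on \<Omega>\<^sub>-
    {((-1, 0), (0, 0)), ((-1, 1), (0, 1)), ((-1, 0), (-1, 1))}"

definition HG_plus :: "(real \<times> real \<Rightarrow> complex) set"
  where "HG_plus = H1_zero_on \<Omega>\<^sub>+
    {((0, 0), (1, 0)), ((0, 1), (1, 1)), ((1, 0), (1, 1))}"

type_synonym state =
  "(real \<times> real \<Rightarrow> complex) \<times> (real \<times> real \<Rightarrow> complex) \<times> (real \<times> real \<Rightarrow> complex)"

definition Z :: "state set"
  where "Z = HG_minus \<times> L2 \<Omega>\<^sub>- \<times> L2 \<Omega>\<^sub>+"

definition Z_norm :: "state \<Rightarrow> real"
  where "Z_norm = (\<lambda>(u, v, w).
    sqrt ((grad_norm \<Omega>\<^sub>- u)\<^sup>2 + (L2_norm \<Omega>\<^sub>- v)\<^sup>2 + (L2_norm \<Omega>\<^sub>+ w)\<^sup>2))"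

definition Z_eq :: "state \<Rightarrow> state \<Rightarrow> bool"
  where "Z_eq = (\<lambda>(u, v, w) (u', v', w').
    (AE x in lborel_on \<Omega>\<^sub>-. u x = u' x) \<and>
    (AE x in lborel_on \<Omega>\<^sub>-. v x = v' x) \<and>
    (AE x in lborel_on \<Omega>\<^sub>+. w x = w' x))"

definition Z0 :: "state set"
  where "Z0 = {(u, v, w) \<in> Z. (\<exists>g. has_weak_laplacian \<Omega>\<^sub>- u g) \<and> v \<in> HG_minus \<and>
    w \<in> HG_plus \<and> (\<exists>g. has_weak_laplacian \<Omega>\<^sub>+ w g)}"

text \<open>Equality of the traces on the common side, and of the weak normal traces.\<close>

definition traces_agree :: "(real \<times> real \<Rightarrow> complex) \<Rightarrow> (real \<times> real \<Rightarrow> complex) \<Rightarrow> bool"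
  where "traces_agree v w \<longleftrightarrow>
    (\<exists>g. has_trace \<Omega>\<^sub>- (0, 0) (0, 1) v g \<and> has_trace \<Omega>\<^sub>+ (0, 0) (0, 1) w g)"

definition normal_traces_agree :: "(real \<times> real \<Rightarrow> complex) \<Rightarrow> (real \<times> real \<Rightarrow> complex) \<Rightarrow> bool"
  where "normal_traces_agree u w \<longleftrightarrow> (\<forall>\<phi>\<in>H10 \<Omega>\<^sub>0.
    (LINT x|lborel_on \<Omega>\<^sub>-. (\<Sum>e\<in>Basis. weak_deriv \<Omega>\<^sub>- e u x * weak_deriv \<Omega>\<^sub>0 e \<phi> x)
       + \<phi> x * weak_laplacian \<Omega>\<^sub>- u x) +
    (LINT x|lborel_on \<Omega>\<^sub>+. (\<Sum>e\<in>Basis. weak_deriv \<Omega>\<^sub>+ e w x * weak_deriv \<Omega>\<^sub>0 e \<phi> x)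
       + \<phi> x * weak_laplacian \<Omega>\<^sub>+ w x) = 0)"

definition dom_A :: "state set"
  where "dom_A = {(u, v, w) \<in> Z0. traces_agree v w \<and> normal_traces_agree u w}"

definition A :: "state \<Rightarrow> state"
  where "A = (\<lambda>(u, v, w). (v, weak_laplacian \<Omega>\<^sub>- u, weak_laplacian \<Omega>\<^sub>+ w))"


section \<open>Spectrum and resolvent\<close>

definition shift_A :: "complex \<Rightarrow> state \<Rightarrow> state"  \<comment> \<open>\<open>\<mu> - A\<close>\<close>
  where "shift_A \<mu> = (\<lambda>(u, v, w). case A (u, v, w) of (u', v', w') \<Rightarrow>
    (\<lambda>x. \<mu> * u x - u' x, \<lambda>x. \<mu> * v x - v' x, \<lambda>x. \<mu> * w x - w' x))"

definition R_A :: "complex \<Rightarrow> state \<Rightarrow> state"  \<comment> \<open>\<open>R(\<mu>,A)\<close>; for \<open>\<mu>\<close> outside the spectrum, unique up to \<open>Z_eq\<close>\<close>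
  where "R_A \<mu> f = (SOME z. z \<in> dom_A \<and> Z_eq (shift_A \<mu> z) f)"

definition resolvent_set_A :: "complex set"
  where "resolvent_set_A = {\<mu>.
    (\<forall>f\<in>Z. \<exists>z\<in>dom_A. Z_eq (shift_A \<mu> z) f \<and>
      (\<forall>z'\<in>dom_A. Z_eq (shift_A \<mu> z') f \<longrightarrow> Z_eq z' z)) \<and>
    (\<exists>C. \<forall>f\<in>Z. Z_norm (R_A \<mu> f) \<le> C * Z_norm f)}"

definition spectrum_A :: "complex set"
  where "spectrum_A = - resolvent_set_A"

text \<open>The analogue of \<^const>\<open>onorm\<close> for maps between representatives of elements of \<open>Z\<close>.\<close>

definition Z_onorm :: "(state \<Rightarrow> state) \<Rightarrow> real"
  where "Z_onorm T = (SUP f\<in>Z. Z_norm (T f) / Z_norm f)"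

end

theory Submission
  imports Defs
begin

text \<open>
  Since the functions vanish on the horizontal sides, the equation \<open>(is - A) (u, v, w) = (f, g, h)\<close>
  splits into ordinary differential equations in \<open>x\<close> for the coefficients of
  \<open>sin (k y)\<close>, \<open>k = (n + 1) pi\<close>, coupled at \<open>x = 0\<close>. It is enough to bound the energy of
  one mode by \<open>C s\<^sup>6\<close> times the data of that mode with \<open>C\<close> independent of \<open>k\<close> and \<open>s\<close>; Parseval
  then sums up the estimates, and solvability is the assumption on the spectrum.

  The real part of the equation tested with the solution gives
  \<open>diss \<le> (l data + energy / l) / 2\<close> for all \<open>l > 0\<close>, where \<open>diss\<close> is the dissipation in the heat part.
  The dissipation bounds \<open>w (0)\<close> and, by the multiplier \<open>(1 - x) cnj w'\<close>, also \<open>w' (0)\<close>, which are the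
  Cauchy data of the wave part at the interface. If \<open>k\<^sup>2 > 2 s\<^sup>2\<close> the wave equation is elliptic, and the
  multiplier \<open>cnj u\<close> gives \<open>energy \<le> C (diss + data)\<close>. Otherwise the multipliers \<open>(x + 1) cnj u'\<close> and
  \<open>cnj u\<close> give \<open>energy \<le> C (\<bar>s\<bar>\<^sup>3 diss + s\<^sup>4 data)\<close>, and \<open>l\<close> of the order of \<open>\<bar>s\<bar>\<^sup>3\<close> yields \<open>s\<^sup>6\<close>.
\<close>

section \<open>Absolutely continuous functions on an interval\<close>

text \<open>The data are merely square integrable, so the mode equations hold in the integrated form
  \<open>ac_deriv\<close>: absolute continuity together with an almost everywhere derivative. A
  multiplier argument is then a product rule followed by a pointwise lower bound. The condition on
  the normal traces is available only in weak form. It makes the coefficients of u_x on the left and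
  of w_x on the right pieces of a single absolutely continuous function on (-1,1), and this function
  serves as both \<open>P\<close> and \<open>Q\<close>. In the low-frequency bound, one factor |s|
  comes from the loss k + |s| <= 3 |s| in the estimate of w'(0), and the factor s^2 from bounding
  k^2 |U|^2 and |V|^2 through |P|^2 by Poincare. The loss s^6 concerns squared norms, hence |s|^3
  for the resolvent. Differentiation in y turns sines into cosines, so completeness of both systems
  is needed to recover the full gradient. A sine has no compact support in (0,1); it enters the
  normal trace condition as a limit of cut-off sines whose derivatives stay bounded.\<close>

definition ac_deriv :: "real \<Rightarrow> real \<Rightarrow> (real \<Rightarrow> complex) \<Rightarrow> (real \<Rightarrow> complex) \<Rightarrow> bool"
  where "ac_deriv a b F F' \<longleftrightarrow> set_integrable lborel {a..b} F' \<and>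
    (\<forall>x\<in>{a..b}. (LINT t:{a..x}|lborel. F' t) = F x - F a)"

lemma set_integrable_Icc_sub:
  fixes f :: "real \<Rightarrow> complex"
  assumes "set_integrable lborel {a..b} f" "x \<le> b"
  shows "set_integrable lborel {a..x} f"
  by (rule set_integrable_subset[OF assms(1)]) (use assms(2) in auto)

lemma continuous_on_indef:
  fixes f :: "real \<Rightarrow> complex"
  assumes "set_integrable lborel {a..b} f"
  shows "continuous_on {a..b} (\<lambda>x. LINT t:{a..x}|lborel. f t)"
proof -
  have "f integrable_on {a..b}"
    using assms by (rule set_borel_integral_eq_integral)
  then have "continuous_on {a..b} (\<lambda>x. integral {a..x} f)"
    by (rule indefinite_integral_continuous_1)
  moreover have "integral {a..x} f = (LINT t:{a..x}|lborel. f t)" if "x \<in> {a..b}" for x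
    using set_borel_integral_eq_integral(2)[OF set_integrable_Icc_sub[OF assms, of x]] that by auto
  ultimately show ?thesis
    by (rule continuous_on_eq)
qed

lemma ac_deriv_continuous:
  assumes "ac_deriv a b F F'"
  shows "continuous_on {a..b} F"
proof -
  have "continuous_on {a..b} (\<lambda>x. F a + (LINT t:{a..x}|lborel. F' t))"
    using assms by (intro continuous_intros continuous_on_indef) (auto simp: ac_deriv_def)
  moreover have "F x = F a + (LINT t:{a..x}|lborel. F' t)" if "x \<in> {a..b}" for x
    using assms that unfolding ac_deriv_def by auto
  ultimately show ?thesis
    by (metis (no_types, lifting) continuous_on_eq)
qed

lemma set_integrable_mult_continuous:
  fixes f g :: "real \<Rightarrow> complex"
  assumes "set_integrable lborel {a..b} f" "continuous_on {a..b} g"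
  shows "set_integrable lborel {a..b} (\<lambda>x. f x * g x)"
proof -
  have m: "set_borel_measurable lborel {a..b} g"
    using assms(2) by (auto simp: set_borel_measurable_def intro!: borel_measurable_continuous_on_indicator)
  obtain B where B: "\<And>x. x \<in> {a..b} \<Longrightarrow> norm (g x) \<le> B"
    using compact_imp_bounded[OF compact_continuous_image[OF assms(2)]]
    by (force simp: bounded_iff)
  have "integrable lborel (\<lambda>x. (indicator {a..b} x *\<^sub>R f x) * (indicator {a..b} x *\<^sub>R g x))"
  proof (rule Bochner_Integration.integrable_bound)
    show "integrable lborel (\<lambda>x. B *\<^sub>R (indicator {a..b} x *\<^sub>R f x))"
      using assms(1) unfolding set_integrable_def by (rule integrable_scaleR_right)
    show "(\<lambda>x. (indicator {a..b} x *\<^sub>R f x) * (indicator {a..b} x *\<^sub>R g x)) \<in> borel_measurable lborel"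
      using assms(1) m by (intro borel_measurable_times) (auto simp: set_integrable_def set_borel_measurable_def)
    show "AE x in lborel. norm ((indicator {a..b} x *\<^sub>R f x) * (indicator {a..b} x *\<^sub>R g x))
      \<le> norm (B *\<^sub>R (indicator {a..b} x *\<^sub>R f x))"
    proof (rule AE_I2)
      fix x
      show "norm ((indicator {a..b} x *\<^sub>R f x) * (indicator {a..b} x *\<^sub>R g x))
      \<le> norm (B *\<^sub>R (indicator {a..b} x *\<^sub>R f x))"
        using B[of x] by (auto simp: indicator_def norm_mult mult.commute[of "norm (f x)"] intro!: mult_right_mono)
    qed
  qed
  then show ?thesis
    unfolding set_integrable_def
    by (rule Bochner_Integration.integrable_cong[THEN iffD1, rotated 2]) (auto simp: indicator_def)
qed

text \<open>Fubini: the product is the integral of \<open>\<alpha> s * \<beta> t\<close> over the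
  square, and cutting the square along its diagonal leaves one iterated integral for each term of
  the product rule.\<close>

lemma indef_mult:
  fixes \<alpha> \<beta> :: "real \<Rightarrow> complex"
  assumes "set_integrable lborel {a..x} \<alpha>" "set_integrable lborel {a..x} \<beta>"
  shows "(LINT t:{a..x}|lborel. \<alpha> t) * (LINT t:{a..x}|lborel. \<beta> t) =
    (LINT t:{a..x}|lborel. \<alpha> t * (LINT r:{a..t}|lborel. \<beta> r) + (LINT r:{a..t}|lborel. \<alpha> r) * \<beta> t)"
proof -
  define A where "A = (\<lambda>t. indicator {a..x} t *\<^sub>R \<alpha> t)"
  define B where "B = (\<lambda>t. indicator {a..x} t *\<^sub>R \<beta> t)"
  have iA: "integrable lborel A" and iB: "integrable lborel B"
    using assms by (auto simp: A_def B_def set_integrable_def)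
  have mA[measurable]: "A \<in> borel_measurable borel" and mB[measurable]: "B \<in> borel_measurable borel"
    using iA iB by auto
  have A0: "(LINT r:{a..t}|lborel. \<alpha> r) = (LINT r:{..t}|lborel. A r)" if "t \<in> {a..x}" for t
    unfolding set_lebesgue_integral_def A_def
    by (intro Bochner_Integration.integral_cong) (use that in \<open>auto simp: indicator_def\<close>)
  have B0: "(LINT r:{a..t}|lborel. \<beta> r) = (LINT r:{..t}|lborel. B r)" if "t \<in> {a..x}" for t
    unfolding set_lebesgue_integral_def B_def
    by (intro Bochner_Integration.integral_cong) (use that in \<open>auto simp: indicator_def\<close>)
  have iAB: "integrable (lborel \<Otimes>\<^sub>M lborel) (\<lambda>(s,t). A s * B t)"
    using iA iB by (intro lborel_pair.Fubini_integrable)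
       (auto simp: norm_mult intro!: integrable_mult_left)
  have i1: "integrable (lborel \<Otimes>\<^sub>M lborel) (\<lambda>(s,t). indicator {..s} t *\<^sub>R (A s * B t))"
    by (rule Bochner_Integration.integrable_bound[OF iAB])
       (auto simp: indicator_def intro!: AE_I2 )
  have i2: "integrable (lborel \<Otimes>\<^sub>M lborel) (\<lambda>(s,t). indicator {..<t} s *\<^sub>R (A s * B t))"
    by (rule Bochner_Integration.integrable_bound[OF iAB])
       (auto simp: indicator_def intro!: AE_I2 )
  have "(LINT t|lborel. A t) * (LINT t|lborel. B t) = (LINT s|lborel. (LINT t|lborel. A s * B t))"
    by simp
  also have "\<dots> = (LINT p|(lborel \<Otimes>\<^sub>M lborel). (\<lambda>(s,t). A s * B t) p)"
    using lborel_pair.integral_fst'[OF iAB] by simp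
  \<comment> \<open>The diagonal is counted with the first triangle only, so the two indicators add
    up to one everywhere; the second triangle is closed again below because points are null
    sets.\<close>
  also have "\<dots> = (LINT p|(lborel \<Otimes>\<^sub>M lborel). (\<lambda>(s,t). indicator {..s} t *\<^sub>R (A s * B t)) p
       + (\<lambda>(s,t). indicator {..<t} s *\<^sub>R (A s * B t)) p)"
    by (intro Bochner_Integration.integral_cong) (auto simp: indicator_def)
  also have "\<dots> = (LINT p|(lborel \<Otimes>\<^sub>M lborel). (\<lambda>(s,t). indicator {..s} t *\<^sub>R (A s * B t)) p)
       + (LINT p|(lborel \<Otimes>\<^sub>M lborel). (\<lambda>(s,t). indicator {..<t} s *\<^sub>R (A s * B t)) p)"
    by (rule Bochner_Integration.integral_add[OF i1 i2])
  also have "(LINT p|(lborel \<Otimes>\<^sub>M lborel). (\<lambda>(s,t). indicator {..s} t *\<^sub>R (A s * B t)) p)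
      = (LINT s|lborel. (LINT t|lborel. indicator {..s} t *\<^sub>R (A s * B t)))"
    using lborel_pair.integral_fst'[OF i1] by simp
  also have "\<dots> = (LINT s|lborel. A s * (LINT t:{..s}|lborel. B t))"
    by (simp add: set_lebesgue_integral_def flip: mult_scaleR_right)
  also have "(LINT p|(lborel \<Otimes>\<^sub>M lborel). (\<lambda>(s,t). indicator {..<t} s *\<^sub>R (A s * B t)) p)
      = (LINT t|lborel. (LINT s|lborel. indicator {..<t} s *\<^sub>R (A s * B t)))"
    using lborel_pair.integral_snd[OF i2] by (simp add: case_prod_beta')
  also have "\<dots> = (LINT t|lborel. (LINT s:{..<t}|lborel. A s) * B t)"
    by (simp add: set_lebesgue_integral_def flip: mult_scaleR_left)
  also have "\<dots> = (LINT t|lborel. (LINT s:{..t}|lborel. A s) * B t)"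
  proof -
    have "(LINT s:{..<t}|lborel. A s) = (LINT s:{..t}|lborel. A s)" for t
      unfolding set_lebesgue_integral_def
    proof (rule integral_cong_AE)
      show "AE s in lborel. indicator {..<t} s *\<^sub>R A s = indicator {..t} s *\<^sub>R A s"
        using AE_lborel_singleton[of t] by eventually_elim (auto simp: indicator_def)
    qed auto
    then show ?thesis by simp
  qed
  also have "(LINT s|lborel. A s * (LINT t:{..s}|lborel. B t)) + (LINT t|lborel. (LINT s:{..t}|lborel. A s) * B t)
     = (LINT s|lborel. A s * (LINT t:{..s}|lborel. B t) + (LINT r:{..s}|lborel. A r) * B s)"
  proof (rule Bochner_Integration.integral_add[symmetric])
    show "integrable lborel (\<lambda>s. A s * (LINT t:{..s}|lborel. B t))"
      using lborel_pair.integrable_fst'[OF i1]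
      by (simp add: set_lebesgue_integral_def flip: mult_scaleR_right)
    have "integrable lborel (\<lambda>t. (LINT s:{..<t}|lborel. A s) * B t)"
      using lborel_pair.integrable_snd[OF i2]
      by (simp add: set_lebesgue_integral_def case_prod_beta' flip: mult_scaleR_left)
    moreover have "(LINT s:{..<t}|lborel. A s) = (LINT s:{..t}|lborel. A s)" for t
      unfolding set_lebesgue_integral_def
    proof (rule integral_cong_AE)
      show "AE s in lborel. indicator {..<t} s *\<^sub>R A s = indicator {..t} s *\<^sub>R A s"
        using AE_lborel_singleton[of t] by eventually_elim (auto simp: indicator_def)
    qed auto
    ultimately show "integrable lborel (\<lambda>t. (LINT s:{..t}|lborel. A s) * B t)" by simp
  qed
  also have "\<dots> = (LINT t:{a..x}|lborel. \<alpha> t * (LINT r:{a..t}|lborel. \<beta> r) + (LINT r:{a..t}|lborel. \<alpha> r) * \<beta> t)"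
    unfolding set_lebesgue_integral_def[where A="{a..x}" and f="\<lambda>t. \<alpha> t * (LINT r:{a..t}|lborel. \<beta> r) +
        (LINT r:{a..t}|lborel. \<alpha> r) * \<beta> t"]
  proof (intro Bochner_Integration.integral_cong refl)
    fix s
    show "A s * (LINT t:{..s}|lborel. B t) + (LINT r:{..s}|lborel. A r) * B s = indicator {a..x} s *\<^sub>R
        (\<alpha> s * (LINT r:{a..s}|lborel. \<beta> r) + (LINT r:{a..s}|lborel. \<alpha> r) * \<beta> s)"
      using A0[of s] B0[of s] by (cases "s \<in> {a..x}") (auto simp: A_def B_def)
  qed
  finally show ?thesis
    by (simp add: A_def B_def set_lebesgue_integral_def)
qed

text \<open>Splitting off the initial values \<open>F a\<close> and \<open>G a\<close> leaves a
  product of two indefinite integrals, which is the case of \<open>indef_mult\<close>.\<close>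

lemma ac_deriv_mult:
  assumes "ac_deriv a b F F'" "ac_deriv a b G G'"
  shows "ac_deriv a b (\<lambda>x. F x * G x) (\<lambda>x. F' x * G x + F x * G' x)"
proof -
  have iF: "set_integrable lborel {a..b} F'" and iG: "set_integrable lborel {a..b} G'"
    using assms by (auto simp: ac_deriv_def)
  have cF: "continuous_on {a..b} F" and cG: "continuous_on {a..b} G"
    using assms ac_deriv_continuous by auto
  have i1: "set_integrable lborel {a..b} (\<lambda>x. F' x * G x)"
    by (rule set_integrable_mult_continuous[OF iF cG])
  have i2: "set_integrable lborel {a..b} (\<lambda>x. F x * G' x)"
    using set_integrable_mult_continuous[OF iG cF] by (simp add: mult.commute)
  have "(LINT t:{a..x}|lborel. F' t * G t + F t * G' t) = F x * G x - F a * G a" if x: "x \<in> {a..b}" for x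
  proof -
    have ix: "set_integrable lborel {a..x} F'" "set_integrable lborel {a..x} G'"
      using set_integrable_Icc_sub iF iG x by auto
    have Fx: "F t = F a + (LINT r:{a..t}|lborel. F' r)" if "t \<in> {a..x}" for t
      using assms(1) that x by (auto simp: ac_deriv_def)
    have Gx: "G t = G a + (LINT r:{a..t}|lborel. G' r)" if "t \<in> {a..x}" for t
      using assms(2) that x by (auto simp: ac_deriv_def)
    let ?f = "\<lambda>t. (LINT r:{a..t}|lborel. F' r)" and ?g = "\<lambda>t. (LINT r:{a..t}|lborel. G' r)"
    have c: "continuous_on {a..x} ?f" "continuous_on {a..x} ?g"
      using continuous_on_indef[OF ix(1)] continuous_on_indef[OF ix(2)] by auto
    have j: "set_integrable lborel {a..x} (\<lambda>t. F' t * ?g t + ?f t * G' t)"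
      using set_integrable_mult_continuous[OF ix(1) c(2)] set_integrable_mult_continuous[OF ix(2) c(1)]
      by (intro set_integral_add) (simp_all add: mult.commute)
    have "(LINT t:{a..x}|lborel. F' t * G t + F t * G' t) =
      (LINT t:{a..x}|lborel. (F' t * ?g t + ?f t * G' t) + (G a * F' t + F a * G' t))"

    proof (intro set_lebesgue_integral_cong allI impI)
      fix t assume "t \<in> {a..x}"
      then show "F' t * G t + F t * G' t = (F' t * ?g t + ?f t * G' t) + (G a * F' t + F a * G' t)"
        by (simp add: Fx[of t] Gx[of t] algebra_simps)
    qed simp
    also have "\<dots> = (LINT t:{a..x}|lborel. F' t * ?g t + ?f t * G' t)
        + (G a * (LINT t:{a..x}|lborel. F' t) + F a * (LINT t:{a..x}|lborel. G' t))"
      using ix j by (subst set_integral_add; simp)+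
    also have "\<dots> = ?f x * ?g x + (G a * ?f x + F a * ?g x)"
      using indef_mult[OF ix] by simp
    finally show ?thesis
      using Fx[of x] Gx[of x] x by (simp add: algebra_simps)
  qed
  then show ?thesis
    unfolding ac_deriv_def using i1 i2 by (auto intro!: set_integral_add)
qed

lemma ac_deriv_add:
  assumes "ac_deriv a b F F'" "ac_deriv a b G G'"
  shows "ac_deriv a b (\<lambda>x. F x + G x) (\<lambda>x. F' x + G' x)"
proof -
  have "(LINT t:{a..x}|lborel. F' t + G' t) = (LINT t:{a..x}|lborel. F' t) + (LINT t:{a..x}|lborel. G' t)"
    if "x \<in> {a..b}" for x
    using assms that by (intro set_integral_add) (auto simp: ac_deriv_def intro: set_integrable_Icc_sub)
    then show ?thesis
    using assms unfolding ac_deriv_def by (auto intro!: set_integral_add)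
qed

lemma ac_deriv_cmult:
  assumes "ac_deriv a b F F'"
  shows "ac_deriv a b (\<lambda>x. c * F x) (\<lambda>x. c * F' x)"
  using assms unfolding ac_deriv_def by (auto simp: right_diff_distrib)

lemma ac_deriv_cnj:
  assumes "ac_deriv a b F F'"
  shows "ac_deriv a b (\<lambda>x. cnj (F x)) (\<lambda>x. cnj (F' x))"
proof -
  have "(LINT t:{a..x}|lborel. cnj (F' t)) = cnj (LINT t:{a..x}|lborel. F' t)" for x
    unfolding set_lebesgue_integral_def using Bochner_Integration.integral_cnj[where M=lborel and f="\<lambda>t.
        indicator {a..x} t *\<^sub>R F' t"] by simp
  moreover have "set_integrable lborel {a..b} (\<lambda>t. cnj (F' t))"
    using assms integrable_cnj[of lborel "\<lambda>t. indicator {a..b} t *\<^sub>R F' t"]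
    by (auto simp: ac_deriv_def set_integrable_def)
  ultimately show ?thesis
    using assms unfolding ac_deriv_def by simp
qed

lemma ac_deriv_C1:
  assumes "\<And>x. (F has_vector_derivative F' x) (at x)" "continuous_on {a..b} F'"
  shows "ac_deriv a b F F'"
proof -
  have "(LINT t:{a..x}|lborel. F' t) = F x - F a" if "x \<in> {a..b}" for x
    unfolding set_lebesgue_integral_def
    using integral_FTC_Icc[of a x F F'] that assms has_vector_derivative_at_within
      continuous_on_subset[OF assms(2)] by fastforce
  then show ?thesis
    using assms unfolding ac_deriv_def set_integrable_def
    by (auto intro!: borel_integrable_compact)
qed

lemma ac_deriv_integral:
  assumes "ac_deriv a b F F'" "a \<le> b"
  shows "(LINT t:{a..b}|lborel. F' t) = F b - F a"
  using assms by (auto simp: ac_deriv_def)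

lemma ac_deriv_const: "ac_deriv a b (\<lambda>x. c) (\<lambda>x. 0)"
  by (simp add: ac_deriv_def set_lebesgue_integral_def set_integrable_def)

lemma ac_deriv_ident: "ac_deriv a b (\<lambda>x. complex_of_real x) (\<lambda>x. 1)"
  by (rule ac_deriv_C1) (auto intro!: derivative_eq_intros)

text \<open>The frame of all energy estimates: \<open>F\<close> is a product of the solution with a
  multiplier, \<open>B\<close> collects what Young's inequality leaves of \<open>Re (F' x)\<close>,
  and the result compares integrals with boundary values.\<close>

lemma ac_deriv_lower:
  assumes "ac_deriv a b F F'" "a \<le> b" "set_integrable lborel {a..b} B"
    and "\<And>x. x \<in> {a..b} \<Longrightarrow> B x \<le> Re (F' x)"
  shows "(LINT x:{a..b}|lborel. B x) \<le> Re (F b) - Re (F a)"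
proof -
  have i: "integrable lborel (\<lambda>x. indicator {a..b} x *\<^sub>R F' x)"
    using assms(1) by (simp add: ac_deriv_def set_integrable_def)
  have eq: "(\<lambda>x. indicator {a..b} x *\<^sub>R Re (F' x)) = (\<lambda>x. Re (indicator {a..b} x *\<^sub>R F' x))"
    by (auto simp: indicator_def)
  have i': "set_integrable lborel {a..b} (\<lambda>x. Re (F' x))"
    unfolding set_integrable_def eq using i by (rule integrable_Re)
  have "(LINT x:{a..b}|lborel. Re (F' x)) = Re (LINT x:{a..b}|lborel. F' x)"
    unfolding set_lebesgue_integral_def eq using integral_Re[OF i] .
  also have "\<dots> = Re (F b) - Re (F a)"
    using ac_deriv_integral[OF assms(1,2)] by simp
  finally show ?thesis
    using set_integral_mono[OF assms(3) i' assms(4)] by simp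
qed

lemma set_integrable_uminus [simp]:
  fixes f :: "real \<Rightarrow> real"
  shows "set_integrable M S f \<Longrightarrow> set_integrable M S (\<lambda>x. - f x)"
  unfolding set_integrable_def by (subst scaleR_minus_right) (rule integrable_minus)

text \<open>Young's inequality with a free weight, from
  \<open>(l * cmod z - cmod w)\<^sup>2 \<ge> 0\<close>. The choice of \<open>l\<close> decides which
  factor is absorbed.\<close>

lemma Re_mult_cnj_le:
  assumes "l > 0"
  shows "\<bar>Re (z * cnj w)\<bar> \<le> l / 2 * (cmod z)\<^sup>2 + 1 / (2 * l) * (cmod w)\<^sup>2"
proof -
  have "0 \<le> (l * cmod z - cmod w)\<^sup>2" by simp
  then have "cmod z * cmod w \<le> l / 2 * (cmod z)\<^sup>2 + 1 / (2 * l) * (cmod w)\<^sup>2"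
    using assms by (simp add: field_simps power2_eq_square)
  moreover have "\<bar>Re (z * cnj w)\<bar> \<le> cmod z * cmod w"
    using abs_Re_le_cmod[of "z * cnj w"] by (simp add: norm_mult)
  ultimately show ?thesis by linarith
qed

lemma Re_mult_cnj_self: "Re (z * cnj z) = (cmod z)\<^sup>2"
  unfolding cmod_power2 by (simp add: power2_eq_square)

lemma set_integrable_cmod_square:
  assumes "continuous_on {a..b::real} F"
  shows "set_integrable lborel {a..b} (\<lambda>x. (cmod (F x))\<^sup>2)"
  unfolding set_integrable_def
  by (intro borel_integrable_compact continuous_intros assms) auto

section \<open>The estimate for one mode\<close>

abbreviation nsq :: "real \<Rightarrow> real \<Rightarrow> (real \<Rightarrow> complex) \<Rightarrow> real"
  where "nsq a b f \<equiv> (LINT x:{a..b}|lborel. (cmod (f x))\<^sup>2)"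

lemma nsq_nonneg: "0 \<le> nsq a b f"
  unfolding set_lebesgue_integral_def by simp

text \<open>
  The coefficients of \<open>sin (k y)\<close> in the solution and the data: \<open>U\<close>, \<open>W\<close> belong to \<open>u\<close>, \<open>w\<close>, their
  derivatives \<open>P\<close>, \<open>Q\<close> to \<open>u_x\<close>, \<open>w_x\<close>, and \<open>f\<close>, \<open>f2\<close>, \<open>h\<close> to the three components of the data. The
  velocity \<open>v = is u - f\<close> is eliminated; its coefficient is \<open>V\<close> below.
\<close>

locale mode =
  fixes k s :: real and U P f f' f2 W Q h :: "real \<Rightarrow> complex"
  assumes k1: "1 \<le> k" and s1: "1 \<le> \<bar>s\<bar>"
    and U: "ac_deriv (-1) 0 U P" and U0: "U (-1) = 0"
    and P: "ac_deriv (-1) 0 P (\<lambda>x. (k\<^sup>2 - s\<^sup>2) * U x - (\<i> * s * f x + f2 x))"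
    and f: "ac_deriv (-1) 0 f f'" and f0: "f (-1) = 0"
    and W: "ac_deriv 0 1 W Q" and W1: "W 1 = 0"
    and Q: "ac_deriv 0 1 Q (\<lambda>x. (k\<^sup>2 + \<i> * s) * W x - h x)"
    and coupling1: "\<i> * s * U 0 - f 0 = W 0" and coupling2: "P 0 = Q 0"
    and f'2: "set_integrable lborel {-1..0} (\<lambda>x. (cmod (f' x))\<^sup>2)"
    and f22: "set_integrable lborel {-1..0} (\<lambda>x. (cmod (f2 x))\<^sup>2)"
    and h2: "set_integrable lborel {0..1} (\<lambda>x. (cmod (h x))\<^sup>2)"
begin

text \<open>\<open>data\<close> and \<open>energy\<close> are the shares of one mode in the squared
  norms of the data and of the solution; the weight \<open>k\<^sup>2\<close> stands for the
  y-derivative. \<open>diss\<close> is the share in the squared gradient norm of w.\<close>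

definition "V = (\<lambda>x. \<i> * s * U x - f x)"
definition "data = nsq (-1) 0 f' + k\<^sup>2 * nsq (-1) 0 f + nsq (-1) 0 f2 + nsq 0 1 h"
definition "energy = nsq (-1) 0 P + k\<^sup>2 * nsq (-1) 0 U + nsq (-1) 0 V + nsq 0 1 W"
definition "diss = nsq 0 1 Q + k\<^sup>2 * nsq 0 1 W"

lemma V: "ac_deriv (-1) 0 V (\<lambda>x. \<i> * s * P x - f' x)"
  using ac_deriv_add[OF ac_deriv_cmult[OF U, of "\<i> * s"] ac_deriv_cmult[OF f, of "-1"]]
  by (simp add: V_def)

lemmas conts = ac_deriv_continuous[OF U] ac_deriv_continuous[OF P] ac_deriv_continuous[OF f]
  ac_deriv_continuous[OF V] ac_deriv_continuous[OF W] ac_deriv_continuous[OF Q]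

lemmas sq_int = conts[THEN set_integrable_cmod_square] f'2 f22 h2

lemma k_sq: "1 \<le> k\<^sup>2" and s_sq: "1 \<le> s\<^sup>2"
  using k1 s1 by (auto simp: abs_le_square_iff[of 1, simplified])

lemma data_parts:
  shows "nsq (-1) 0 f' + k\<^sup>2 * nsq (-1) 0 f \<le> data" "nsq (-1) 0 f \<le> data"
    "nsq (-1) 0 f + nsq (-1) 0 f2 \<le> data" "nsq 0 1 h \<le> data" "0 \<le> data"
proof -
  have "1 * nsq (-1) 0 f \<le> k\<^sup>2 * nsq (-1) 0 f"
    by (intro mult_right_mono k_sq nsq_nonneg)
  then show "nsq (-1) 0 f' + k\<^sup>2 * nsq (-1) 0 f \<le> data" "nsq (-1) 0 f \<le> data"
    "nsq (-1) 0 f + nsq (-1) 0 f2 \<le> data" "nsq 0 1 h \<le> data" "0 \<le> data"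
    using nsq_nonneg[of "-1" 0 f'] nsq_nonneg[of "-1" 0 f] nsq_nonneg[of "-1" 0 f2] nsq_nonneg[of 0 1 h]
    by (auto simp: data_def)
qed

lemma diss_parts: "nsq 0 1 W \<le> diss" "0 \<le> diss"
proof -
  have "1 * nsq 0 1 W \<le> k\<^sup>2 * nsq 0 1 W"
    by (intro mult_right_mono k_sq nsq_nonneg)
  then show "nsq 0 1 W \<le> diss" "0 \<le> diss"
    using nsq_nonneg[of 0 1 W] nsq_nonneg[of 0 1 Q] by (auto simp: diss_def)
qed

text \<open>The heat equation is tested with \<open>cnj W\<close> and the wave equation with
  \<open>cnj V\<close>. By the coupling conditions both leave the same interface term, with opposite
  signs, and it cancels in the sum.\<close>

lemma dissipation:
  assumes l: "l > 0"
  shows "diss \<le> (l * data + energy / l) / 2"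
proof -
  let ?BR = "\<lambda>x. (cmod (Q x))\<^sup>2 + k\<^sup>2 * (cmod (W x))\<^sup>2 - (l / 2) * (cmod (h x))\<^sup>2 - (1 / (2*l)) * (cmod (W x))\<^sup>2"
  let ?BL = "\<lambda>x. - ((l/2) * (cmod (f' x))\<^sup>2 + (1/(2*l)) * (cmod (P x))\<^sup>2 + (l/2) * k\<^sup>2 * (cmod (f x))\<^sup>2
      + (1/(2*l)) * k\<^sup>2 * (cmod (U x))\<^sup>2 + (l/2) * (cmod (f2 x))\<^sup>2 + (1/(2*l)) * (cmod (V x))\<^sup>2)"
  have iR: "set_integrable lborel {0..1} ?BR"
    by (intro set_integral_diff set_integral_add set_integrable_mult_right impI sq_int)
  have "(LINT x:{0..1}|lborel. ?BR x) \<le> Re (Q 1 * cnj (W 1)) - Re (Q 0 * cnj (W 0))"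
  proof (rule ac_deriv_lower[OF ac_deriv_mult[OF Q ac_deriv_cnj[OF W]] _ iR])
    fix x :: real assume "x \<in> {0..1}"
    have "\<bar>Re (h x * cnj (W x))\<bar> \<le> l / 2 * (cmod (h x))\<^sup>2 + 1 / (2 * l) * (cmod (W x))\<^sup>2"
      by (rule Re_mult_cnj_le[OF l])
    moreover have "Re (((k\<^sup>2 + \<i> * s) * W x - h x) * cnj (W x) + Q x * cnj (Q x)) =
       k\<^sup>2 * (cmod (W x))\<^sup>2 - Re (h x * cnj (W x)) + (cmod (Q x))\<^sup>2"
      unfolding cmod_power2 by (simp add: algebra_simps power2_eq_square)
    ultimately show "?BR x \<le> Re (((k\<^sup>2 + \<i> * s) * W x - h x) * cnj (W x) + Q x * cnj (Q x))"
      by linarith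
  qed simp
  moreover have "(LINT x:{0..1}|lborel. ?BR x) = diss - (l/2) * nsq 0 1 h - (1/(2*l)) * nsq 0 1 W"
    unfolding diss_def using sq_int by simp
  ultimately have R: "diss - (l/2) * nsq 0 1 h - (1/(2*l)) * nsq 0 1 W \<le> - Re (Q 0 * cnj (W 0))"
    by (simp add: W1)
  have iL: "set_integrable lborel {-1..0} ?BL"
    by (intro set_integrable_uminus set_integral_add set_integrable_mult_right impI sq_int)
  have "(LINT x:{-1..0}|lborel. ?BL x) \<le> Re (P 0 * cnj (V 0)) - Re (P (-1) * cnj (V (-1)))"
  proof (rule ac_deriv_lower[OF ac_deriv_mult[OF P ac_deriv_cnj[OF V]] _ iL])
    fix x :: real assume "x \<in> {-1..0}"
    have a: "\<bar>Re (f' x * cnj (P x))\<bar> \<le> l / 2 * (cmod (f' x))\<^sup>2 + 1 / (2 * l) * (cmod (P x))\<^sup>2"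
      by (rule Re_mult_cnj_le[OF l])
    have "\<bar>Re (f x * cnj (U x))\<bar> \<le> l / 2 * (cmod (f x))\<^sup>2 + 1 / (2 * l) * (cmod (U x))\<^sup>2"
      by (rule Re_mult_cnj_le[OF l])
    then have "k\<^sup>2 * \<bar>Re (f x * cnj (U x))\<bar> \<le> k\<^sup>2 * (l / 2 * (cmod (f x))\<^sup>2 + 1 / (2 * l) * (cmod (U x))\<^sup>2)"
      by (rule mult_left_mono) simp
    then have b: "k\<^sup>2 * \<bar>Re (f x * cnj (U x))\<bar> \<le> (l/2) * k\<^sup>2 * (cmod (f x))\<^sup>2 + (1/(2*l)) * k\<^sup>2 * (cmod (U x))\<^sup>2"
      by (simp only: distrib_left mult_ac)
    have c: "\<bar>Re (f2 x * cnj (V x))\<bar> \<le> l / 2 * (cmod (f2 x))\<^sup>2 + 1 / (2 * l) * (cmod (V x))\<^sup>2"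
      by (rule Re_mult_cnj_le[OF l])
    \<comment> \<open>The second derivative of \<open>U\<close> is
      \<open>k\<^sup>2 * U x + \<i> * s * V x - f2 x\<close>. The terms with |U|^2, |V|^2 and |P|^2
      carry a purely imaginary factor and drop out of the real part, so only pairings with the data
      survive.\<close>
    have d: "Re (((k\<^sup>2 - s\<^sup>2) * U x - (\<i> * s * f x + f2 x)) * cnj (V x) + P x * cnj (\<i> * s * P x - f' x))
       = - Re (f' x * cnj (P x)) - k\<^sup>2 * Re (f x * cnj (U x)) - Re (f2 x * cnj (V x))"
      unfolding V_def by (simp add: algebra_simps power2_eq_square)
    have "- (k\<^sup>2 * \<bar>Re (f x * cnj (U x))\<bar>) \<le> - (k\<^sup>2 * Re (f x * cnj (U x)))"
      by (simp add: mult_left_mono)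
    then show "?BL x \<le> Re (((k\<^sup>2 - s\<^sup>2) * U x - (\<i> * s * f x + f2 x)) * cnj (V x) + P x * cnj (\<i> * s * P x - f' x))"
      unfolding d using a b c by linarith
  qed simp
  moreover have "(LINT x:{-1..0}|lborel. ?BL x) = - ((l/2) * nsq (-1) 0 f' + (1/(2*l)) * nsq (-1) 0 P + (l/2) *
      k\<^sup>2 * nsq (-1) 0 f
      + (1/(2*l)) * k\<^sup>2 * nsq (-1) 0 U + (l/2) * nsq (-1) 0 f2 + (1/(2*l)) * nsq (-1) 0 V)"
    using sq_int by (simp add: set_integral_uminus)
  moreover have "V (-1) = 0" "V 0 = W 0"
    using U0 f0 coupling1 by (simp_all add: V_def)
  ultimately have "- ((l/2) * nsq (-1) 0 f' + (1/(2*l)) * nsq (-1) 0 P + (l/2) * k\<^sup>2 * nsq (-1) 0 f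
      + (1/(2*l)) * k\<^sup>2 * nsq (-1) 0 U + (l/2) * nsq (-1) 0 f2 + (1/(2*l)) * nsq (-1) 0 V) \<le> Re (Q 0 * cnj (W 0))"
    using coupling2 by simp
  with R show ?thesis
    using l unfolding data_def energy_def by (simp add: field_simps)
qed

text \<open>Integrate the derivative 2 Re (W cnj Q) of |W|^2 up to the zero at x = 1. The Young
  weight \<open>k\<close> makes the two terms proportional to those of \<open>diss\<close>, and this
  gains the factor \<open>k\<close> on the left.\<close>

lemma W0_bound: "k * (cmod (W 0))\<^sup>2 \<le> diss"
proof -
  let ?B = "\<lambda>x. - (k * (cmod (W x))\<^sup>2 + (1/k) * (cmod (Q x))\<^sup>2)"
  have i: "set_integrable lborel {0..1} ?B"
    by (intro set_integrable_uminus set_integral_add set_integrable_mult_right impI sq_int)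
  have "(LINT x:{0..1}|lborel. ?B x) \<le> Re (W 1 * cnj (W 1)) - Re (W 0 * cnj (W 0))"
  proof (rule ac_deriv_lower[OF ac_deriv_mult[OF W ac_deriv_cnj[OF W]] _ i])
    fix x :: real assume "x \<in> {0..1}"
    have "\<bar>Re (W x * cnj (Q x))\<bar> \<le> k / 2 * (cmod (W x))\<^sup>2 + 1 / (2 * k) * (cmod (Q x))\<^sup>2"
      using k1 by (intro Re_mult_cnj_le) auto
    moreover have "Re (Q x * cnj (W x) + W x * cnj (Q x)) = 2 * Re (W x * cnj (Q x))"
      by (simp add: algebra_simps)
    moreover have "1 / (2 * k) * (cmod (Q x))\<^sup>2 = (1 / k * (cmod (Q x))\<^sup>2) / 2"
      by simp
    ultimately show "?B x \<le> Re (Q x * cnj (W x) + W x * cnj (Q x))"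
      by linarith
  qed simp
  moreover have "(LINT x:{0..1}|lborel. ?B x) = - (k * nsq 0 1 W + (1/k) * nsq 0 1 Q)"
    using sq_int by (simp add: set_integral_uminus)
  moreover have "Re (W 0 * cnj (W 0)) = (cmod (W 0))\<^sup>2"
    by (rule Re_mult_cnj_self)
  ultimately have "(cmod (W 0))\<^sup>2 \<le> k * nsq 0 1 W + (1/k) * nsq 0 1 Q"
    using W1 by simp
  then have "k * (cmod (W 0))\<^sup>2 \<le> k * (k * nsq 0 1 W + (1/k) * nsq 0 1 Q)"
    using k1 by (intro mult_left_mono) auto
  also have "\<dots> = diss"
    using k1 by (simp add: diss_def distrib_left power2_eq_square)
  finally show ?thesis .
qed

text \<open>The mirror image of \<open>W0_bound\<close>. Since \<open>f\<close> vanishes at the left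
  end, the primitive is taken with a minus sign so that a lower bound for its derivative bounds the
  value at 0.\<close>

lemma f0_bound: "k * (cmod (f 0))\<^sup>2 \<le> data"
proof -
  let ?B = "\<lambda>x. - (k * (cmod (f x))\<^sup>2 + (1/k) * (cmod (f' x))\<^sup>2)"
  have c: "ac_deriv (-1) 0 (\<lambda>x. - (f x * cnj (f x))) (\<lambda>x. - (f' x * cnj (f x) + f x * cnj (f' x)))"
    using ac_deriv_cmult[OF ac_deriv_mult[OF f ac_deriv_cnj[OF f]], of "-1"] by simp
  have i: "set_integrable lborel {-1..0} ?B"
    by (intro set_integrable_uminus set_integral_add set_integrable_mult_right impI sq_int)
  have "(LINT x:{-1..0}|lborel. ?B x) \<le> Re (- (f 0 * cnj (f 0))) - Re (- (f (-1) * cnj (f (-1))))"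
  proof (rule ac_deriv_lower[OF c _ i])
    fix x :: real assume "x \<in> {-1..0}"
    have "\<bar>Re (f x * cnj (f' x))\<bar> \<le> k / 2 * (cmod (f x))\<^sup>2 + 1 / (2 * k) * (cmod (f' x))\<^sup>2"
      using k1 by (intro Re_mult_cnj_le) auto
    moreover have "Re (- (f' x * cnj (f x) + f x * cnj (f' x))) = - 2 * Re (f x * cnj (f' x))"
      by (simp add: algebra_simps)
    moreover have "1 / (2 * k) * (cmod (f' x))\<^sup>2 = (1 / k * (cmod (f' x))\<^sup>2) / 2"
      by simp
    ultimately show "?B x \<le> Re (- (f' x * cnj (f x) + f x * cnj (f' x)))"
      by linarith
  qed simp
  moreover have "(LINT x:{-1..0}|lborel. ?B x) = - (k * nsq (-1) 0 f + (1/k) * nsq (-1) 0 f')"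
    using sq_int by (simp add: set_integral_uminus)
  moreover have "Re (- (f 0 * cnj (f 0))) = - (cmod (f 0))\<^sup>2"
    by (simp only: uminus_complex.sel Re_mult_cnj_self)
  ultimately have "(cmod (f 0))\<^sup>2 \<le> k * nsq (-1) 0 f + (1/k) * nsq (-1) 0 f'"
    using f0 by simp
  then have "k * (cmod (f 0))\<^sup>2 \<le> k * (k * nsq (-1) 0 f + (1/k) * nsq (-1) 0 f')"
    using k1 by (intro mult_left_mono) auto
  also have "\<dots> = nsq (-1) 0 f' + k\<^sup>2 * nsq (-1) 0 f"
    using k1 by (simp add: distrib_left power2_eq_square)
  finally show ?thesis
    using data_parts(1) by linarith
qed

text \<open>The multiplier \<open>(1 - x) * cnj Q\<close> removes the unknown value
  \<open>Q 1\<close>. The loss \<open>k + \<bar>s\<bar>\<close> is the price of pairing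
  \<open>(k\<^sup>2 + \<i> * s) * W\<close> with \<open>Q\<close> when only k^2 |W|^2 + |Q|^2 is
  controlled.\<close>

lemma Q0_bound: "(cmod (Q 0))\<^sup>2 \<le> (2 + k + \<bar>s\<bar>) * diss + data"
proof -
  define K where "K = k + \<bar>s\<bar>"
  let ?B = "\<lambda>x. - ((2 + K) * (cmod (Q x))\<^sup>2 + (K * k\<^sup>2) * (cmod (W x))\<^sup>2 + (cmod (h x))\<^sup>2)"
  have c: "ac_deriv 0 1 (\<lambda>x. (1 - of_real x) * (Q x * cnj (Q x)))
     (\<lambda>x. (-1) * (Q x * cnj (Q x)) + (1 - of_real x) * (((k\<^sup>2 + \<i> * s) * W x - h x) * cnj (Q x) + Q x * cnj
         ((k\<^sup>2 + \<i> * s) * W x - h x)))"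
    using ac_deriv_mult[OF ac_deriv_add[OF ac_deriv_const[of _ _ 1] ac_deriv_cmult[OF ac_deriv_ident, of _ _ "-1"]]
       ac_deriv_mult[OF Q ac_deriv_cnj[OF Q]]] by simp
  have i: "set_integrable lborel {0..1} ?B"
    by (intro set_integrable_uminus set_integral_add set_integrable_mult_right impI sq_int)
  have "(LINT x:{0..1}|lborel. ?B x) \<le> Re ((1 - of_real 1) * (Q 1 * cnj (Q 1))) - Re ((1 - of_real 0) *
      (Q 0 * cnj (Q 0)))"
  proof (rule ac_deriv_lower[OF c _ i])
    fix x :: real assume x: "x \<in> {0..1}"
    define R where "R = Re (((k\<^sup>2 + \<i> * s) * W x - h x) * cnj (Q x))"
    have 1: "\<bar>Re (W x * cnj (Q x))\<bar> \<le> k / 2 * (cmod (W x))\<^sup>2 + 1 / (2 * k) * (cmod (Q x))\<^sup>2"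
      using k1 by (intro Re_mult_cnj_le) auto
    have "k\<^sup>2 * \<bar>Re (W x * cnj (Q x))\<bar> \<le> k\<^sup>2 * (k / 2 * (cmod (W x))\<^sup>2 + 1 / (2 * k) * (cmod (Q x))\<^sup>2)"
      by (intro mult_left_mono 1) auto
    also have "\<dots> = k / 2 * (k\<^sup>2 * (cmod (W x))\<^sup>2 + (cmod (Q x))\<^sup>2)"
      using k1 by (simp add: field_simps power2_eq_square)
    finally have 2: "k\<^sup>2 * \<bar>Re (W x * cnj (Q x))\<bar> \<le> k / 2 * (k\<^sup>2 * (cmod (W x))\<^sup>2 + (cmod (Q x))\<^sup>2)" .
    have "\<bar>Re ((\<i> * s * W x) * cnj (Q x))\<bar> \<le> \<bar>s\<bar> / 2 * ((cmod (W x))\<^sup>2 + (cmod (Q x))\<^sup>2)"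
    proof -
      \<comment> \<open>The weight 1/|s| spreads the factor s evenly: both |W|^2 and |Q|^2 receive
        |s|/2.\<close>
      have "\<bar>Re ((\<i> * s * W x) * cnj (Q x))\<bar> \<le> 1 / \<bar>s\<bar> / 2 * (cmod (\<i> * s * W x))\<^sup>2 + 1 / (2 * (1 / \<bar>s\<bar>)) *
          (cmod (Q x))\<^sup>2"
        using s1 by (intro Re_mult_cnj_le) auto
      also have "\<dots> = \<bar>s\<bar> / 2 * ((cmod (W x))\<^sup>2 + (cmod (Q x))\<^sup>2)"
        using s1 by (simp add: norm_mult power_mult_distrib power2_eq_square distrib_left)
      finally show ?thesis .
    qed
    also have "\<dots> \<le> \<bar>s\<bar> / 2 * (k\<^sup>2 * (cmod (W x))\<^sup>2 + (cmod (Q x))\<^sup>2)"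
      using k_sq mult_right_mono[OF k_sq, of "(cmod (W x))\<^sup>2"] by (intro mult_left_mono) auto
    finally have 3: "\<bar>Re ((\<i> * s * W x) * cnj (Q x))\<bar> \<le> \<bar>s\<bar> / 2 * (k\<^sup>2 * (cmod (W x))\<^sup>2 + (cmod (Q x))\<^sup>2)" .
    have 4: "\<bar>Re (h x * cnj (Q x))\<bar> \<le> ((cmod (h x))\<^sup>2 + (cmod (Q x))\<^sup>2) / 2"
      using Re_mult_cnj_le[of 1 "h x" "Q x"] by (simp add: add_divide_distrib)
    have "R = k\<^sup>2 * Re (W x * cnj (Q x)) + Re ((\<i> * s * W x) * cnj (Q x)) - Re (h x * cnj (Q x))"
      by (simp add: R_def algebra_simps)
    then have "\<bar>R\<bar> \<le> k\<^sup>2 * \<bar>Re (W x * cnj (Q x))\<bar> + \<bar>Re ((\<i> * s * W x) * cnj (Q x))\<bar> + \<bar>Re (h x * cnj (Q x))\<bar>"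
      using abs_mult[of "k\<^sup>2" "Re (W x * cnj (Q x))", unfolded abs_power2] by linarith
    also have "\<dots> \<le> k / 2 * (k\<^sup>2 * (cmod (W x))\<^sup>2 + (cmod (Q x))\<^sup>2) + \<bar>s\<bar> / 2 * (k\<^sup>2 * (cmod (W x))\<^sup>2 + (cmod (Q x))\<^sup>2)
        + ((cmod (h x))\<^sup>2 + (cmod (Q x))\<^sup>2) / 2"
      using 2 3 4 by linarith
    finally have R2: "2 * \<bar>R\<bar> \<le> K * (k\<^sup>2 * (cmod (W x))\<^sup>2 + (cmod (Q x))\<^sup>2) + (cmod (h x))\<^sup>2 + (cmod (Q x))\<^sup>2"
      by (simp add: K_def field_simps)
    have "(1 - x) * (2 * \<bar>R\<bar>) \<le> 1 * (2 * \<bar>R\<bar>)"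
      using x by (intro mult_right_mono) auto
    moreover have "- ((1 - x) * (2 * \<bar>R\<bar>)) \<le> (1 - x) * (2 * R)"
      using x mult_left_mono[of "2 * - \<bar>R\<bar>" "2 * R" "1 - x"] by simp
    moreover have "Re ((-1) * (Q x * cnj (Q x)) + (1 - of_real x) * (((k\<^sup>2 + \<i> * s) * W x - h x) * cnj (Q x) + Q
        x * cnj ((k\<^sup>2 + \<i> * s) * W x - h x)))
      = - (cmod (Q x))\<^sup>2 + (1 - x) * (2 * R)"
      unfolding cmod_power2 R_def by (simp add: algebra_simps power2_eq_square)
    ultimately show "?B x \<le> Re ((-1) * (Q x * cnj (Q x)) + (1 - of_real x) * (((k\<^sup>2 + \<i> * s) * W x - h x) * cnj
        (Q x) + Q x * cnj ((k\<^sup>2 + \<i> * s) * W x - h x)))"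
      using R2 by (simp add: algebra_simps)
  qed simp
  moreover have "(LINT x:{0..1}|lborel. ?B x) = - ((2 + K) * nsq 0 1 Q + (K * k\<^sup>2) * nsq 0 1 W + nsq 0 1 h)"
    using sq_int by (simp add: set_integral_uminus)
  moreover have "Re ((1 - of_real 0) * (Q 0 * cnj (Q 0))) = (cmod (Q 0))\<^sup>2"
    using Re_mult_cnj_self[of "Q 0"] by simp
  ultimately have "(cmod (Q 0))\<^sup>2 \<le> (2 + K) * nsq 0 1 Q + (K * k\<^sup>2) * nsq 0 1 W + nsq 0 1 h"
    by simp
  also have "\<dots> \<le> (2 + K) * diss + nsq 0 1 h"
    unfolding diss_def using nsq_nonneg[of 0 1 W] by (simp add: algebra_simps)
  also have "\<dots> \<le> (2 + K) * diss + data"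
    using data_parts by simp
  finally show ?thesis by (simp add: K_def add.assoc)
qed

text \<open>The multiplier x vanishes at 0, where \<open>U\<close> is unknown, and \<open>U\<close>
  vanishes at -1, so no boundary term appears. Young with weight 1/2 gives the constant 4.\<close>

lemma U_Poincare: "nsq (-1) 0 U \<le> 4 * nsq (-1) 0 P"
proof -
  let ?B = "\<lambda>x. (1/2) * (cmod (U x))\<^sup>2 - 2 * (cmod (P x))\<^sup>2"
  have i: "set_integrable lborel {-1..0} ?B"
    by (intro set_integral_diff set_integral_add set_integrable_mult_right impI sq_int)
  have "(LINT x:{-1..0}|lborel. ?B x) \<le> Re (of_real 0 * (U 0 * cnj (U 0))) - Re (of_real (-1) * (U (-1) * cnj
      (U (-1))))"
  proof (rule ac_deriv_lower[OF ac_deriv_mult[OF ac_deriv_ident ac_deriv_mult[OF U ac_deriv_cnj[OF U]]] _ i])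
    fix x :: real assume x: "x \<in> {-1..0}"
    define R where "R = Re (U x * cnj (P x))"
    have "\<bar>R\<bar> \<le> (1/2) / 2 * (cmod (U x))\<^sup>2 + 1 / (2 * (1/2)) * (cmod (P x))\<^sup>2"
      unfolding R_def by (rule Re_mult_cnj_le) simp
    moreover have "\<bar>x\<bar> * \<bar>R\<bar> \<le> 1 * \<bar>R\<bar>"
      using x by (intro mult_right_mono) auto
    moreover have "- (\<bar>x\<bar> * \<bar>R\<bar>) \<le> x * R"
      by (metis abs_ge_minus_self abs_mult minus_le_iff)
    moreover have "Re (1 * (U x * cnj (U x)) + complex_of_real x * (P x * cnj (U x) + U x * cnj (P x))) =
        (cmod (U x))\<^sup>2 + 2 * (x * R)"
      unfolding cmod_power2 R_def by (simp add: algebra_simps power2_eq_square)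
    ultimately show "?B x \<le> Re (1 * (U x * cnj (U x)) + complex_of_real x * (P x * cnj (U x) + U x * cnj (P x)))"
      by simp
  qed simp
  moreover have "(LINT x:{-1..0}|lborel. ?B x) = (1/2) * nsq (-1) 0 U - 2 * nsq (-1) 0 P"
    using sq_int by simp
  ultimately show ?thesis
    using U0 by simp
qed

text \<open>At the interface i s U = W + f by the continuity of the velocity, so the trace bounds
  for \<open>W\<close> and \<open>f\<close> combine.\<close>

lemma U0_bound: "k * (s\<^sup>2 * (cmod (U 0))\<^sup>2) \<le> 2 * (diss + data)"
proof -
  have "s\<^sup>2 * (cmod (U 0))\<^sup>2 = (cmod (W 0 + f 0))\<^sup>2"
    using coupling1[symmetric] by (simp add: norm_mult power_mult_distrib)
  also have "\<dots> \<le> (cmod (W 0) + cmod (f 0))\<^sup>2"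
    by (intro power_mono norm_triangle_ineq) simp
  also have "\<dots> \<le> 2 * (cmod (W 0))\<^sup>2 + 2 * (cmod (f 0))\<^sup>2"
    using sum_squares_bound[of "cmod (W 0)" "cmod (f 0)"] by (simp add: power2_sum)
  finally have "k * (s\<^sup>2 * (cmod (U 0))\<^sup>2) \<le> k * (2 * (cmod (W 0))\<^sup>2 + 2 * (cmod (f 0))\<^sup>2)"
    using k1 by (intro mult_left_mono) auto
  also have "\<dots> = 2 * (k * (cmod (W 0))\<^sup>2 + k * (cmod (f 0))\<^sup>2)"
    by (simp add: algebra_simps)
  finally show ?thesis
    using W0_bound f0_bound by simp
qed

lemma source_bound:
  "(cmod (\<i> * s * f x + f2 x))\<^sup>2 \<le> 2 * s\<^sup>2 * (cmod (f x))\<^sup>2 + 2 * (cmod (f2 x))\<^sup>2"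
proof -
  have "(cmod (\<i> * s * f x + f2 x))\<^sup>2 \<le> (cmod (\<i> * s * f x) + cmod (f2 x))\<^sup>2"
    by (intro power_mono norm_triangle_ineq) simp
  also have "\<dots> \<le> 2 * (cmod (\<i> * s * f x))\<^sup>2 + 2 * (cmod (f2 x))\<^sup>2"
    using sum_squares_bound[of "cmod (\<i> * s * f x)" "cmod (f2 x)"] by (simp add: power2_sum)
  finally show ?thesis
    by (simp add: norm_mult power_mult_distrib)
qed

lemma V_bound: "nsq (-1) 0 V \<le> 2 * s\<^sup>2 * nsq (-1) 0 U + 2 * nsq (-1) 0 f"
proof -
  have *: "(cmod (V x))\<^sup>2 \<le> (2 * s\<^sup>2) * (cmod (U x))\<^sup>2 + 2 * (cmod (f x))\<^sup>2" for x
  proof -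
    have "(cmod (V x))\<^sup>2 \<le> (cmod (\<i> * s * U x) + cmod (f x))\<^sup>2"
      unfolding V_def by (intro power_mono norm_triangle_ineq4) simp
    also have "\<dots> \<le> 2 * (cmod (\<i> * s * U x))\<^sup>2 + 2 * (cmod (f x))\<^sup>2"
      using sum_squares_bound[of "cmod (\<i> * s * U x)" "cmod (f x)"] by (simp add: power2_sum)
    finally show ?thesis
      by (simp add: norm_mult power_mult_distrib)
  qed
  have "nsq (-1) 0 V \<le> (LINT x:{-1..0}|lborel. (2 * s\<^sup>2) * (cmod (U x))\<^sup>2 + 2 * (cmod (f x))\<^sup>2)"
    by (intro set_integral_mono set_integral_add set_integrable_mult_right impI sq_int *)
  also have "\<dots> = 2 * s\<^sup>2 * nsq (-1) 0 U + 2 * nsq (-1) 0 f"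
    using sq_int by simp
  finally show ?thesis .
qed

text \<open>The function \<open>?N\<close> combines the multipliers \<open>(x + 1) cnj P\<close> and \<open>cnj U\<close>, so that the terms with
  \<open>\<bar>U\<bar>\<^sup>2\<close>, whose coefficient \<open>s\<^sup>2 - k\<^sup>2\<close> has no sign, cancel in \<open>?N'\<close>.\<close>

lemma P_bound_low_frequency:
  assumes k: "k\<^sup>2 \<le> 2 * s\<^sup>2"
  shows "nsq (-1) 0 P \<le> 11 * \<bar>s\<bar> * diss + 13 * s\<^sup>2 * data"
proof -
  let ?F = "\<lambda>x. \<i> * s * f x + f2 x"
  let ?P' = "\<lambda>x. (k\<^sup>2 - s\<^sup>2) * U x - ?F x"
  let ?c = "complex_of_real (s\<^sup>2 - k\<^sup>2)"
  let ?N = "\<lambda>x. (of_real x + 1) * (P x * cnj (P x)) + (?c * ((of_real x + 1) * (U x * cnj (U x))) + P x * cnj (U x))"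
  let ?N' = "\<lambda>x. (1 * (P x * cnj (P x)) + (of_real x + 1) * (?P' x * cnj (P x) + P x * cnj (?P' x))) +
      (?c * (1 * (U x * cnj (U x)) + (of_real x + 1) * (P x * cnj (U x) + U x * cnj (P x))) +
       (?P' x * cnj (U x) + P x * cnj (P x)))"
  have x1: "ac_deriv (-1) 0 (\<lambda>x. complex_of_real x + 1) (\<lambda>x. 1)"
    using ac_deriv_add[OF ac_deriv_ident ac_deriv_const[of _ _ 1]] by simp
  have N: "ac_deriv (-1) 0 ?N ?N'"
    by (intro ac_deriv_add ac_deriv_cmult ac_deriv_mult x1 P U ac_deriv_cnj)
  \<comment> \<open>Young spends |P|^2 / 2 of the 2 |P|^2 in \<open>?N'\<close>, and 4 |F|^2 in
    total, which \<open>source_bound\<close> turns into the coefficients 8. The loss |U|^2 / 8 will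
    cost another |P|^2 / 2 by \<open>U_Poincare\<close>, so that exactly |P|^2 remains.\<close>
  let ?B = "\<lambda>x. (3/2) * (cmod (P x))\<^sup>2 - 8 * s\<^sup>2 * (cmod (f x))\<^sup>2 - 8 * (cmod (f2 x))\<^sup>2 - (1/8) * (cmod (U x))\<^sup>2"
  have i: "set_integrable lborel {-1..0} ?B"
    by (intro set_integral_diff set_integral_add set_integrable_mult_right impI sq_int)
  have "(LINT x:{-1..0}|lborel. ?B x) \<le> Re (?N 0) - Re (?N (-1))"
  proof (rule ac_deriv_lower[OF N _ i])
    fix x :: real assume x: "x \<in> {-1..0}"
    have 1: "\<bar>Re (?F x * cnj (P x))\<bar> \<le> 2 / 2 * (cmod (?F x))\<^sup>2 + 1 / (2 * 2) * (cmod (P x))\<^sup>2"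
      by (rule Re_mult_cnj_le) simp
    have 2: "\<bar>Re (?F x * cnj (U x))\<bar> \<le> 4 / 2 * (cmod (?F x))\<^sup>2 + 1 / (2 * 4) * (cmod (U x))\<^sup>2"
      by (rule Re_mult_cnj_le) simp
    have "(x + 1) * \<bar>Re (?F x * cnj (P x))\<bar> \<le> 1 * \<bar>Re (?F x * cnj (P x))\<bar>"
      using x by (intro mult_right_mono) auto
    moreover have "(x + 1) * Re (?F x * cnj (P x)) \<le> (x + 1) * \<bar>Re (?F x * cnj (P x))\<bar>"
      using x by (intro mult_left_mono) auto
    ultimately have 3: "(x + 1) * Re (?F x * cnj (P x)) \<le> 2 / 2 * (cmod (?F x))\<^sup>2 + 1 / (2 * 2) * (cmod (P x))\<^sup>2"
      using 1 by linarith
    have "Re (?N' x) = 2 * (cmod (P x))\<^sup>2 - 2 * ((x + 1) * Re (?F x * cnj (P x))) - Re (?F x * cnj (U x))"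
      unfolding cmod_power2 by (simp add: algebra_simps power2_eq_square)
    then show "?B x \<le> Re (?N' x)"
      using 2 3 source_bound[of x] by linarith
  qed simp
  moreover have "(LINT x:{-1..0}|lborel. ?B x) = (3/2) * nsq (-1) 0 P - 8 * s\<^sup>2 * nsq (-1) 0 f - 8 * nsq (-1) 0
      f2 - (1/8) * nsq (-1) 0 U"
    using sq_int by simp
  moreover have "Re (?N (-1)) = 0"
    by (simp add: U0)
  moreover have "Re (?N 0) = (cmod (P 0))\<^sup>2 + (s\<^sup>2 - k\<^sup>2) * (cmod (U 0))\<^sup>2 + Re (P 0 * cnj (U 0))"
    unfolding cmod_power2 by (simp add: algebra_simps power2_eq_square)
  moreover define r where "r = Re (P 0 * cnj (U 0))"
  ultimately have *: "nsq (-1) 0 P \<le> (cmod (P 0))\<^sup>2 + (s\<^sup>2 - k\<^sup>2) * (cmod (U 0))\<^sup>2 + r + 8 * s\<^sup>2 * nsq (-1) 0 f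
      + 8 * nsq (-1) 0 f2"
    using U_Poincare unfolding r_def by simp
  have s2: "1 * nsq (-1) 0 f2 \<le> s\<^sup>2 * nsq (-1) 0 f2" "1 * data \<le> s\<^sup>2 * data" "1 * diss \<le> \<bar>s\<bar> * diss"
    "1 * (cmod (U 0))\<^sup>2 \<le> s\<^sup>2 * (cmod (U 0))\<^sup>2"
    using s_sq s1 data_parts diss_parts nsq_nonneg by (intro mult_right_mono; auto)+
  have "s\<^sup>2 * (nsq (-1) 0 f + nsq (-1) 0 f2) \<le> s\<^sup>2 * data"
    by (intro mult_left_mono data_parts) simp
  then have F: "8 * s\<^sup>2 * nsq (-1) 0 f + 8 * nsq (-1) 0 f2 \<le> 8 * s\<^sup>2 * data"
    using s2 by (simp add: distrib_left)
  have "r \<le> (cmod (P 0))\<^sup>2 / 2 + (cmod (U 0))\<^sup>2 / 2"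
    using abs_le_D1[OF Re_mult_cnj_le[OF zero_less_one, of "P 0" "U 0"]] unfolding r_def by simp
  moreover have "1 * (s\<^sup>2 * (cmod (U 0))\<^sup>2) \<le> k * (s\<^sup>2 * (cmod (U 0))\<^sup>2)"
    using k1 by (intro mult_right_mono) auto
  moreover have "(s\<^sup>2 - k\<^sup>2) * (cmod (U 0))\<^sup>2 \<le> s\<^sup>2 * (cmod (U 0))\<^sup>2"
    by (intro mult_right_mono) auto
  \<comment> \<open>Here low frequency enters: it turns the loss 2 + k + |s| of
    \<open>Q0_bound\<close> into 5 |s|.\<close>
  moreover have "k \<le> 2 * \<bar>s\<bar>"
  proof -
    have "2 * s\<^sup>2 \<le> (2 * s)\<^sup>2" by (simp add: power_mult_distrib)
    then have "\<bar>k\<bar> \<le> \<bar>2 * s\<bar>" using k abs_le_square_iff[of k "2 * s"] by linarith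
    then show ?thesis by (simp add: abs_mult)
  qed
  then have "(2 + k + \<bar>s\<bar>) * diss \<le> (5 * \<bar>s\<bar>) * diss"
    using s1 by (intro mult_right_mono diss_parts) auto
  \<comment> \<open>Half of |P 0|^2 and of |U 0|^2 comes from \<open>r\<close>. The total is at most
    3/2 (5 |s| diss + data) + 3/2 times 2 (diss + data) + 8 s^2 data, that is 10.5 and 12.5 before
    rounding up.\<close>
  ultimately show ?thesis
    using * F U0_bound Q0_bound s2 data_parts(5) diss_parts(2)
    unfolding coupling2 mult.assoc distrib_left[of 2] by linarith
qed

text \<open>Now \<open>k\<^sup>2 - s\<^sup>2\<close> exceeds \<open>k\<^sup>2 / 2\<close>, so the
  multiplier \<open>cnj U\<close> is coercive. No power of s is lost, because the loss in
  \<open>Q0_bound\<close> is of order k and is compensated by the factor k gained in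
  \<open>U0_bound\<close>.\<close>

lemma energy_high_frequency:
  assumes k: "2 * s\<^sup>2 < k\<^sup>2"
  shows "energy \<le> 25 * diss + 42 * data"
proof -
  let ?F = "\<lambda>x. \<i> * s * f x + f2 x"
  let ?P' = "\<lambda>x. (k\<^sup>2 - s\<^sup>2) * U x - ?F x"
  have ksq: "s\<^sup>2 \<le> k\<^sup>2" using k zero_le_power2[of s] by linarith
  have sk: "\<bar>s\<bar> \<le> k" using ksq k1 by (simp add: abs_le_square_iff[symmetric])
  let ?B = "\<lambda>x. (cmod (P x))\<^sup>2 + (1/4) * (k\<^sup>2 * (cmod (U x))\<^sup>2) - 2 * (cmod (f x))\<^sup>2 - 2 * (cmod (f2 x))\<^sup>2"
  have i: "set_integrable lborel {-1..0} ?B"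
    by (intro set_integral_diff set_integral_add set_integrable_mult_right impI sq_int)
  have "(LINT x:{-1..0}|lborel. ?B x) \<le> Re (P 0 * cnj (U 0)) - Re (P (-1) * cnj (U (-1)))"
  proof (rule ac_deriv_lower[OF ac_deriv_mult[OF P ac_deriv_cnj[OF U]] _ i])
    fix x :: real assume x: "x \<in> {-1..0}"
    \<comment> \<open>The weight 2/k^2 charges the source with 1/k^2, which cancels the factor s^2
      in \<open>source_bound\<close> since s^2 <= k^2, and it costs only a quarter of k^2
      |U|^2.\<close>
    define a where "a = (2 / k\<^sup>2) * (cmod (?F x))\<^sup>2"
    have k20: "0 < 2 / k\<^sup>2" using k1 by simp
    have "2 * (cmod (?F x))\<^sup>2 / k\<^sup>2 \<le> 2 * (2 * s\<^sup>2 * (cmod (f x))\<^sup>2 + 2 * (cmod (f2 x))\<^sup>2) / k\<^sup>2"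
      using source_bound[of x] by (intro divide_right_mono) auto
    also have "\<dots> = 4 * ((s\<^sup>2 / k\<^sup>2) * (cmod (f x))\<^sup>2) + 4 * ((1 / k\<^sup>2) * (cmod (f2 x))\<^sup>2)"
      by (simp add: field_simps add_divide_distrib)
    also have "\<dots> \<le> 4 * (1 * (cmod (f x))\<^sup>2) + 4 * (1 * (cmod (f2 x))\<^sup>2)"
    proof -
      have "s\<^sup>2 / k\<^sup>2 \<le> 1" "1 / k\<^sup>2 \<le> 1"
        using ksq k_sq k1 by (simp_all add: divide_le_eq_1)
      then show ?thesis
        by (intro add_mono mult_left_mono mult_right_mono) auto
    qed
    finally have "a \<le> 4 * (cmod (f x))\<^sup>2 + 4 * (cmod (f2 x))\<^sup>2"
      by (simp add: a_def)
    moreover define R where "R = Re (?F x * cnj (U x))"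
    have "\<bar>R\<bar> \<le> (2 / k\<^sup>2) / 2 * (cmod (?F x))\<^sup>2 + 1 / (2 * (2 / k\<^sup>2)) * (cmod (U x))\<^sup>2"
      unfolding R_def by (rule Re_mult_cnj_le[OF k20])
    then have "\<bar>R\<bar> \<le> a / 2 + (k\<^sup>2 * (cmod (U x))\<^sup>2) / 4"
      by (simp add: a_def)
    moreover have "(k\<^sup>2 / 2) * (cmod (U x))\<^sup>2 \<le> (k\<^sup>2 - s\<^sup>2) * (cmod (U x))\<^sup>2"
      using k by (intro mult_right_mono) auto
    then have "(k\<^sup>2 * (cmod (U x))\<^sup>2) / 2 \<le> (k\<^sup>2 - s\<^sup>2) * (cmod (U x))\<^sup>2"
      by simp
    ultimately have "?B x \<le> (cmod (P x))\<^sup>2 + (k\<^sup>2 - s\<^sup>2) * (cmod (U x))\<^sup>2 - R"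
      by linarith
    moreover have "Re (?P' x * cnj (U x) + P x * cnj (P x)) = (cmod (P x))\<^sup>2 + (k\<^sup>2 - s\<^sup>2) * (cmod (U x))\<^sup>2 - R"
      unfolding cmod_power2 R_def by (simp add: algebra_simps power2_eq_square)
    ultimately show "?B x \<le> Re (?P' x * cnj (U x) + P x * cnj (P x))"
      by (rule ord_le_eq_trans[OF _ sym])
  qed simp
  moreover have "(LINT x:{-1..0}|lborel. ?B x) = nsq (-1) 0 P + (1/4) * (k\<^sup>2 * nsq (-1) 0 U) - 2 * nsq (-1) 0 f
      - 2 * nsq (-1) 0 f2"
    using sq_int by simp
  moreover define r where "r = Re (P 0 * cnj (U 0))"
  ultimately have *: "nsq (-1) 0 P + (1/4) * (k\<^sup>2 * nsq (-1) 0 U) \<le> r + 2 * data"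
    using U0 data_parts(3) unfolding r_def by simp
  \<comment> \<open>The weight 1/k fits both interface values: |P 0|^2 is bounded with a factor of
    order k, and |U 0|^2 with a factor 1/k.\<close>
  have "r \<le> ((1/k) * (cmod (P 0))\<^sup>2 + k * (cmod (U 0))\<^sup>2) / 2"
  proof -
    have "\<bar>Re (P 0 * cnj (U 0))\<bar> \<le> (1/k) / 2 * (cmod (P 0))\<^sup>2 + 1 / (2 * (1/k)) * (cmod (U 0))\<^sup>2"
      using k1 by (intro Re_mult_cnj_le) auto
    then show ?thesis unfolding r_def by (simp add: add_divide_distrib)
  qed
  moreover have "k * (1 * (cmod (U 0))\<^sup>2) \<le> k * (s\<^sup>2 * (cmod (U 0))\<^sup>2)"
    using k1 s_sq by (intro mult_left_mono mult_right_mono) auto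
  moreover have "(1/k) * (cmod (P 0))\<^sup>2 \<le> 4 * (diss + data)"
  proof -
    have "(2 + k + \<bar>s\<bar>) * diss \<le> (4 * k) * diss" "1 * data \<le> (4 * k) * data"
      using sk k1 by (intro mult_right_mono diss_parts data_parts; simp)+
    then have "(cmod (P 0))\<^sup>2 \<le> k * (4 * (diss + data))"
      using Q0_bound unfolding coupling2 by (simp add: distrib_left)
    then show ?thesis using k1 by (simp add: field_simps)
  qed
  ultimately have R: "r \<le> 3 * (diss + data)"
    using U0_bound by simp
  have kU: "2 * s\<^sup>2 * nsq (-1) 0 U \<le> k\<^sup>2 * nsq (-1) 0 U" "0 \<le> k\<^sup>2 * nsq (-1) 0 U"
    using k nsq_nonneg by (auto intro!: mult_right_mono)
  have "nsq (-1) 0 P + (1/4) * (k\<^sup>2 * nsq (-1) 0 U) \<le> 3 * diss + 5 * data"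
    using * R by simp
  \<comment> \<open>By \<open>V_bound\<close> and \<open>kU\<close> the energy is at most nsq P + 2
    k^2 nsq U + 2 data + diss, and eight times the last estimate covers the first two terms.\<close>
  then show ?thesis
    unfolding energy_def using V_bound kU diss_parts(1) data_parts(2) nsq_nonneg[of "-1" 0 P] by linarith
qed

lemma mode_estimate: "energy \<le> 36000 * s ^ 6 * data"
proof (cases "k\<^sup>2 \<le> 2 * s\<^sup>2")
  case True
  let ?p = "nsq (-1) 0 P"
  let ?a = "\<bar>s\<bar>"
  have a: "1 \<le> ?a" "s\<^sup>2 = ?a\<^sup>2" "s ^ 6 = ?a ^ 6" using s1 by (auto simp: power_even_abs)
  \<comment> \<open>The potential part, the part of \<open>V\<close> carried by \<open>U\<close>,
    and nsq P contribute 8, 8 and 1 times s^2 nsq P; together these give the factor 17.\<close>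
  have "k\<^sup>2 * nsq (-1) 0 U \<le> (2 * s\<^sup>2) * (4 * ?p)"
    using True U_Poincare nsq_nonneg by (intro mult_mono) auto
  moreover have "2 * s\<^sup>2 * nsq (-1) 0 U \<le> 2 * s\<^sup>2 * (4 * ?p)"
    using U_Poincare by (intro mult_left_mono) auto
  moreover have "1 * ?p \<le> s\<^sup>2 * ?p"
    using s_sq nsq_nonneg by (intro mult_right_mono) auto
  ultimately have "energy \<le> 17 * s\<^sup>2 * ?p + 2 * data + diss"
    unfolding energy_def using V_bound diss_parts(1) data_parts(2) by linarith
  also have "\<dots> \<le> 17 * s\<^sup>2 * (11 * ?a * diss + 13 * s\<^sup>2 * data) + 2 * data + diss"
    using P_bound_low_frequency[OF True] by (intro add_mono mult_left_mono) auto
  also have "\<dots> = 187 * ?a ^ 3 * diss + diss + 221 * ?a ^ 4 * data + 2 * data"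
    unfolding a(2) by (simp add: algebra_simps power_numeral_reduce)
  also have "\<dots> \<le> 187 * ?a ^ 3 * diss + ?a ^ 3 * diss + 221 * ?a ^ 6 * data + 2 * ?a ^ 6 * data"
  proof -
    have "1 * diss \<le> ?a ^ 3 * diss"
      using a by (intro mult_right_mono diss_parts one_le_power)
    moreover have "?a ^ 4 * data \<le> ?a ^ 6 * data"
      using a(1) by (intro mult_right_mono data_parts power_increasing) auto
    moreover have "1 * data \<le> ?a ^ 6 * data"
      using a(1) by (intro mult_right_mono data_parts one_le_power)
    ultimately show ?thesis
      unfolding mult.assoc by linarith
  qed
  also have "\<dots> = 188 * ?a ^ 3 * diss + 223 * ?a ^ 6 * data" by simp
  \<comment> \<open>The weight l = 188 |s|^3 is chosen so that the energy returns with the factor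
    1/2 exactly and can be absorbed. Then 35790 is twice 188^2/2 + 223.\<close>
  also have "188 * ?a ^ 3 * diss \<le> 188 * ?a ^ 3 * (((188 * ?a ^ 3) * data + energy / (188 * ?a ^ 3)) / 2)"
    using a by (intro mult_left_mono dissipation) auto
  also have "\<dots> = 17672 * ?a ^ 6 * data + energy / 2"
    using a by (simp add: field_simps power_numeral_reduce)
  finally have "energy \<le> 35790 * ?a ^ 6 * data" by linarith
  also have "\<dots> \<le> 36000 * ?a ^ 6 * data"
    using data_parts(5) by (intro mult_right_mono) auto
  finally show ?thesis unfolding a(3) .
next
  case False
  then have "energy \<le> 25 * diss + 42 * data"
    by (intro energy_high_frequency) simp
  \<comment> \<open>With l = 25 the term 25 diss again returns half of the energy.\<close>
  moreover have "diss \<le> (25 * data + energy / 25) / 2"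
    by (rule dissipation) simp
  ultimately have "energy \<le> 1000 * data"
    using data_parts(5) by simp
  moreover have "1000 * data \<le> 36000 * s ^ 6 * data"
  proof -
    have "1 \<le> (s\<^sup>2) ^ 3" using s_sq by (rule one_le_power)
    then have "1 \<le> s ^ 6" by (simp flip: power_mult)
    then show ?thesis using data_parts(5) by (intro mult_right_mono) auto
  qed
  ultimately show ?thesis by linarith
qed

end

section \<open>Orthonormal bases of cosines and of sines\<close>

text \<open>Functions in L2(0,1) are extended by zero to the line, so that slices of functions on
  the plane can be inserted directly and integrals need no domain.\<close>

definition l2_unit :: "(real \<Rightarrow> complex) \<Rightarrow> bool"
  where "l2_unit f \<longleftrightarrow> f \<in> borel_measurable borel \<and> integrable lborel (\<lambda>y. (cmod (f y))\<^sup>2) \<and>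
    (\<forall>y. y \<notin> {0<..<1} \<longrightarrow> f y = 0)"

text \<open>The span is built one term at a time, with repeated indices allowed. Closure under
  products and under changes of the system is then a plain induction; \<open>lincomb_sum\<close>
  recovers an indexed sum at the end.\<close>

inductive lincomb :: "(nat \<Rightarrow> real \<Rightarrow> real) \<Rightarrow> (real \<Rightarrow> complex) \<Rightarrow> bool" for e
  where
    zero: "lincomb e (\<lambda>y. 0)"
  | step: "lincomb e G \<Longrightarrow> lincomb e (\<lambda>y. G y + c * of_real (e m y))"

lemma lincomb_single: "lincomb e (\<lambda>y. c * of_real (e m y))"
  using lincomb.step[OF lincomb.zero] by simp

lemma lincomb_add: "lincomb e G \<Longrightarrow> lincomb e F \<Longrightarrow> lincomb e (\<lambda>y. F y + G y)"
proof (induction rule: lincomb.induct)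
  case (step G c m)
  then show ?case using lincomb.step[of e "\<lambda>y. F y + G y" c m] by (simp add: add.assoc)
qed simp

lemma lincomb_cmult: "lincomb e G \<Longrightarrow> lincomb e (\<lambda>y. d * G y)"
proof (induction rule: lincomb.induct)
  case (step G c m)
  then show ?case using lincomb.step[of e "\<lambda>y. d * G y" "d * c" m] by (simp add: distrib_left mult.assoc)
qed (simp add: lincomb.zero)

lemma lincomb_rescale:
  assumes "lincomb e G" "\<And>n. e n = (\<lambda>y. r n * e' n y)"
  shows "lincomb e' G"
  using assms(1)
proof (induction rule: lincomb.induct)
  case (step G c m)
  then show ?case using lincomb.step[of e' G "c * of_real (r m)" m] assms(2)[of m] by (simp add: mult.assoc)
qed (simp add: lincomb.zero)

lemma lincomb_continuous:
  assumes "lincomb e G" "\<And>n. continuous_on UNIV (e n)"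
  shows "continuous_on UNIV G"
  using assms(1) by (induction) (auto intro!: continuous_intros assms(2))

lemma lincomb_sum:
  assumes "lincomb e G"
  shows "\<exists>N c. G = (\<lambda>y. \<Sum>n<N. c n * of_real (e n y))"
  using assms
proof induction
  case zero
  show ?case by (rule exI[of _ 0]) simp
next
  case (step G d m)
  then obtain N c where G: "G = (\<lambda>y. \<Sum>n<N. c n * of_real (e n y))" by blast
  \<comment> \<open>The old coefficients are cut off at \<open>N\<close>, beyond which they are
    arbitrary, and the new term is added to a coefficient of the same index if there is one.\<close>
  let ?c = "\<lambda>n. (if n < N then c n else 0) + (if n = m then d else 0)"
  have *: "(\<Sum>n<max N (Suc m). ?c n * of_real (e n y)) = G y + d * of_real (e m y)" for y
  proof -
    have "(\<Sum>n<max N (Suc m). ?c n * of_real (e n y)) =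
      (\<Sum>n<max N (Suc m). if n < N then c n * of_real (e n y) else 0) + (\<Sum>n<max N (Suc m). if n = m then d *
          of_real (e n y) else 0)"
      unfolding sum.distrib[symmetric] by (intro sum.cong) (auto simp: distrib_right)
    also have "(\<Sum>n<max N (Suc m). if n < N then c n * of_real (e n y) else 0) = (\<Sum>n<N. c n * of_real (e n y))"
      by (rule sum.mono_neutral_cong_right) auto
    also have "(\<Sum>n<max N (Suc m). if n = m then d * complex_of_real (e n y) else 0) = d * of_real (e m y)"
      by (subst sum.delta) auto
    finally show ?thesis by (simp add: G)
  qed
  show ?case
    by (intro exI[of _ "max N (Suc m)"] exI[of _ ?c] ext *[symmetric])
qed

lemma l2_unit_integrable:
  assumes f: "l2_unit f" and g: "continuous_on UNIV (g :: real \<Rightarrow> complex)"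
  shows "integrable lborel (\<lambda>y. f y * g y)"
proof -
  obtain B where B: "\<And>y. y \<in> {0..1} \<Longrightarrow> norm (g y) \<le> B"
    using compact_imp_bounded[OF compact_continuous_image[OF continuous_on_subset[OF g], of "{0..1}"]]
    by (force simp: bounded_iff)
  have B0: "0 \<le> B" using order_trans[OF norm_ge_zero B[of 0]] by simp
  have [measurable]: "f \<in> borel_measurable borel" "g \<in> borel_measurable borel"
    using f g by (auto simp: l2_unit_def intro: borel_measurable_continuous_onI)
  show ?thesis
  proof (rule Bochner_Integration.integrable_bound)
    show "integrable lborel (\<lambda>y. B * (indicator {0..1} y + (cmod (f y))\<^sup>2))"
      using f by (auto simp: l2_unit_def)
    show "AE y in lborel. norm (f y * g y) \<le> norm (B * (indicator {0..1} y + (cmod (f y))\<^sup>2))"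
    proof (rule AE_I2)
      fix y
      have "norm (f y * g y) \<le> B * (1 + (cmod (f y))\<^sup>2)" if "y \<in> {0..1}"
      proof -
        have "0 \<le> (cmod (f y) - 1)\<^sup>2" by simp
        then have "2 * cmod (f y) \<le> (cmod (f y))\<^sup>2 + 1"
          by (simp add: power2_diff)
        then have "cmod (f y) \<le> 1 + (cmod (f y))\<^sup>2"
          using norm_ge_zero[of "f y"] by linarith
        then have "cmod (f y) * cmod (g y) \<le> (1 + (cmod (f y))\<^sup>2) * B"
          using B[OF that] by (intro mult_mono) auto
        then show ?thesis by (simp add: norm_mult mult.commute)
      qed
      moreover have "f y = 0" if "y \<notin> {0..1}"
        using f that by (auto simp: l2_unit_def)
      ultimately show "norm (f y * g y) \<le> norm (B * (indicator {0..1} y + (cmod (f y))\<^sup>2))"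
        using B0 by (cases "y \<in> {0..1}") auto
    qed
  qed measurable
qed

section \<open>Bessel's inequality and Parseval's identity from orthonormality and density\<close>

locale l2_basis =
  fixes e :: "nat \<Rightarrow> real \<Rightarrow> real"
  assumes cont: "continuous_on UNIV (e n)"
    and ortho: "(LINT y:{0..1}|lborel. e n y * e m y) = (if n = m then 1 else 0)"
    and dense: "l2_unit f \<Longrightarrow> 0 < \<epsilon> \<Longrightarrow> \<exists>G. lincomb e G \<and> (LINT y:{0..1}|lborel. (cmod (f y - G y))\<^sup>2) < \<epsilon>"
begin

text \<open>Completing the square in the coefficients. The choice c = a gives Bessel; an arbitrary
  approximating combination has at least the error of c = a, which gives Parseval.\<close>

lemma integral_square_diff:
  fixes c :: "nat \<Rightarrow> complex"
  assumes f: "l2_unit f"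
  defines "a \<equiv> \<lambda>n. LINT y|lborel. f y * of_real (e n y)"
  shows "(LINT y:{0..1}|lborel. (cmod (f y - (\<Sum>n<N. c n * of_real (e n y))))\<^sup>2) =
    (LINT y|lborel. (cmod (f y))\<^sup>2) - (\<Sum>n<N. (cmod (a n))\<^sup>2) + (\<Sum>n<N. (cmod (c n - a n))\<^sup>2)"
proof -
  let ?I = "indicator {0..1::real} :: real \<Rightarrow> real"
  let ?G = "\<lambda>y. \<Sum>n<N. c n * of_real (e n y)"
  have c: "continuous_on UNIV (\<lambda>y. complex_of_real (e n y))" for n
    by (intro continuous_intros cont)
  have i1: "integrable lborel (\<lambda>y. (cmod (f y))\<^sup>2)" using f by (simp add: l2_unit_def)
  have i2: "integrable lborel (\<lambda>y. f y * of_real (e n y))" for n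
    by (rule l2_unit_integrable[OF f c])
  have i2': "integrable lborel (\<lambda>y. \<Sum>n<N. cnj (c n) * (f y * of_real (e n y)))"
    by (intro Bochner_Integration.integrable_sum integrable_mult_right i2)
  have i3: "integrable lborel (\<lambda>y. ?I y *\<^sub>R (e n y * e m y))" for n m
    using borel_integrable_compact[of "{0..1}" "\<lambda>y. e n y * e m y"] cont
    by (auto intro!: continuous_intros intro: continuous_on_subset)
  have i3c: "integrable lborel (\<lambda>y. complex_of_real (?I y *\<^sub>R (e n y * e m y)))" for n m
    by (rule integrable_of_real[OF i3])
  have i3': "integrable lborel (\<lambda>y. \<Sum>n<N. \<Sum>m<N. c n * cnj (c m) * of_real (?I y *\<^sub>R (e n y * e m y)))"
    by (intro Bochner_Integration.integrable_sum integrable_mult_right i3c)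
  \<comment> \<open>Since \<open>f\<close> vanishes off (0,1), the indicator has to be kept only on
    the products of basis functions.\<close>
  have pw: "?I y *\<^sub>R (cmod (f y - ?G y))\<^sup>2 = (cmod (f y))\<^sup>2 - 2 * Re (\<Sum>n<N. cnj (c n) * (f y * of_real (e n y)))
      + Re (\<Sum>n<N. \<Sum>m<N. c n * cnj (c m) * of_real (?I y *\<^sub>R (e n y * e m y)))" for y
  proof (cases "y \<in> {0..1}")
    case True
    have "(cmod (z - w))\<^sup>2 = (cmod z)\<^sup>2 - 2 * Re (z * cnj w) + Re (w * cnj w)" for z w
      unfolding cmod_power2 by (simp add: power2_eq_square algebra_simps)
    then have "(cmod (f y - ?G y))\<^sup>2 = (cmod (f y))\<^sup>2 - 2 * Re (f y * cnj (?G y)) + Re (?G y * cnj (?G y))" .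
    also have "?G y * cnj (?G y) = (\<Sum>n<N. \<Sum>m<N. c n * cnj (c m) * of_real (e n y * e m y))"
      by (simp add: sum_product cnj_sum mult_ac)
    also have "f y * cnj (?G y) = (\<Sum>n<N. cnj (c n) * (f y * of_real (e n y)))"
      by (simp add: sum_distrib_left mult_ac)
    finally show ?thesis using True by simp
  next
    case False
    then have "f y = 0" using f by (auto simp: l2_unit_def)
    then show ?thesis using False by simp
  qed
  have "(LINT y:{0..1}|lborel. (cmod (f y - ?G y))\<^sup>2) =
    (LINT y|lborel. (cmod (f y))\<^sup>2 - 2 * Re (\<Sum>n<N. cnj (c n) * (f y * of_real (e n y)))
      + Re (\<Sum>n<N. \<Sum>m<N. c n * cnj (c m) * of_real (?I y *\<^sub>R (e n y * e m y))))"
    unfolding set_lebesgue_integral_def pw ..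
  also have "\<dots> = (LINT y|lborel. (cmod (f y))\<^sup>2) - 2 * Re (LINT y|lborel. (\<Sum>n<N. cnj (c n) * (f y * of_real (e n y))))
      + Re (LINT y|lborel. (\<Sum>n<N. \<Sum>m<N. c n * cnj (c m) * of_real (?I y *\<^sub>R (e n y * e m y))))"
    using i1 integrable_Re[OF i2'] integrable_Re[OF i3']
    by (simp only: Bochner_Integration.integral_add Bochner_Integration.integral_diff integral_mult_right_zero
        integrable_mult_right
        Bochner_Integration.integrable_diff integral_Re[OF i2'] integral_Re[OF i3'])
  also have "(LINT y|lborel. (\<Sum>n<N. cnj (c n) * (f y * of_real (e n y)))) = (\<Sum>n<N. cnj (c n) * a n)"
    unfolding a_def using i2 by (simp add: Bochner_Integration.integral_sum)
  also have "(LINT y|lborel. (\<Sum>n<N. \<Sum>m<N. c n * cnj (c m) * of_real (?I y *\<^sub>R (e n y * e m y))))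
     = (\<Sum>n<N. \<Sum>m<N. c n * cnj (c m) * (LINT y|lborel. of_real (?I y *\<^sub>R (e n y * e m y))))"
    using i3c by (subst Bochner_Integration.integral_sum; simp del: of_real_mult)+
  also have "\<dots> = (\<Sum>n<N. \<Sum>m<N. c n * cnj (c m) * (if n = m then 1 else 0))"
  proof (intro sum.cong refl)
    fix n m
    have "(LINT y|lborel. complex_of_real (?I y *\<^sub>R (e n y * e m y))) = of_real (LINT y:{0..1}|lborel. e n y * e m y)"
      unfolding set_lebesgue_integral_def by (rule integral_of_real[OF i3])
    then show "c n * cnj (c m) * (LINT y|lborel. of_real (?I y *\<^sub>R (e n y * e m y))) = c n * cnj (c m) *
        (if n = m then 1 else 0)"
      unfolding ortho by simp
  qed
  also have "\<dots> = (\<Sum>n<N. c n * cnj (c n))"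
    by (intro sum.cong refl) (simp add: sum.delta if_distrib[of "\<lambda>x. _ * x"] cong: if_cong)
  finally have "(LINT y:{0..1}|lborel. (cmod (f y - ?G y))\<^sup>2) = (LINT y|lborel. (cmod (f y))\<^sup>2) -
     (\<Sum>n<N. 2 * Re (cnj (c n) * a n)) + (\<Sum>n<N. Re (c n * cnj (c n)))"
    by (simp add: sum_distrib_left Re_sum del: times_complex.sel)
  moreover have "2 * Re (cnj (c n) * a n) - Re (c n * cnj (c n)) = (cmod (a n))\<^sup>2 - (cmod (c n - a n))\<^sup>2" for n
    unfolding cmod_power2 by (simp add: power2_eq_square algebra_simps)
  then have "(\<Sum>n<N. 2 * Re (cnj (c n) * a n)) - (\<Sum>n<N. Re (c n * cnj (c n))) = (\<Sum>n<N. (cmod (a n))\<^sup>2) -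
      (\<Sum>n<N. (cmod (c n - a n))\<^sup>2)"
    unfolding sum_subtractf[symmetric] by (simp del: times_complex.sel)
  ultimately show ?thesis by linarith
qed

lemma Bessel:
  assumes f: "l2_unit f"
  shows "(\<Sum>n<N. (cmod (LINT y|lborel. f y * of_real (e n y)))\<^sup>2) \<le> (LINT y|lborel. (cmod (f y))\<^sup>2)"
proof -
  have "0 \<le> (LINT y:{0..1}|lborel. (cmod (f y - (\<Sum>n<N. (LINT y|lborel. f y * of_real (e n y)) * of_real (e n y))))\<^sup>2)"
    unfolding set_lebesgue_integral_def by simp
  then show ?thesis
    unfolding integral_square_diff[OF f] by simp
qed

lemma Parseval:
  assumes f: "l2_unit f"
  shows "(\<lambda>n. (cmod (LINT y|lborel. f y * of_real (e n y)))\<^sup>2) sums (LINT y|lborel. (cmod (f y))\<^sup>2)"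
proof -
  let ?a = "\<lambda>n. LINT y|lborel. f y * of_real (e n y)"
  let ?n = "LINT y|lborel. (cmod (f y))\<^sup>2"
  have s: "summable (\<lambda>n. (cmod (?a n))\<^sup>2)"
    using Bessel[OF f] by (intro summableI_nonneg_bounded) auto
  have "?n \<le> (\<Sum>n. (cmod (?a n))\<^sup>2)"
  proof (rule field_le_epsilon)
    fix \<epsilon> :: real assume "0 < \<epsilon>"
    from dense[OF f this] obtain G where G: "lincomb e G" "(LINT y:{0..1}|lborel. (cmod (f y - G y))\<^sup>2) < \<epsilon>" by blast
    obtain N c where "G = (\<lambda>y. \<Sum>n<N. c n * of_real (e n y))"
      using lincomb_sum[OF G(1)] by blast
    then have "?n - (\<Sum>n<N. (cmod (?a n))\<^sup>2) + (\<Sum>n<N. (cmod (c n - ?a n))\<^sup>2) < \<epsilon>"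
      using G(2) integral_square_diff[OF f, where c=c and N=N] by simp
    moreover have "0 \<le> (\<Sum>n<N. (cmod (c n - ?a n))\<^sup>2)" by (intro sum_nonneg) auto
    moreover have "(\<Sum>n<N. (cmod (?a n))\<^sup>2) \<le> (\<Sum>n. (cmod (?a n))\<^sup>2)"
      by (rule sum_le_suminf[OF s]) auto
    ultimately show "?n \<le> (\<Sum>n. (cmod (?a n))\<^sup>2) + \<epsilon>" by linarith
  qed
  moreover have "(\<Sum>n. (cmod (?a n))\<^sup>2) \<le> ?n"
    by (intro suminf_le_const[OF s] Bessel f)
  ultimately have "(\<Sum>n. (cmod (?a n))\<^sup>2) = ?n" by (rule order_antisym[rotated])
  then show ?thesis
    using summable_sums[OF s] by simp
qed

end

section \<open>Density of the cosines and of the sines in L2(0,1)\<close>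

definition cos_basis :: "nat \<Rightarrow> real \<Rightarrow> real"
  where "cos_basis n y = (if n = 0 then 1 else sqrt 2 * cos (real n * pi * y))"

definition sin_basis :: "nat \<Rightarrow> real \<Rightarrow> real"
  where "sin_basis n y = sqrt 2 * sin (real (Suc n) * pi * y)"

text \<open>By the product-to-sum formula the span of the cosines is an algebra, as
  Stone-Weierstrass requires. The sines have no such property and are treated through the
  cosines.\<close>

lemma lincomb_cos_mult_single:
  assumes "lincomb (\<lambda>n y. cos (real n * pi * y)) F"
  shows "lincomb (\<lambda>n y. cos (real n * pi * y)) (\<lambda>y. F y * (c * of_real (cos (real m * pi * y))))"
  using assms
proof (induction)
  case zero
  then show ?case using lincomb.zero by simp
next
  case (step G d n)
  let ?C = "\<lambda>n y. cos (real n * pi * y)"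
  \<comment> \<open>For natural numbers \<open>max n m - min n m\<close> is |n - m|, a form that
    avoids truncated subtraction.\<close>
  have "cos (real n * pi * y) * cos (real m * pi * y) = (cos (real (n + m) * pi * y) + cos
      (real (max n m - min n m) * pi * y)) / 2" for y
  proof -
    have "cos (real (max n m - min n m) * pi * y) = cos (real n * pi * y - real m * pi * y)"
    proof (cases "n \<le> m")
      case True
      then show ?thesis
        by (subst cos_minus[symmetric]) (simp add: of_nat_diff algebra_simps)
    next
      case False
      then show ?thesis by (simp add: of_nat_diff algebra_simps)
    qed
    moreover have "cos (real (n + m) * pi * y) = cos (real n * pi * y + real m * pi * y)"
      by (simp add: algebra_simps)
    ultimately show ?thesis
      by (simp only: cos_times_cos add.commute)
  qed
  then have "complex_of_real (?C n y) * of_real (?C m y) = (of_real (?C (n + m) y) + of_real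
      (?C (max n m - min n m) y)) / 2" for y
    by (simp only: of_real_mult[symmetric]) simp
  then have *: "d * of_real (?C n y) * (c * of_real (?C m y)) =
      (d * c / 2) * of_real (?C (n + m) y) + (d * c / 2) * of_real (?C (max n m - min n m) y)" for y
  proof -
    assume a: "\<And>y. complex_of_real (?C n y) * of_real (?C m y) = (of_real (?C (n + m) y) + of_real
        (?C (max n m - min n m) y)) / 2"
    have "d * of_real (?C n y) * (c * of_real (?C m y)) = d * c * (of_real (?C n y) * of_real (?C m y))"
      by (simp only: mult_ac)
    then show ?thesis unfolding a by (simp only: distrib_left add_divide_distrib times_divide_eq_right
        times_divide_eq_left)
  qed
  show ?case
    unfolding distrib_right * by (intro lincomb_add lincomb_single step.IH)
qed

lemma lincomb_cos_mult:
  assumes F: "lincomb (\<lambda>n y. cos (real n * pi * y)) F" and G: "lincomb (\<lambda>n y. cos (real n * pi * y)) G"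
  shows "lincomb (\<lambda>n y. cos (real n * pi * y)) (\<lambda>y. F y * G y)"
  using G
proof (induction)
  case zero
  then show ?case using lincomb.zero by simp
next
  case (step G d n)
  show ?case
    unfolding distrib_left by (intro lincomb_add lincomb_cos_mult_single step.IH F)
qed

text \<open>Stone-Weierstrass on [0,1] for real functions, applied to real and imaginary part. Each
  part gets half of the error.\<close>

lemma cos_approximation:
  fixes g :: "real \<Rightarrow> complex"
  assumes g: "continuous_on {0..1} g" and e: "0 < \<epsilon>"
  shows "\<exists>G. lincomb (\<lambda>n y. cos (real n * pi * y)) G \<and> (\<forall>y\<in>{0..1}. cmod (g y - G y) < \<epsilon>)"
proof -
  let ?P = "\<lambda>f. lincomb (\<lambda>n y. cos (real n * pi * y)) (\<lambda>y. complex_of_real (f y)) \<and> continuous_on {0..1} f"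
  have real: "\<exists>h. ?P h \<and> (\<forall>y\<in>{0..1}. \<bar>f y - h y\<bar> < \<epsilon> / 2)" if f: "continuous_on {0..1} f" for f
  proof (rule Stone_Weierstrass_HOL[of "{0..1}" ?P])
    show "?P (\<lambda>x. c)" for c
      using lincomb_single[of "\<lambda>n y. cos (real n * pi * y)" "of_real c" 0] by simp
    show "?P f \<and> ?P g \<Longrightarrow> ?P (\<lambda>x. f x + g x)" for f g
      using lincomb_add by (auto intro!: continuous_intros)
    show "?P f \<and> ?P g \<Longrightarrow> ?P (\<lambda>x. f x * g x)" for f g
      using lincomb_cos_mult by (auto intro!: continuous_intros)
    show "\<exists>f. ?P f \<and> f x \<noteq> f y" if "x \<in> {0..1} \<and> y \<in> {0..1} \<and> x \<noteq> y" for x y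
    proof (intro exI conjI)
      show "lincomb (\<lambda>n y. cos (real n * pi * y)) (\<lambda>y. complex_of_real (cos (real 1 * pi * y)))"
        using lincomb_single[of "\<lambda>n y. cos (real n * pi * y)" 1 1] by simp
      \<comment> \<open>Points are separated by the first cosine alone, as it is injective on half a
        period.\<close>
      show "cos (real 1 * pi * x) \<noteq> cos (real 1 * pi * y)"
        using that cos_inj_pi[of "pi * x" "pi * y"] by (auto simp: mult_left_le)
    qed (intro continuous_intros)
  qed (use f e in auto)
  obtain h where h: "?P h" "\<And>y. y \<in> {0..1} \<Longrightarrow> \<bar>Re (g y) - h y\<bar> < \<epsilon> / 2"
    using real[OF continuous_on_Re[OF g]] by auto
  obtain k where k: "?P k" "\<And>y. y \<in> {0..1} \<Longrightarrow> \<bar>Im (g y) - k y\<bar> < \<epsilon> / 2"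
    using real[OF continuous_on_Im[OF g]] by auto
  show ?thesis
  proof (intro exI conjI ballI)
    show "lincomb (\<lambda>n y. cos (real n * pi * y)) (\<lambda>y. of_real (h y) + \<i> * of_real (k y))"
      using h(1) k(1) by (intro lincomb_add lincomb_cmult) auto
    fix y :: real assume "y \<in> {0..1}"
    then show "cmod (g y - (of_real (h y) + \<i> * of_real (k y))) < \<epsilon>"
      using cmod_le[of "g y - (of_real (h y) + \<i> * of_real (k y))"] h(2)[of y] k(2)[of y] by simp
  qed
qed

lemma square_triangle: "(cmod (x - z))\<^sup>2 \<le> 2 * (cmod (x - y))\<^sup>2 + 2 * (cmod (y - z))\<^sup>2"
proof -
  have "(cmod (x - z))\<^sup>2 \<le> (cmod (x - y) + cmod (y - z))\<^sup>2"
    using norm_triangle_ineq[of "x - y" "y - z"] by (intro power_mono) auto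
  also have "\<dots> \<le> 2 * (cmod (x - y))\<^sup>2 + 2 * (cmod (y - z))\<^sup>2"
    using sum_squares_bound[of "cmod (x - y)" "cmod (y - z)"] by (simp add: power2_sum)
  finally show ?thesis .
qed

text \<open>A measurable function is an almost everywhere limit of continuous functions. Boundedness
  makes the limit hold in L2 by dominated convergence, and each continuous function is uniformly
  close to a combination of cosines.\<close>

lemma l2_unit_bounded_approx:
  assumes f: "l2_unit f" and B: "\<And>y. cmod (f y) \<le> B" and e: "0 < \<epsilon>"
  shows "\<exists>G. lincomb (\<lambda>n y. cos (real n * pi * y)) G \<and> (LINT y:{0..1}|lborel. (cmod (f y - G y))\<^sup>2) < \<epsilon>"
proof -
  have fm[measurable]: "f \<in> borel_measurable borel" using f by (simp add: l2_unit_def)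
  have B0: "0 \<le> B" using order_trans[OF norm_ge_zero B[of 0]] .
  have "f \<in> borel_measurable lebesgue"
    using measurable_completion[of f lborel borel] by simp
  then have "f measurable_on UNIV"
    by (rule lebesgue_measurable_imp_measurable_on) simp
  then obtain N g where N: "negligible N" and g: "\<And>n. continuous_on UNIV (g n)"
    and lim: "\<And>x. x \<notin> N \<Longrightarrow> (\<lambda>n. g n x) \<longlonglongrightarrow> f x"
    unfolding measurable_on_def by auto
  \<comment> \<open>The projection onto the ball of radius \<open>B\<close> is continuous and fixes
    the values of \<open>f\<close>. Composed with it, the approximating functions keep their limit
    and acquire a common bound.\<close>
  define c where "c = (\<lambda>z::complex. closest_point (cball 0 B) z)"
  have cc: "continuous_on UNIV c"
    unfolding c_def using B0 by (intro continuous_on_closest_point) auto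
  have cB: "cmod (c z) \<le> B" for z
    using closest_point_in_set[of "cball (0::complex) B" z] B0 by (simp add: c_def)
  have cf: "c (f y) = f y" for y
    unfolding c_def using B[of y] by (intro closest_point_self) simp
  have cg: "continuous_on UNIV (\<lambda>y. c (g n y))" for n
    using continuous_on_compose2[OF cc g[of n]] by simp
  then have [measurable]: "(\<lambda>y. c (g n y)) \<in> borel_measurable borel" for n
    by (rule borel_measurable_continuous_onI)
  have "(\<lambda>n. LINT y|lborel. indicator {0..1} y *\<^sub>R (cmod (f y - c (g n y)))\<^sup>2) \<longlonglongrightarrow> (LINT y::real|lborel. (0::real))"
  proof (rule integral_dominated_convergence)
    show "integrable lborel (\<lambda>y. indicator {0..1::real} y *\<^sub>R (2 * B)\<^sup>2)"
      by (intro integrable_scaleR_left integrable_real_indicator) auto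
    show "AE y in lborel. norm (indicator {0..1} y *\<^sub>R (cmod (f y - c (g n y)))\<^sup>2) \<le> indicator {0..1} y *\<^sub>R
        (2 * B)\<^sup>2" for n
    proof (rule AE_I2)
      fix y
      have "cmod (f y - c (g n y)) \<le> 2 * B"
        using norm_triangle_ineq4[of "f y" "c (g n y)"] B[of y] cB[of "g n y"] by linarith
      then have "(cmod (f y - c (g n y)))\<^sup>2 \<le> (2 * B)\<^sup>2"
        by (intro power_mono) auto
      then show "norm (indicator {0..1} y *\<^sub>R (cmod (f y - c (g n y)))\<^sup>2) \<le> indicator {0..1} y *\<^sub>R (2 * B)\<^sup>2"
        by (auto simp: indicator_def)
    qed
    have "AE y in lborel. y \<notin> N"
      using N by (metis AE_completion_iff AE_not_in negligible_iff_null_sets)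
    then show "AE y in lborel. (\<lambda>n. indicator {0..1} y *\<^sub>R (cmod (f y - c (g n y)))\<^sup>2) \<longlonglongrightarrow> 0"
    proof eventually_elim
      case (elim y)
      have "(\<lambda>n. c (g n y)) \<longlonglongrightarrow> c (f y)"
        using cc lim[OF elim] by (metis UNIV_I continuous_on_eq_continuous_at continuous_within_tendsto_compose'
            open_UNIV)
      then have "(\<lambda>n. indicator {0..1} y *\<^sub>R (cmod (f y - c (g n y)))\<^sup>2) \<longlonglongrightarrow> indicator {0..1} y *\<^sub>R
          (cmod (f y - c (f y)))\<^sup>2"
        by (intro tendsto_intros)
      then show ?case by (simp add: cf)
    qed
  qed measurable
  then have "\<forall>\<^sub>F n in sequentially. (LINT y|lborel. indicator {0..1} y *\<^sub>R (cmod (f y - c (g n y)))\<^sup>2) < \<epsilon> / 4"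
    using e by (intro order_tendstoD(2)) auto
  then obtain n where n: "(LINT y:{0..1}|lborel. (cmod (f y - c (g n y)))\<^sup>2) < \<epsilon> / 4"
    unfolding set_lebesgue_integral_def by (auto simp: eventually_sequentially)
  obtain G where G: "lincomb (\<lambda>n y. cos (real n * pi * y)) G" "\<And>y. y \<in> {0..1} \<Longrightarrow> cmod (c (g n y) - G y) < sqrt (\<epsilon> / 4)"
    using cos_approximation[OF continuous_on_subset[OF cg[of n]], of "sqrt (\<epsilon> / 4)"] e by auto
  have [measurable]: "G \<in> borel_measurable borel"
    by (intro borel_measurable_continuous_onI lincomb_continuous[OF G(1)] continuous_intros)
  have i1: "set_integrable lborel {0..1} (\<lambda>y. (cmod (f y - c (g n y)))\<^sup>2)"
    unfolding set_integrable_def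
  proof (rule Bochner_Integration.integrable_bound)
    show "integrable lborel (\<lambda>y. indicator {0..1::real} y *\<^sub>R (2 * B)\<^sup>2)"
      by (intro integrable_scaleR_left integrable_real_indicator) auto
    show "AE y in lborel. norm (indicator {0..1} y *\<^sub>R (cmod (f y - c (g n y)))\<^sup>2) \<le> norm (indicator {0..1} y
        *\<^sub>R (2 * B)\<^sup>2)"
    proof (rule AE_I2)
      fix y
      have "cmod (f y - c (g n y)) \<le> 2 * B"
        using norm_triangle_ineq4[of "f y" "c (g n y)"] B[of y] cB[of "g n y"] by linarith
      then have "(cmod (f y - c (g n y)))\<^sup>2 \<le> (2 * B)\<^sup>2"
        by (intro power_mono) auto
      then show "norm (indicator {0..1} y *\<^sub>R (cmod (f y - c (g n y)))\<^sup>2) \<le> norm (indicator {0..1} y *\<^sub>R (2 * B)\<^sup>2)"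
        by (auto simp: indicator_def)
    qed
  qed measurable
  have i2: "set_integrable lborel {0..1} (\<lambda>y. 2 * (cmod (f y - c (g n y)))\<^sup>2 + \<epsilon> / 2)"
    using i1 by (intro set_integral_add set_integrable_mult_right) (auto simp: set_integrable_def)
  have le: "(cmod (f y - G y))\<^sup>2 \<le> 2 * (cmod (f y - c (g n y)))\<^sup>2 + \<epsilon> / 2" if "y \<in> {0..1}" for y
  proof -
    have "(cmod (c (g n y) - G y))\<^sup>2 \<le> (sqrt (\<epsilon> / 4))\<^sup>2"
      using G(2)[OF that] by (intro power_mono) auto
    then show ?thesis
      using square_triangle[of "f y" "G y" "c (g n y)"] e by simp
  qed
  have i3: "set_integrable lborel {0..1} (\<lambda>y. (cmod (f y - G y))\<^sup>2)"
    unfolding set_integrable_def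
  proof (rule Bochner_Integration.integrable_bound[OF i2[unfolded set_integrable_def]])
    show "AE y in lborel. norm (indicator {0..1} y *\<^sub>R (cmod (f y - G y))\<^sup>2) \<le> norm (indicator {0..1} y *\<^sub>R
        (2 * (cmod (f y - c (g n y)))\<^sup>2 + \<epsilon> / 2))"
    proof (rule AE_I2)
      fix y :: real
      show "norm (indicator {0..1} y *\<^sub>R (cmod (f y - G y))\<^sup>2) \<le> norm (indicator {0..1} y *\<^sub>R
          (2 * (cmod (f y - c (g n y)))\<^sup>2 + \<epsilon> / 2))"
        using le[of y] by (cases "y \<in> {0..1}") auto
    qed
  qed measurable
  have "(LINT y:{0..1}|lborel. (cmod (f y - G y))\<^sup>2) \<le> (LINT y:{0..1}|lborel. 2 * (cmod (f y - c (g n y)))\<^sup>2 + \<epsilon> / 2)"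
    by (rule set_integral_mono[OF i3 i2 le])
  also have "\<dots> = 2 * (LINT y:{0..1}|lborel. (cmod (f y - c (g n y)))\<^sup>2) + (LINT y:{0..1::real}|lborel. \<epsilon> / 2)"
    using i1 by (subst set_integral_add) (auto simp: set_integrable_def[of _ _ "\<lambda>y. \<epsilon> / 2"])
  also have "(LINT y:{0..1::real}|lborel. \<epsilon> / 2) = \<epsilon> / 2"
    by (simp add: set_lebesgue_integral_def)
  finally have "(LINT y:{0..1}|lborel. (cmod (f y - G y))\<^sup>2) < \<epsilon>" using n by linarith
  then show ?thesis using G(1) by blast
qed

lemma l2_unit_diff_integrable:
  assumes f: "l2_unit f" and G: "continuous_on UNIV G"
  shows "set_integrable lborel {0..1} (\<lambda>y. (cmod (f y - G y))\<^sup>2)"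
  unfolding set_integrable_def
proof (rule Bochner_Integration.integrable_bound)
  have [measurable]: "f \<in> borel_measurable borel" "G \<in> borel_measurable borel"
    using f G by (auto simp: l2_unit_def intro: borel_measurable_continuous_onI)
  have "set_integrable lborel {0..1} (\<lambda>y. (cmod (G y))\<^sup>2)"
    unfolding set_integrable_def
    by (intro borel_integrable_compact continuous_intros continuous_on_subset[OF G]) auto
  then show "integrable lborel (\<lambda>y. 2 * (cmod (f y))\<^sup>2 + 2 * (indicator {0..1} y *\<^sub>R (cmod (G y))\<^sup>2))"
    using f by (auto simp: l2_unit_def set_integrable_def)
  show "(\<lambda>y. indicator {0..1} y *\<^sub>R (cmod (f y - G y))\<^sup>2) \<in> borel_measurable lborel"
    by measurable
  show "AE y in lborel. norm (indicator {0..1} y *\<^sub>R (cmod (f y - G y))\<^sup>2) \<le> norm (2 * (cmod (f y))\<^sup>2 + 2 *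
      (indicator {0..1} y *\<^sub>R (cmod (G y))\<^sup>2))"
  proof (rule AE_I2)
    fix y
    show "norm (indicator {0..1} y *\<^sub>R (cmod (f y - G y))\<^sup>2) \<le> norm (2 * (cmod (f y))\<^sup>2 + 2 * (indicator {0..1}
        y *\<^sub>R (cmod (G y))\<^sup>2))"
      using square_triangle[of "f y" "G y" 0] by (cases "y \<in> {0..1}") auto
  qed
qed

lemma l2_unit_restrict:
  assumes "l2_unit f" "E \<in> sets borel"
  shows "l2_unit (\<lambda>y. indicator E y *\<^sub>R f y)"
proof -
  have "integrable lborel (\<lambda>y. (cmod (indicator E y *\<^sub>R f y))\<^sup>2)"
  proof (rule Bochner_Integration.integrable_bound)
    show "integrable lborel (\<lambda>y. (cmod (f y))\<^sup>2)" using assms(1) by (simp add: l2_unit_def)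
    show "(\<lambda>y. (cmod (indicator E y *\<^sub>R f y))\<^sup>2) \<in> borel_measurable lborel"
      using assms by (auto simp: l2_unit_def)
  qed (auto simp: indicator_def)
  then show ?thesis using assms by (auto simp: l2_unit_def)
qed

text \<open>It suffices to approximate \<open>f\<close> on sets \<open>E n\<close> that eventually
  contain each point of (0,1); the rest tends to zero by domination with |f|^2. The class
  \<open>L\<close> is left open so that one argument serves cosines and sines. Two errors below
  \<epsilon>/4 are doubled by \<open>square_triangle\<close>.\<close>

lemma l2_truncation:
  assumes f: "l2_unit f" and E: "\<And>n. E n \<in> sets borel"
    and ev: "\<And>y. y \<in> {0<..<1} \<Longrightarrow> \<forall>\<^sub>F n in sequentially. y \<in> E n"
    and L: "\<And>G. L G \<Longrightarrow> continuous_on UNIV G"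
    and approx: "\<And>n \<epsilon>. 0 < \<epsilon> \<Longrightarrow> \<exists>G. L G \<and> (LINT y:{0..1}|lborel. (cmod (indicator (E n) y *\<^sub>R f y - G y))\<^sup>2) < \<epsilon>"
    and e: "0 < \<epsilon>"
  shows "\<exists>G. L G \<and> (LINT y:{0..1}|lborel. (cmod (f y - G y))\<^sup>2) < \<epsilon>"
proof -
  have fm[measurable]: "f \<in> borel_measurable borel" using f by (simp add: l2_unit_def)
  note [measurable] = E
  let ?d = "\<lambda>n y. indicator {0..1} y *\<^sub>R (cmod (f y - indicator (E n) y *\<^sub>R f y))\<^sup>2"
  have "(\<lambda>n. LINT y|lborel. ?d n y) \<longlonglongrightarrow> (LINT y::real|lborel. (0::real))"
  proof (rule integral_dominated_convergence)
    show "integrable lborel (\<lambda>y. (cmod (f y))\<^sup>2)" using f by (simp add: l2_unit_def)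
    show "AE y in lborel. norm (?d n y) \<le> (cmod (f y))\<^sup>2" for n
      by (intro AE_I2) (auto simp: indicator_def)
    show "AE y in lborel. (\<lambda>n. ?d n y) \<longlonglongrightarrow> 0"
    proof (rule AE_I2)
      fix y
      have "\<forall>\<^sub>F n in sequentially. ?d n y = 0"
      proof (cases "y \<in> {0<..<1}")
        case True
        show ?thesis using ev[OF True] by eventually_elim simp
      next
        case False
        then have "f y = 0" using f by (simp add: l2_unit_def)
        then show ?thesis by simp
      qed
      then show "(\<lambda>n. ?d n y) \<longlonglongrightarrow> 0" by (rule tendsto_eventually)
    qed
  qed measurable
  then have "\<forall>\<^sub>F n in sequentially. (LINT y|lborel. ?d n y) < \<epsilon> / 4"
    using e by (intro order_tendstoD(2)) auto
  then obtain n where n: "(LINT y:{0..1}|lborel. (cmod (f y - indicator (E n) y *\<^sub>R f y))\<^sup>2) < \<epsilon> / 4"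
    unfolding set_lebesgue_integral_def by (auto simp: eventually_sequentially)
  obtain G where G: "L G" "(LINT y:{0..1}|lborel. (cmod (indicator (E n) y *\<^sub>R f y - G y))\<^sup>2) < \<epsilon> / 4"
    using approx[of "\<epsilon> / 4" n] e by auto
  have i2: "set_integrable lborel {0..1} (\<lambda>y. (cmod (indicator (E n) y *\<^sub>R f y - G y))\<^sup>2)"
    by (rule l2_unit_diff_integrable[OF l2_unit_restrict[OF f E] L[OF G(1)]])
  have i1: "set_integrable lborel {0..1} (\<lambda>y. (cmod (f y - indicator (E n) y *\<^sub>R f y))\<^sup>2)"
    unfolding set_integrable_def
  proof (rule Bochner_Integration.integrable_bound)
    show "integrable lborel (\<lambda>y. (cmod (f y))\<^sup>2)" using f by (simp add: l2_unit_def)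
  qed (auto simp: indicator_def)
  have "(LINT y:{0..1}|lborel. (cmod (f y - G y))\<^sup>2) \<le> (LINT y:{0..1}|lborel. 2 * (cmod (f y - indicator (E n) y
      *\<^sub>R f y))\<^sup>2
      + 2 * (cmod (indicator (E n) y *\<^sub>R f y - G y))\<^sup>2)"
    by (intro set_integral_mono[OF l2_unit_diff_integrable[OF f L[OF G(1)]]] set_integral_add
        set_integrable_mult_right i1 i2 square_triangle)
  also have "\<dots> = 2 * (LINT y:{0..1}|lborel. (cmod (f y - indicator (E n) y *\<^sub>R f y))\<^sup>2)
      + 2 * (LINT y:{0..1}|lborel. (cmod (indicator (E n) y *\<^sub>R f y - G y))\<^sup>2)"
    using i1 i2 by (subst set_integral_add) auto
  also have "\<dots> < \<epsilon>" using n G(2) by linarith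
  finally show ?thesis using G(1) by blast
qed

text \<open>Truncation at the level sets of |f| reduces the claim to bounded functions.\<close>

lemma cos_dense:
  assumes f: "l2_unit f" and e: "0 < \<epsilon>"
  shows "\<exists>G. lincomb (\<lambda>n y. cos (real n * pi * y)) G \<and> (LINT y:{0..1}|lborel. (cmod (f y - G y))\<^sup>2) < \<epsilon>"
proof (rule l2_truncation[OF f _ _ _ _ e])
  have [measurable]: "f \<in> borel_measurable borel" using f by (simp add: l2_unit_def)
  show Em: "{y. cmod (f y) \<le> real n} \<in> sets borel" for n by measurable
  show "\<forall>\<^sub>F n in sequentially. y \<in> {y. cmod (f y) \<le> real n}" for y
    using eventually_ge_at_top[of "nat \<lceil>cmod (f y)\<rceil>"] by eventually_elim (simp add: nat_ceiling_le_eq)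
  show "lincomb (\<lambda>n y. cos (real n * pi * y)) G \<Longrightarrow> continuous_on UNIV G" for G
    by (erule lincomb_continuous) (intro continuous_intros)
  show "\<exists>G. lincomb (\<lambda>n y. cos (real n * pi * y)) G \<and>
    (LINT y:{0..1}|lborel. (cmod (indicator {y. cmod (f y) \<le> real n} y *\<^sub>R f y - G y))\<^sup>2) < \<epsilon>'" if "0 < \<epsilon>'" for n \<epsilon>'
    by (rule l2_unit_bounded_approx[OF l2_unit_restrict[OF f Em] _ that, of _ "real n"]) (auto simp: indicator_def)
qed

text \<open>sin (pi y) cos (n pi y) is half the difference of the sines of frequency n + 1 and n -
  1. The frequencies of the system start at 1, hence the separate cases n = 0 and n = 1.\<close>

lemma lincomb_sin_mult:
  assumes "lincomb (\<lambda>n y. cos (real n * pi * y)) G"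
  shows "lincomb (\<lambda>n y. sin (real (Suc n) * pi * y)) (\<lambda>y. of_real (sin (pi * y)) * G y)"
  using assms
proof induction
  case zero
  then show ?case using lincomb.zero by simp
next
  case (step G d n)
  let ?S = "\<lambda>n y. sin (real (Suc n) * pi * y)"
  have "lincomb ?S (\<lambda>y. of_real (sin (pi * y)) * (d * of_real (cos (real n * pi * y))))"
  proof -
    consider "n = 0" | "n = 1" | m where "n = Suc (Suc m)"
      by (metis One_nat_def not0_implies_Suc)
    then show ?thesis
    proof cases
      case 1
      then show ?thesis using lincomb_single[of ?S d 0] by (simp add: mult.commute)
    next
      case 2
      have "of_real (sin (pi * y)) * (d * of_real (cos (real n * pi * y))) = (d / 2) * complex_of_real (?S 1 y)" for y
        using sin_double[of "pi * y"] 2 by (simp add: mult_ac)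
      then show ?thesis using lincomb_single[of ?S "d / 2" 1] by (simp only:)
    next
      case 3
      have "sin (pi * y) * cos (real n * pi * y) = (?S n y - ?S m y) / 2" for y
      proof -
        have "?S m y = sin (real n * pi * y - pi * y)" "?S n y = sin (real n * pi * y + pi * y)"
          by (simp_all add: 3 algebra_simps)
        then show ?thesis by (simp add: sin_add sin_diff)
      qed
      then have *: "complex_of_real (sin (pi * y)) * of_real (cos (real n * pi * y)) = (of_real (?S n y) -
          of_real (?S m y)) / 2" for y
        by (simp only: of_real_mult[symmetric]) simp
      have "of_real (sin (pi * y)) * (d * of_real (cos (real n * pi * y))) = (d / 2) * complex_of_real (?S n y)
          + (- d / 2) * complex_of_real (?S m y)" for y
      proof -
        have "of_real (sin (pi * y)) * (d * of_real (cos (real n * pi * y))) = d * (complex_of_real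
            (sin (pi * y)) * of_real (cos (real n * pi * y)))"
          by (simp only: mult_ac)
        then show ?thesis unfolding * by (simp add: field_simps)
      qed
      then show ?thesis by (simp only:) (intro lincomb_add lincomb_single)
    qed
  qed
  then show ?case
    unfolding distrib_left by (intro lincomb_add step.IH)
qed

text \<open>On the set where \<open>\<bar>f y\<bar> \<le> n sin (pi y)\<close> the function \<open>f\<close> is \<open>sin (pi y)\<close> times a bounded function, and
  \<open>sin (pi y)\<close> times a combination of cosines is a combination of sines.\<close>

lemma sin_dense:
  assumes f: "l2_unit f" and e: "0 < \<epsilon>"
  shows "\<exists>G. lincomb (\<lambda>n y. sin (real (Suc n) * pi * y)) G \<and> (LINT y:{0..1}|lborel. (cmod (f y - G y))\<^sup>2) < \<epsilon>"
proof (rule l2_truncation[OF f _ _ _ _ e])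
  have [measurable]: "f \<in> borel_measurable borel" using f by (simp add: l2_unit_def)
  show Em: "{y. cmod (f y) \<le> real n * sin (pi * y)} \<in> sets borel" for n by measurable
  show "\<forall>\<^sub>F n in sequentially. y \<in> {y. cmod (f y) \<le> real n * sin (pi * y)}" if "y \<in> {0<..<1}" for y
  proof -
    have "0 < sin (pi * y)" using that by (intro sin_gt_zero) auto
    then show ?thesis
      using eventually_ge_at_top[of "nat \<lceil>cmod (f y) / sin (pi * y)\<rceil>"]
      by (auto elim!: eventually_mono simp: nat_ceiling_le_eq pos_divide_le_eq)
  qed
  show "lincomb (\<lambda>n y. sin (real (Suc n) * pi * y)) G \<Longrightarrow> continuous_on UNIV G" for G
    by (erule lincomb_continuous) (intro continuous_intros)
  show "\<exists>G. lincomb (\<lambda>n y. sin (real (Suc n) * pi * y)) G \<and>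
    (LINT y:{0..1}|lborel. (cmod (indicator {y. cmod (f y) \<le> real n * sin (pi * y)} y *\<^sub>R f y - G y))\<^sup>2) <
        \<epsilon>'" if e': "0 < \<epsilon>'" for n \<epsilon>'
  proof -
    let ?E = "{y. cmod (f y) \<le> real n * sin (pi * y)}"
    \<comment> \<open>At the zeros of the sine the quotient is 0 by the convention on division, so
      \<open>g\<close> is bounded by n everywhere.\<close>
    define g where "g = (\<lambda>y. indicator ?E y *\<^sub>R f y / of_real (sin (pi * y)))"
    have gm[measurable]: "g \<in> borel_measurable borel"
      unfolding g_def by measurable
    have gB: "cmod (g y) \<le> real n" for y
    proof (cases "y \<in> ?E \<and> sin (pi * y) \<noteq> 0")
      case True
      then have "0 \<le> real n * sin (pi * y)" using order_trans[OF norm_ge_zero, of "f y" "real n * sin (pi * y)"]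
          by auto
      then have "n = 0 \<or> 0 < sin (pi * y)" using True by (auto simp: zero_le_mult_iff less_le)
      then show ?thesis using True by (auto simp: g_def norm_divide divide_simps)
    qed (auto simp: g_def indicator_def)
    have g0: "g y = 0" if "y \<notin> {0<..<1}" for y
      using f that by (simp add: g_def l2_unit_def)
    have g: "l2_unit g"
      unfolding l2_unit_def
    proof (intro conjI gm allI impI g0)
      show "integrable lborel (\<lambda>y. (cmod (g y))\<^sup>2)"
      proof (rule Bochner_Integration.integrable_bound)
        show "integrable lborel (\<lambda>y. indicator {0..1::real} y *\<^sub>R (real n)\<^sup>2)"
          by (intro integrable_scaleR_left integrable_real_indicator) auto
        show "AE y in lborel. norm ((cmod (g y))\<^sup>2) \<le> norm (indicator {0..1} y *\<^sub>R (real n)\<^sup>2)"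
        proof (rule AE_I2)
          fix y
          have "(cmod (g y))\<^sup>2 \<le> (real n)\<^sup>2" by (intro power_mono gB) simp
          then show "norm ((cmod (g y))\<^sup>2) \<le> norm (indicator {0..1} y *\<^sub>R (real n)\<^sup>2)"
            using g0[of y] by (cases "y \<in> {0<..<1}") (auto simp: indicator_def)
        qed
      qed measurable
    qed auto
    obtain G where G: "lincomb (\<lambda>n y. cos (real n * pi * y)) G" "(LINT y:{0..1}|lborel. (cmod (g y - G y))\<^sup>2) < \<epsilon>'"
      using cos_dense[OF g e'] by blast
    have cG: "continuous_on UNIV G"
      by (rule lincomb_continuous[OF G(1)]) (intro continuous_intros)
    \<comment> \<open>Where the sine vanishes, the condition defining \<open>?E\<close> forces f y =
      0, so nothing is lost by the division.\<close>
    have eq: "indicator ?E y *\<^sub>R f y = of_real (sin (pi * y)) * g y" for y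
    proof (cases "sin (pi * y) = 0")
      case True
      then show ?thesis by (auto simp: indicator_def)
    qed (simp add: g_def scaleR_conv_of_real)
    have "(LINT y:{0..1}|lborel. (cmod (indicator ?E y *\<^sub>R f y - of_real (sin (pi * y)) * G y))\<^sup>2) \<le>
        (LINT y:{0..1}|lborel. (cmod (g y - G y))\<^sup>2)"
    proof (intro set_integral_mono l2_unit_diff_integrable l2_unit_restrict f Em g cG continuous_intros)
      fix y
      have "cmod (of_real (sin (pi * y)) * (g y - G y)) \<le> 1 * cmod (g y - G y)"
        unfolding norm_mult by (intro mult_right_mono) auto
      then show "(cmod (indicator ?E y *\<^sub>R f y - of_real (sin (pi * y)) * G y))\<^sup>2 \<le> (cmod (g y - G y))\<^sup>2"
        unfolding eq by (intro power_mono) (auto simp: right_diff_distrib)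
    qed
    then show ?thesis
      using G(2) lincomb_sin_mult[OF G(1)] by (meson le_less_trans)
  qed
qed

section \<open>Orthogonality relations, and Parseval's identity on a strip\<close>

lemma integral_cos_unit:
  "(LINT y:{0..1}|lborel. cos (of_int j * pi * y)) = (if j = 0 then 1 else 0)"
proof (cases "j = 0")
  case False
  have "(LINT y:{0..1}|lborel. cos (of_int j * pi * y)) = sin (of_int j * pi * 1) / (of_int j * pi) - sin
      (of_int j * pi * 0) / (of_int j * pi)"
    unfolding set_lebesgue_integral_def
    using False by (intro integral_FTC_Icc) (auto intro!: derivative_eq_intros continuous_intros simp flip:
        has_real_derivative_iff_has_vector_derivative)
  also have "\<dots> = 0" by (simp add: sin_int_times_real mult.commute)
  finally show ?thesis using False by simp
qed (simp add: set_lebesgue_integral_def)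

lemma cos_set_integrable: "set_integrable lborel {0..1} (\<lambda>y. cos (c * y))" for c :: real
  unfolding set_integrable_def by (intro borel_integrable_compact continuous_intros) auto

text \<open>The second indicator is active only for n = m = 0, where the function is constant and
  the integral is 1 instead of 1/2.\<close>

lemma integral_cos_cos:
  "(LINT y:{0..1}|lborel. cos (real n * pi * y) * cos (real m * pi * y)) =
    ((if n = m then 1 else 0) + (if n + m = 0 then 1 else 0)) / 2"
proof -
  have "cos (real n * pi * y) * cos (real m * pi * y) = (1/2) * cos ((of_int (int n - int m) * pi) * y) + (1/2)
      * cos ((of_int (int n + int m) * pi) * y)" for y
  proof -
    have e: "(of_int (int n - int m) * pi) * y = real n * pi * y - real m * pi * y"
      "(of_int (int n + int m) * pi) * y = real n * pi * y + real m * pi * y"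
      by (simp_all add: algebra_simps)
    show ?thesis unfolding e by (simp add: cos_times_cos add_divide_distrib)
  qed
  then show ?thesis
    using integral_cos_unit[of "int n - int m"] integral_cos_unit[of "int n + int m"] cos_set_integrable
    by simp
qed

lemma integral_sin_sin:
  "(LINT y:{0..1}|lborel. sin (real (Suc n) * pi * y) * sin (real (Suc m) * pi * y)) =
    (if n = m then 1 else 0) / 2"
proof -
  have "sin (real (Suc n) * pi * y) * sin (real (Suc m) * pi * y) = (1/2) * cos ((of_int (int n - int m) * pi) *
      y) - (1/2) * cos ((of_int (int n + int m + 2) * pi) * y)" for y
  proof -
    have e: "(of_int (int n - int m) * pi) * y = real (Suc n) * pi * y - real (Suc m) * pi * y"
      "(of_int (int n + int m + 2) * pi) * y = real (Suc n) * pi * y + real (Suc m) * pi * y"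
      by (simp_all add: algebra_simps)
    show ?thesis unfolding e by (simp add: sin_times_sin diff_divide_distrib)
  qed
  then show ?thesis
    using integral_cos_unit[of "int n - int m"] integral_cos_unit[of "int n + int m + 2"] cos_set_integrable
    by simp
qed

interpretation cos_basis: l2_basis cos_basis
proof
  show "continuous_on UNIV (cos_basis n)" for n
    unfolding cos_basis_def by (cases "n = 0") (auto intro!: continuous_intros)
  define r :: "nat \<Rightarrow> real" where "r = (\<lambda>n. if n = 0 then 1 else sqrt 2)"
  have b: "cos_basis n y = r n * cos (real n * pi * y)" for n y
    by (simp add: cos_basis_def r_def)
  show "(LINT y:{0..1}|lborel. cos_basis n y * cos_basis m y) = (if n = m then 1 else 0)" for n m
  proof -
    have "cos_basis n y * cos_basis m y = (r n * r m) * (cos (real n * pi * y) * cos (real m * pi * y))" for y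
      by (simp add: b mult_ac)
    then have "(LINT y:{0..1}|lborel. cos_basis n y * cos_basis m y) = (r n * r m) * (LINT y:{0..1}|lborel. cos
        (real n * pi * y) * cos (real m * pi * y))"
      by simp
    then show ?thesis
      unfolding integral_cos_cos r_def by (cases "n = m"; cases "n = 0"; cases "m = 0") simp_all
  qed
  fix f :: "real \<Rightarrow> complex" and \<epsilon> :: real assume "l2_unit f" "0 < \<epsilon>"
  moreover have "(\<lambda>y. cos (real n * pi * y)) = (\<lambda>y. (1 / r n) * cos_basis n y)" for n
    by (auto simp: b r_def)
  ultimately show "\<exists>G. lincomb cos_basis G \<and> (LINT y:{0..1}|lborel. (cmod (f y - G y))\<^sup>2) < \<epsilon>"
    using cos_dense lincomb_rescale[of "\<lambda>n y. cos (real n * pi * y)" _ "\<lambda>n. 1 / r n" cos_basis] by meson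
qed

interpretation sin_basis: l2_basis sin_basis
proof
  show "continuous_on UNIV (sin_basis n)" for n
    unfolding sin_basis_def by (intro continuous_intros)
  show "(LINT y:{0..1}|lborel. sin_basis n y * sin_basis m y) = (if n = m then 1 else 0)" for n m
  proof -
    have "sin_basis n y * sin_basis m y = 2 * (sin (real (Suc n) * pi * y) * sin (real (Suc m) * pi * y))" for y
    proof -
      have "sqrt 2 * x * (sqrt 2 * z) = (sqrt 2 * sqrt 2) * (x * z)" for x z :: real
        by (simp only: mult_ac)
      then show ?thesis unfolding sin_basis_def by simp
    qed
    then have "(LINT y:{0..1}|lborel. sin_basis n y * sin_basis m y) = 2 * (LINT y:{0..1}|lborel. sin
        (real (Suc n) * pi * y) * sin (real (Suc m) * pi * y))"
      by (simp only: set_integral_mult_right)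
    then show ?thesis
      unfolding integral_sin_sin by simp
  qed
  fix f :: "real \<Rightarrow> complex" and \<epsilon> :: real assume "l2_unit f" "0 < \<epsilon>"
  moreover have "(\<lambda>y. sin (real (Suc n) * pi * y)) = (\<lambda>y. (1 / sqrt 2) * sin_basis n y)" for n
    by (auto simp: sin_basis_def)
  ultimately show "\<exists>G. lincomb sin_basis G \<and> (LINT y:{0..1}|lborel. (cmod (f y - G y))\<^sup>2) < \<epsilon>"
    using sin_dense lincomb_rescale[of "\<lambda>n y. sin (real (Suc n) * pi * y)" _ "\<lambda>n. 1 / sqrt 2" sin_basis] by meson
qed

text \<open>Parseval on almost every slice with x fixed, integrated over x. The square integrable
  slices come from Fubini.\<close>

lemma (in l2_basis) strip_Parseval:
  fixes G :: "real \<times> real \<Rightarrow> complex"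
  assumes Gm: "G \<in> borel_measurable borel" and G2: "integrable lborel (\<lambda>z. (cmod (G z))\<^sup>2)"
    and G0: "\<And>z. snd z \<notin> {0<..<1} \<Longrightarrow> G z = 0"
  defines "c \<equiv> \<lambda>n x. LINT y|lborel. G (x, y) * of_real (e n y)"
  shows "c n \<in> borel_measurable borel" "integrable lborel (\<lambda>x. (cmod (c n x))\<^sup>2)"
    "(\<lambda>n. LINT x|lborel. (cmod (c n x))\<^sup>2) sums (LINT z|lborel. (cmod (G z))\<^sup>2)"
proof -
  have em[measurable]: "e n \<in> borel_measurable borel" for n
    by (rule borel_measurable_continuous_onI[OF cont])
  have Gm'[measurable]: "G \<in> borel_measurable (lborel \<Otimes>\<^sub>M lborel)"
    using Gm by (simp add: lborel_prod)
  show cm: "c n \<in> borel_measurable borel" for n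
  proof -
    have "(\<lambda>x. LINT y|lborel. G (x, y) * of_real (e n y)) \<in> borel_measurable lborel"
      by measurable
    then show ?thesis by (simp add: c_def)
  qed
  note [measurable] = cm
  have G2': "integrable (lborel \<Otimes>\<^sub>M lborel) (\<lambda>z. (cmod (G z))\<^sup>2)"
    using G2 by (simp add: lborel_prod)
  define N where "N = (\<lambda>x. LINT y|lborel. (cmod (G (x, y)))\<^sup>2)"
  have iN: "integrable lborel N"
    using lborel_pair.integrable_fst'[OF G2'] by (simp add: N_def)
  have slice: "AE x in lborel. l2_unit (\<lambda>y. G (x, y))"
    using lborel_pair.AE_integrable_fst'[OF G2']
  proof eventually_elim
    case (elim x)
    have "(\<lambda>y. G (x, y)) \<in> borel_measurable lborel" by measurable
    then show ?case using elim G0 by (auto simp: l2_unit_def)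
  qed
  \<comment> \<open>All partial sums lie below the one integrable function \<open>N\<close>; this
    yields the integrability of each term and the exchange of sum and integral.\<close>
  have bess: "AE x in lborel. (\<Sum>n<m. (cmod (c n x))\<^sup>2) \<le> N x" for m
    using slice by eventually_elim (use Bessel in \<open>auto simp: c_def N_def\<close>)
  have pars: "AE x in lborel. (\<lambda>n. (cmod (c n x))\<^sup>2) sums N x"
    using slice by eventually_elim (use Parseval in \<open>auto simp: c_def N_def\<close>)
  show i: "integrable lborel (\<lambda>x. (cmod (c n x))\<^sup>2)" for n
  proof (rule Bochner_Integration.integrable_bound[OF iN])
    show "AE x in lborel. norm ((cmod (c n x))\<^sup>2) \<le> norm (N x)"
      using bess[of "Suc n"]
    proof eventually_elim
      case (elim x)
      have "(cmod (c n x))\<^sup>2 \<le> (\<Sum>k<Suc n. (cmod (c k x))\<^sup>2)"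
        by (simp add: sum_nonneg)
      then show ?case using elim by simp
    qed
  qed measurable
  have "summable (\<lambda>n. LINT x|lborel. norm ((cmod (c n x))\<^sup>2))"
  proof (rule summableI_nonneg_bounded)
    fix m
    have "(\<Sum>n<m. LINT x|lborel. norm ((cmod (c n x))\<^sup>2)) = (LINT x|lborel. (\<Sum>n<m. (cmod (c n x))\<^sup>2))"
      using i by (simp add: Bochner_Integration.integral_sum)
    also have "\<dots> \<le> (LINT x|lborel. N x)"
      by (intro integral_mono_AE iN bess Bochner_Integration.integrable_sum i)
    finally show "(\<Sum>n<m. LINT x|lborel. norm ((cmod (c n x))\<^sup>2)) \<le> (LINT x|lborel. N x)" .
  qed simp
  moreover have "AE x in lborel. summable (\<lambda>n. norm ((cmod (c n x))\<^sup>2))"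
    using pars by eventually_elim (auto simp: sums_iff)
  ultimately have "(\<lambda>n. LINT x|lborel. (cmod (c n x))\<^sup>2) sums (LINT x|lborel. (\<Sum>n. (cmod (c n x))\<^sup>2))"
    using i by (intro sums_integral) auto
  also have "(LINT x|lborel. (\<Sum>n. (cmod (c n x))\<^sup>2)) = (LINT x|lborel. N x)"
  proof (rule integral_cong_AE)
    show "AE x in lborel. (\<Sum>n. (cmod (c n x))\<^sup>2) = N x"
      using pars by eventually_elim (auto simp: sums_iff)
    show "N \<in> borel_measurable lborel" using iN by auto
  qed measurable
  also have "\<dots> = (LINT z|lborel. (cmod (G z))\<^sup>2)"
    using lborel_pair.integral_fst'[OF G2'] by (simp add: N_def lborel_prod)
  finally show "(\<lambda>n. LINT x|lborel. (cmod (c n x))\<^sup>2) sums (LINT z|lborel. (cmod (G z))\<^sup>2)" .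
qed

section \<open>Smooth functions and test functions\<close>

lemma Ck_SucI:
  assumes "\<And>x. (f has_derivative D x) (at x)" "\<And>e. e \<in> Basis \<Longrightarrow> Ck k (\<lambda>x. D x e)"
  shows "Ck (Suc k) f"
proof -
  have "dderiv e f = (\<lambda>x. D x e)" for e
    unfolding dderiv_def using frechet_derivative_at[OF assms(1)] by auto
  moreover have "f differentiable_on UNIV"
    using assms(1) by (auto simp: differentiable_on_def differentiable_def)
  ultimately show ?thesis
    using assms(2) by simp
qed

lemma Ck_SucD:
  assumes "Ck (Suc k) f"
  shows "(f has_derivative frechet_derivative f (at x)) (at x)"
    "e \<in> Basis \<Longrightarrow> Ck k (\<lambda>x. frechet_derivative f (at x) e)"
  using assms by (auto simp: differentiable_on_def dderiv_def frechet_derivative_works)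

lemma Ck_less: "Ck (Suc k) f \<Longrightarrow> Ck k f"
proof (induction k arbitrary: f)
  case 0
  then show ?case
    by (auto intro: differentiable_imp_continuous_on)
qed auto

lemma Ck_const: "Ck k (\<lambda>x. c)"
proof (induction k arbitrary: c)
  case (Suc k)
  show ?case
    by (rule Ck_SucI[where D="\<lambda>x e. 0"]) (auto intro: Suc)
qed auto

lemma Ck_add:
  assumes "Ck k f" "Ck k g"
  shows "Ck k (\<lambda>x. f x + g x)"
  using assms
proof (induction k arbitrary: f g)
  case (Suc k)
  note D = Ck_SucD[OF Suc.prems(1)] Ck_SucD[OF Suc.prems(2)]
  show ?case
    by (rule Ck_SucI[OF has_derivative_add[OF D(1,3)]]) (intro Suc.IH D)
qed (auto intro: continuous_intros)

lemma Ck_mult: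
  assumes "Ck k f" "Ck k g"
  shows "Ck k (\<lambda>x. f x * g x)"
  using assms
proof (induction k arbitrary: f g)
  case (Suc k)
  note D = Ck_SucD[OF Suc.prems(1)] Ck_SucD[OF Suc.prems(2)]
  show ?case
    by (rule Ck_SucI[OF has_derivative_mult[OF D(1,3)]])
      (intro Ck_add Suc.IH D Suc.prems[THEN Ck_less])
qed (auto intro: continuous_intros)

lemma smooth_const: "smooth (\<lambda>x. c)"
  by (simp add: smooth_def Ck_const)

lemma smooth_add: "smooth f \<Longrightarrow> smooth g \<Longrightarrow> smooth (\<lambda>x. f x + g x)"
  by (simp add: smooth_def Ck_add)

lemma smooth_mult: "smooth f \<Longrightarrow> smooth g \<Longrightarrow> smooth (\<lambda>x. f x * g x)"
  by (simp add: smooth_def Ck_mult)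

lemma smooth_diff: "smooth f \<Longrightarrow> smooth g \<Longrightarrow> smooth (\<lambda>x. f x - g x)"
  using smooth_add[of f "\<lambda>x. -1 * g x"] smooth_mult[OF smooth_const, of g "-1"] by simp

lemma smooth_dderiv: "smooth f \<Longrightarrow> e \<in> Basis \<Longrightarrow> smooth (dderiv e f)"
  unfolding smooth_def by (metis Ck.simps(2))

lemma smooth_continuous: "smooth f \<Longrightarrow> continuous_on S f"
  unfolding smooth_def by (metis Ck.simps(1) continuous_on_subset top_greatest)

lemma smooth_has_derivative:
  "smooth f \<Longrightarrow> (f has_derivative frechet_derivative f (at x)) (at x)"
  unfolding smooth_def using Ck_SucD(1) by blast

lemma smooth_has_vector_derivative:
  assumes "smooth (f :: real \<Rightarrow> complex)"
  shows "(f has_vector_derivative dderiv 1 f x) (at x)"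
proof -
  have "frechet_derivative f (at x) t = t *\<^sub>R frechet_derivative f (at x) 1" for t
    using linear_scale[OF has_derivative_linear[OF smooth_has_derivative[OF assms]], of x t 1] by simp
  then show ?thesis
    using smooth_has_derivative[OF assms, of x]
    unfolding has_vector_derivative_def dderiv_def by (metis (no_types, lifting) ext)
qed

text \<open>A class of functions of one variable in which every member has its derivative in the
  class consists of smooth functions. The inner affine map transfers this to functions of one
  coordinate in the plane.\<close>

lemma smooth_real_induct:
  fixes h :: "real \<Rightarrow> complex" and c :: "'a::euclidean_space"
  assumes "\<And>h. I h \<Longrightarrow> \<exists>h'. I h' \<and> (\<forall>t. (h has_vector_derivative h' t) (at t))" and "I h"
  shows "smooth (\<lambda>z. h (c \<bullet> z + b))"
proof -
  have "Ck k (\<lambda>z. h (c \<bullet> z + b))" for k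
    using \<open>I h\<close>
  proof (induction k arbitrary: h)
    case 0
    then obtain h' where "\<And>t. (h has_vector_derivative h' t) (at t)"
      using assms(1) by blast
    then have "continuous_on UNIV h"
      by (meson continuous_at_imp_continuous_on has_vector_derivative_continuous)
    then have "continuous_on UNIV (h \<circ> (\<lambda>z. c \<bullet> z + b))"
      by (intro continuous_on_compose continuous_intros) (auto intro: continuous_on_subset)
    then show ?case by (simp add: o_def)
  next
    case (Suc k)
    obtain h' where h': "I h'" "\<And>t. (h has_vector_derivative h' t) (at t)"
      using assms(1)[OF Suc.prems] by blast
    show ?case
    proof (rule Ck_SucI)
      fix x :: 'a
      have "((\<lambda>z. c \<bullet> z + b) has_derivative (\<lambda>e. c \<bullet> e)) (at x)"
        by (auto intro!: derivative_eq_intros)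
      from has_derivative_compose[OF this h'(2)[unfolded has_vector_derivative_def]]
      show "((\<lambda>z. h (c \<bullet> z + b)) has_derivative (\<lambda>e. h' (c \<bullet> x + b) * of_real (c \<bullet> e))) (at x)"
        by (simp add: scaleR_conv_of_real mult.commute)
      show "Ck k (\<lambda>x. h' (c \<bullet> x + b) * of_real (c \<bullet> e))" for e
        by (intro Ck_mult Suc.IH Ck_const h')
    qed
  qed
  then show ?thesis by (simp add: smooth_def)
qed

lemma smooth_compose_affine:
  fixes h :: "real \<Rightarrow> complex"
  assumes "smooth h"
  shows "smooth (\<lambda>z. h (c \<bullet> z + b))"
proof (rule smooth_real_induct[where I=smooth, OF _ assms])
  fix h :: "real \<Rightarrow> complex" assume "smooth h"
  then show "\<exists>h'. smooth h' \<and> (\<forall>t. (h has_vector_derivative h' t) (at t))"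
    using smooth_has_vector_derivative smooth_dderiv[of h 1] by auto
qed

text \<open>The smooth functions together with \<open>h\<close> itself form a class closed under
  differentiation.\<close>

lemma smooth_antideriv:
  fixes h :: "real \<Rightarrow> complex"
  assumes "smooth h'" "\<And>t. (h has_vector_derivative h' t) (at t)"
  shows "smooth h"
proof -
  have "smooth (\<lambda>z. h ((1::real) \<bullet> z + 0))"
  proof (rule smooth_real_induct[where I="\<lambda>f. f = h \<or> smooth f"])
    fix f :: "real \<Rightarrow> complex" assume "f = h \<or> smooth f"
    then show "\<exists>f'. (f' = h \<or> smooth f') \<and> (\<forall>t. (f has_vector_derivative f' t) (at t))"
      using assms smooth_has_vector_derivative smooth_dderiv[of f 1] by auto
  qed simp
  then show ?thesis by simp
qed

lemma smooth_tensor: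
  fixes p q :: "real \<Rightarrow> complex"
  assumes "smooth p" "smooth q"
  shows "smooth (\<lambda>z. p (fst z) * q (snd z))"
  using smooth_mult[OF smooth_compose_affine[OF assms(1), of "(1::real,0::real)" 0] smooth_compose_affine[OF
      assms(2), of "(0::real,1::real)" 0]]
  by (simp add: inner_prod_def)

lemma dderiv_tensor:
  fixes p q :: "real \<Rightarrow> complex"
  assumes "(p has_vector_derivative p') (at (fst z))" "(q has_vector_derivative q') (at (snd z))"
  shows "dderiv (1, 0) (\<lambda>z. p (fst z) * q (snd z)) z = p' * q (snd z)"
    "dderiv (0, 1) (\<lambda>z. p (fst z) * q (snd z)) z = p (fst z) * q'"
proof -
  have "((\<lambda>z. p (fst z) * q (snd z)) has_derivative (\<lambda>e. p (fst z) * (snd e *\<^sub>R q') + (fst e *\<^sub>R p') * q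
      (snd z))) (at z)"
    using has_derivative_compose[OF has_derivative_fst[OF has_derivative_ident] assms(1)[unfolded
        has_vector_derivative_def], of UNIV]
      has_derivative_compose[OF has_derivative_snd[OF has_derivative_ident] assms(2)[unfolded
          has_vector_derivative_def], of UNIV]
    by (intro has_derivative_mult) auto
  note D = frechet_derivative_at[OF this]
  show "dderiv (1, 0) (\<lambda>z. p (fst z) * q (snd z)) z = p' * q (snd z)"
    "dderiv (0, 1) (\<lambda>z. p (fst z) * q (snd z)) z = p (fst z) * q'"
    by (simp_all add: dderiv_def flip: D)
qed

text \<open>The standard flat function exp (-1/t), multiplied by a polynomial in 1/t. With the
  polynomial as a parameter the family is closed under differentiation, which is what
  \<open>smooth_real_induct\<close> asks for.\<close>

definition flat :: "real poly \<Rightarrow> real \<Rightarrow> real"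
  where "flat p t = (if 0 < t then poly p (1 / t) * exp (- (1 / t)) else 0)"

lemma poly_exp_neg_tendsto: "((\<lambda>x::real. poly p x * exp (- x)) \<longlongrightarrow> 0) at_top"
proof -
  \<comment> \<open>The additional power of x is what lets the induction over the coefficients of
    the polynomial go through.\<close>
  have "((\<lambda>x. x ^ n * poly p x * exp (- x)) \<longlongrightarrow> 0) at_top" for n
  proof (induction p arbitrary: n)
    case (pCons a p)
    have "((\<lambda>x. a * (x ^ n / exp x) + x ^ Suc n * poly p x * exp (- x)) \<longlongrightarrow> a * 0 + 0) at_top"
      by (intro tendsto_intros tendsto_power_div_exp_0 pCons.IH)
    then show ?case
      by (simp add: algebra_simps exp_minus divide_inverse)
  qed simp
  from this[of 0] show ?thesis by simp
qed

lemma flat_tendsto: "((\<lambda>t. flat p t) \<longlongrightarrow> 0) (at_right 0)"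
proof -
  have "((\<lambda>t. poly p (1 / t) * exp (- (1 / t))) \<longlongrightarrow> 0) (at_right 0)"
    using filterlim_compose[OF poly_exp_neg_tendsto filterlim_inverse_at_top_right, of p]
    by (simp add: divide_inverse)
  then show ?thesis
    by (rule Lim_transform_eventually) (auto simp: flat_def eventually_at_right_less intro:
        eventually_at_rightI[of _ 1])
qed

lemma flat_has_derivative:
  "(flat p has_real_derivative flat ([:0, 0, 1:] * (p - pderiv p)) t) (at t)"
proof -
  consider "t < 0" | "t = 0" | "t > 0" by linarith
  then show ?thesis
  proof cases
    case 1
    have "((\<lambda>t. 0) has_real_derivative 0) (at t)" by simp
    then have "(flat p has_real_derivative 0) (at t)"
      by (rule has_field_derivative_transform_within_open[where S="{..<0}"]) (use 1 in \<open>auto simp: flat_def\<close>)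
    then show ?thesis using 1 by (simp add: flat_def)
  next
    case 2
    have "((\<lambda>h. (flat p (0 + h) - flat p 0) / h) \<longlongrightarrow> 0) (at 0)"
    proof (rule filterlim_split_at)
      show "((\<lambda>h. (flat p (0 + h) - flat p 0) / h) \<longlongrightarrow> 0) (at_left 0)"
        by (rule Lim_transform_eventually[OF tendsto_const])
           (auto simp: flat_def eventually_at_left_field intro!: exI[of _ "-1"])
      \<comment> \<open>Dividing by h multiplies by 1/h, that is, it shifts the polynomial; the
        difference quotient at 0 is again a flat function and tends to 0.\<close>
      have "flat (pCons 0 p) h = (flat p (0 + h) - flat p 0) / h" if "0 < h" for h
        using that by (simp add: flat_def)
      then show "((\<lambda>h. (flat p (0 + h) - flat p 0) / h) \<longlongrightarrow> 0) (at_right 0)"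
        by (intro Lim_transform_eventually[OF flat_tendsto[of "pCons 0 p"]] eventually_at_rightI[of _ 1]) auto
    qed
    then show ?thesis using 2 by (simp add: DERIV_def flat_def)
  next
    case 3
    have "((\<lambda>t. poly p (1 / t) * exp (- (1 / t))) has_real_derivative
       poly ([:0, 0, 1:] * (p - pderiv p)) (1 / t) * exp (- (1 / t))) (at t)"
      using 3 by (auto intro!: derivative_eq_intros DERIV_chain2[OF poly_DERIV] simp: field_simps power2_eq_square)
    then have "(flat p has_real_derivative poly ([:0, 0, 1:] * (p - pderiv p)) (1 / t) * exp (- (1 / t))) (at t)"
      by (rule has_field_derivative_transform_within_open[where S="{0<..}"]) (use 3 in \<open>auto simp: flat_def\<close>)
    then show ?thesis using 3 by (simp add: flat_def)
  qed
qed

lemma smooth_flat: "smooth (\<lambda>z. complex_of_real (flat p (c \<bullet> z + b)))"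
proof (rule smooth_real_induct[where I="\<lambda>h. \<exists>p. h = (\<lambda>t. complex_of_real (flat p t))"])
  fix h assume "\<exists>p. h = (\<lambda>t. complex_of_real (flat p t))"
  then obtain p where h: "h = (\<lambda>t. complex_of_real (flat p t))" by blast
  have "(h has_vector_derivative of_real (flat ([:0, 0, 1:] * (p - pderiv p)) t)) (at t)" for t
    unfolding h using flat_has_derivative[of p t, THEN has_real_derivative_iff_has_vector_derivative[THEN iffD1]]
    by (rule bounded_linear.has_vector_derivative[OF bounded_linear_of_real])
  then show "\<exists>h'. (\<exists>p. h' = (\<lambda>t. complex_of_real (flat p t))) \<and> (\<forall>t. (h has_vector_derivative h' t) (at t))"
    by blast
qed auto

text \<open>A smooth function with values in [0,1], supported at distance 1/(m+1) from the ends of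
  (a,b) and converging pointwise to the indicator of (a,b).\<close>

definition bump :: "real \<Rightarrow> real \<Rightarrow> nat \<Rightarrow> real \<Rightarrow> real"
  where "bump a b m t = flat 1 (real (Suc m) * (t - a) - 1) * flat 1 (real (Suc m) * (b - t) - 1)"

lemma flat_1_bounds: "0 \<le> flat 1 t" "flat 1 t \<le> 1"
  by (auto simp: flat_def)

lemma bump_bounds: "0 \<le> bump a b m t" "bump a b m t \<le> 1"
  by (auto simp: bump_def flat_1_bounds intro!: mult_le_one)

lemma bump_support:
  assumes "bump a b m t \<noteq> 0"
  shows "t \<in> {a + 1 / real (Suc m) .. b - 1 / real (Suc m)}"
proof -
  have "0 < real (Suc m) * (t - a) - 1" "0 < real (Suc m) * (b - t) - 1"
    using assms by (auto simp: bump_def flat_def split: if_splits)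
  then show ?thesis by (auto simp: field_simps)
qed

lemma smooth_bump: "smooth (\<lambda>t. complex_of_real (bump a b m t))"
proof -
  have "smooth (\<lambda>t::real. complex_of_real (flat 1 (real (Suc m) \<bullet> t + (- real (Suc m) * a - 1)))
     * complex_of_real (flat 1 ((- real (Suc m)) \<bullet> t + (real (Suc m) * b - 1))))"
    by (intro smooth_mult smooth_flat)
  then show ?thesis
    by (simp add: bump_def algebra_simps)
qed

lemma flat_1_tendsto:
  assumes "0 < c"
  shows "(\<lambda>m. flat 1 (real (Suc m) * c - 1)) \<longlonglongrightarrow> 1"
proof -
  have t: "filterlim (\<lambda>m. real (Suc m) * c - 1) at_top sequentially"
    using assms by real_asymp
  have "(\<lambda>m. exp (- (1 / (real (Suc m) * c - 1)))) \<longlonglongrightarrow> exp (- 0)"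
    using tendsto_inverse_0_at_top[OF t] by (intro tendsto_intros) (simp add: divide_inverse)
  moreover have "\<forall>\<^sub>F m in sequentially. exp (- (1 / (real (Suc m) * c - 1))) = flat 1 (real (Suc m) * c - 1)"
    using filterlim_at_top_dense[THEN iffD1, OF t, rule_format, of 0]
    by eventually_elim (simp add: flat_def)
  ultimately show ?thesis
    by (auto intro: Lim_transform_eventually)
qed

lemma bump_tendsto: "(\<lambda>m. bump a b m t) \<longlonglongrightarrow> indicator {a<..<b} t"
proof (cases "t \<in> {a<..<b}")
  case True
  then have "(\<lambda>m. bump a b m t) \<longlonglongrightarrow> 1 * 1"
    unfolding bump_def by (intro tendsto_mult flat_1_tendsto) auto
  then show ?thesis using True by simp
next
  case False
  have "bump a b m t = 0" for m
  proof (rule ccontr)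
    assume "bump a b m t \<noteq> 0"
    moreover have "0 < 1 / real (Suc m)" by simp
    ultimately have "a < t" "t < b"
      using bump_support[of a b m t] unfolding atLeastAtMost_iff by linarith+
    then show False using False by auto
  qed
  then show ?thesis using False by simp
qed

lemma tensor_test_function:
  fixes p q :: "real \<Rightarrow> complex"
  assumes "smooth p" "smooth q" "\<And>x. p x \<noteq> 0 \<Longrightarrow> x \<in> {a..b}" "\<And>y. q y \<noteq> 0 \<Longrightarrow> y \<in> {c..d}"
    and "{a..b} \<times> {c..d} \<subseteq> S"
  shows "(\<lambda>z. p (fst z) * q (snd z)) \<in> test_functions S"
proof -
  let ?f = "\<lambda>z. p (fst z) * q (snd z)"
  have "{x. ?f x \<noteq> 0} \<subseteq> {a..b} \<times> {c..d}"
    using assms(3,4) by force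
  moreover have K: "compact ({a..b} \<times> {c..d})"
    by (intro compact_Times) auto
  ultimately have "closure {x. ?f x \<noteq> 0} \<subseteq> {a..b} \<times> {c..d}"
    by (intro closure_minimal compact_imp_closed)
  moreover from this have "compact (closure {x. ?f x \<noteq> 0})"
    using K by (meson bounded_subset closure_subset compact_closure compact_imp_bounded)
  ultimately show ?thesis
    using assms(5) smooth_tensor[OF assms(1,2)] by (auto simp: test_functions_def)
qed

text \<open>Boxes are closed under intersection and generate the Borel sets, so vanishing integrals
  extend to all Borel sets by a Dynkin argument. The integral over the whole space handles
  complements.\<close>

lemma AE_eq_0_of_box_integrals:
  fixes F :: "'a::euclidean_space \<Rightarrow> complex"
  assumes F: "integrable lborel F" and box: "\<And>a b. (LINT x:box a b|lborel. F x) = 0"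
    and total: "(LINT x|lborel. F x) = 0"
  shows "AE x in lborel. F x = 0"
proof (rule sigma_finite_measure.density_zero[OF _ F])
  show "sigma_finite_measure (lborel :: 'a measure)"
    by (rule sigma_finite_lborel)
  have Fs: "set_integrable lborel E F" if "E \<in> sets borel" for E
    using integrable_mult_indicator[OF _ F, of E] that by (simp add: set_integrable_def)
  fix E :: "'a set" assume "E \<in> sets lborel"
  then have E: "E \<in> sigma_sets UNIV (range (\<lambda>(a, b). box a b))"
    by (simp add: borel_eq_box)
  have stable: "Int_stable (range (\<lambda>(a, b). box a (b::'a)))"
    by (auto simp: Int_stable_def Int_interval box_Int_box image_iff intro: exI)
  have "range (\<lambda>(a, b). box a (b::'a)) \<subseteq> Pow UNIV" by simp
  from stable this E show "(LINT x:E|lborel. F x) = 0"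
  proof (induction rule: sigma_sets_induct_disjoint[where \<Omega>=UNIV])
    case (compl E)
    then have "E \<in> sets borel" by (simp add: borel_eq_box)
    then have "(LINT x:UNIV|lborel. F x) = (LINT x:E|lborel. F x) + (LINT x:UNIV - E|lborel. F x)"
      using Fs by (subst set_integral_Un[symmetric]) auto
    then show ?case
      using compl total by (simp add: set_lebesgue_integral_def)
  next
    case (union E)
    then have b: "E i \<in> sets borel" for i by (auto simp: borel_eq_box)
    have "(LINT x:(\<Union>i. E i)|lborel. F x) = (\<Sum>i. (LINT x:(E i)|lborel. F x))"
      using union(1) b by (intro lebesgue_integral_countable_add Fs) (auto simp: disjoint_family_on_def)
    then show ?case using union by simp
  next
    case (basic E)
    then show ?case using box by auto
  qed (simp add: set_lebesgue_integral_def)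
qed

text \<open>The fundamental lemma of the calculus of variations with bumps as test functions: they
  converge boundedly to indicators of open intervals.\<close>

lemma AE_eq_0_interval:
  fixes F :: "real \<Rightarrow> complex"
  assumes F: "integrable lborel F" and zero: "\<And>x. x \<notin> {a<..<b} \<Longrightarrow> F x = 0"
    and bump: "\<And>\<alpha> \<beta> m. a \<le> \<alpha> \<Longrightarrow> \<beta> \<le> b \<Longrightarrow> (LINT x|lborel. F x * of_real (bump \<alpha> \<beta> m x)) = 0"
  shows "AE x in lborel. F x = 0"
proof (rule AE_eq_0_of_box_integrals[OF F])
  have *: "(LINT x:{\<alpha><..<\<beta>}|lborel. F x) = 0" if "a \<le> \<alpha>" "\<beta> \<le> b" for \<alpha> \<beta>
  proof -
    have [measurable]: "(\<lambda>x. complex_of_real (bump \<alpha> \<beta> m x)) \<in> borel_measurable borel" for m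
      by (intro borel_measurable_continuous_onI smooth_continuous smooth_bump)
    have [measurable]: "F \<in> borel_measurable borel" using F by auto
    have "(\<lambda>m. LINT x|lborel. F x * of_real (bump \<alpha> \<beta> m x)) \<longlonglongrightarrow> (LINT x|lborel. F x * of_real (indicator {\<alpha><..<\<beta>} x))"
    proof (rule integral_dominated_convergence)
      show "integrable lborel (\<lambda>x. norm (F x))" using F by simp
      show "AE x in lborel. norm (F x * of_real (bump \<alpha> \<beta> m x)) \<le> norm (F x)" for m
        using bump_bounds[of \<alpha> \<beta> m] by (intro AE_I2) (simp add: norm_mult mult_left_le)
      show "AE x in lborel. (\<lambda>m. F x * of_real (bump \<alpha> \<beta> m x)) \<longlonglongrightarrow> F x * of_real (indicator {\<alpha><..<\<beta>} x)"
        by (intro AE_I2 tendsto_intros bump_tendsto)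
    qed measurable
    then have "(LINT x|lborel. F x * of_real (indicator {\<alpha><..<\<beta>} x)) = 0"
      using bump[OF that] by (simp add: LIMSEQ_const_iff)
    then show ?thesis
      by (simp add: set_lebesgue_integral_def scaleR_conv_of_real mult.commute)
  qed
  show "(LINT x:box \<alpha> \<beta>|lborel. F x) = 0" for \<alpha> \<beta>
  proof -
    \<comment> \<open>An arbitrary interval may be cut down to (a,b), off which \<open>F\<close>
      vanishes.\<close>
    have "(LINT x:box \<alpha> \<beta>|lborel. F x) = (LINT x:{max a \<alpha><..<min b \<beta>}|lborel. F x)"
      unfolding set_lebesgue_integral_def
      by (intro Bochner_Integration.integral_cong) (use zero in \<open>auto simp: indicator_def box_real\<close>)
    then show ?thesis using * by simp
  qed
  have "(LINT x|lborel. F x) = (LINT x:{a<..<b}|lborel. F x)"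
    unfolding set_lebesgue_integral_def
    by (intro Bochner_Integration.integral_cong) (use zero in \<open>auto simp: indicator_def\<close>)
  then show "(LINT x|lborel. F x) = 0" using * by simp
qed

text \<open>The planar version; products of two bumps are test functions on the rectangle and
  converge to indicators of smaller rectangles.\<close>

lemma AE_eq_0_rectangle:
  fixes F :: "real \<times> real \<Rightarrow> complex"
  assumes F: "integrable lborel F" and zero: "\<And>z. z \<notin> {a<..<b} \<times> {c<..<d} \<Longrightarrow> F z = 0"
    and test: "\<And>\<phi>. \<phi> \<in> test_functions ({a<..<b} \<times> {c<..<d}) \<Longrightarrow> (LINT z|lborel. F z * \<phi> z) = 0"
  shows "AE z in lborel. F z = 0"
proof (rule AE_eq_0_of_box_integrals[OF F])
  have *: "(LINT z:{\<alpha><..<\<beta>} \<times> {\<gamma><..<\<delta>}|lborel. F z) = 0" if "a \<le> \<alpha>" "\<beta> \<le> b" "c \<le> \<gamma>" "\<delta> \<le> d" for \<alpha> \<beta> \<gamma> \<delta>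
  proof -
    let ?B = "\<lambda>m z. complex_of_real (bump \<alpha> \<beta> m (fst z)) * complex_of_real (bump \<gamma> \<delta> m (snd z))"
    have sm: "smooth (?B m)" for m
      by (intro smooth_tensor smooth_bump)
    have mB: "?B m \<in> borel_measurable lborel" for m
      unfolding measurable_lborel2 by (intro borel_measurable_continuous_onI smooth_continuous sm)
    have mF: "F \<in> borel_measurable lborel" using F by auto
    have [measurable]: "(fst :: real \<times> real \<Rightarrow> real) \<in> borel_measurable lborel" "(snd :: real \<times> real \<Rightarrow> real) \<in>
        borel_measurable lborel"
      unfolding measurable_lborel2 by (intro borel_measurable_continuous_onI continuous_intros)+
    have "?B m \<in> test_functions ({a<..<b} \<times> {c<..<d})" for m
    proof (rule tensor_test_function[OF smooth_bump smooth_bump])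
      define r where "r = 1 / real (Suc m)"
      have "0 < r" by (simp add: r_def)
      then show "{\<alpha> + 1 / real (Suc m)..\<beta> - 1 / real (Suc m)} \<times> {\<gamma> + 1 / real (Suc m)..\<delta> - 1 / real (Suc m)} \<subseteq>
          {a<..<b} \<times> {c<..<d}"

        unfolding r_def[symmetric] using that by auto
    qed (use bump_support in auto)
    then have z: "(LINT z|lborel. F z * ?B m z) = 0" for m
      using test by blast
    have "(\<lambda>m. LINT z|lborel. F z * ?B m z) \<longlonglongrightarrow> (LINT z|lborel. F z * (of_real (indicator {\<alpha><..<\<beta>} (fst z)) *
        of_real (indicator {\<gamma><..<\<delta>} (snd z))))"
    proof (rule integral_dominated_convergence)
      show "integrable lborel (\<lambda>z. norm (F z))" using F by simp
      show "AE z in lborel. norm (F z * ?B m z) \<le> norm (F z)" for m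
        using bump_bounds by (intro AE_I2) (simp add: norm_mult mult_left_le mult_le_one)
      show "AE z in lborel. (\<lambda>m. F z * ?B m z) \<longlonglongrightarrow> F z * (of_real (indicator {\<alpha><..<\<beta>} (fst z)) * of_real
          (indicator {\<gamma><..<\<delta>} (snd z)))"
        by (intro AE_I2 tendsto_intros bump_tendsto)
      show "(\<lambda>z. F z * ?B m z) \<in> borel_measurable lborel" for m
        by (intro borel_measurable_times mF mB)
      show "(\<lambda>z. F z * (of_real (indicator {\<alpha><..<\<beta>} (fst z)) * of_real (indicator {\<gamma><..<\<delta>} (snd z)))) \<in>
          borel_measurable lborel"
        using mF by measurable
    qed
    then have "(LINT z|lborel. F z * (of_real (indicator {\<alpha><..<\<beta>} (fst z)) * of_real (indicator {\<gamma><..<\<delta>}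
        (snd z)))) = 0"
      unfolding z by (simp add: LIMSEQ_const_iff)
    moreover have "F z * (of_real (indicator {\<alpha><..<\<beta>} (fst z)) * of_real (indicator {\<gamma><..<\<delta>} (snd z))) =
        indicator ({\<alpha><..<\<beta>} \<times> {\<gamma><..<\<delta>}) z *\<^sub>R F z" for z
      by (cases z) (auto simp: indicator_def)
    ultimately show ?thesis
      by (simp add: set_lebesgue_integral_def)
  qed
  show "(LINT z:box \<alpha> \<beta>|lborel. F z) = 0" for \<alpha> \<beta>
  proof -
    have "box \<alpha> \<beta> = {fst \<alpha><..<fst \<beta>} \<times> {snd \<alpha><..<snd \<beta>}"
      by (auto simp: box_def Basis_prod_def inner_prod_def)
    then have "(LINT z:box \<alpha> \<beta>|lborel. F z) = (LINT z:{max a (fst \<alpha>)<..<min b (fst \<beta>)} \<times> {max c (snd \<alpha>)<..<min d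
        (snd \<beta>)}|lborel. F z)"
      unfolding set_lebesgue_integral_def
    proof (intro Bochner_Integration.integral_cong refl)
      fix z :: "real \<times> real"
      assume "box \<alpha> \<beta> = {fst \<alpha><..<fst \<beta>} \<times> {snd \<alpha><..<snd \<beta>}"
      then show "indicator (box \<alpha> \<beta>) z *\<^sub>R F z = indicator ({max a (fst \<alpha>)<..<min b (fst \<beta>)} \<times>
          {max c (snd \<alpha>)<..<min d (snd \<beta>)}) z *\<^sub>R F z"
        by (cases "z \<in> {a<..<b} \<times> {c<..<d}") (auto simp: indicator_def zero)
    qed
    then show ?thesis using * by simp
  qed
  have "(LINT x|lborel. F x) = (LINT x:{a<..<b} \<times> {c<..<d}|lborel. F x)"
    unfolding set_lebesgue_integral_def
    by (intro Bochner_Integration.integral_cong) (use zero in \<open>auto simp: indicator_def\<close>)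
  then show "(LINT x|lborel. F x) = 0" using * by simp
qed

section \<open>Weak derivatives and traces on a unit square\<close>

lemma L2_measurable: "f \<in> L2 S \<Longrightarrow> f \<in> borel_measurable (lborel_on S)"
  by (simp add: L2_def)

lemma L2_cmult:
  assumes "f \<in> L2 S" shows "(\<lambda>x. c * f x) \<in> L2 S"
  using assms by (auto simp: L2_def norm_mult power_mult_distrib)

lemma L2_add:
  assumes f: "f \<in> L2 S" and g: "g \<in> L2 S"
  shows "(\<lambda>x. f x + g x) \<in> L2 S"
proof -
  have [measurable]: "f \<in> borel_measurable (lborel_on S)" "g \<in> borel_measurable (lborel_on S)"
    using f g by (auto simp: L2_def)
  have "integrable (lborel_on S) (\<lambda>x. (cmod (f x + g x))\<^sup>2)"
  proof (rule Bochner_Integration.integrable_bound)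
    show "integrable (lborel_on S) (\<lambda>x. 2 * (cmod (f x))\<^sup>2 + 2 * (cmod (g x))\<^sup>2)"
      using f g by (auto simp: L2_def)
    show "AE x in lborel_on S. norm ((cmod (f x + g x))\<^sup>2) \<le> norm (2 * (cmod (f x))\<^sup>2 + 2 * (cmod (g x))\<^sup>2)"
      using square_triangle[of "f _" "- g _" 0] by (intro AE_I2) simp
  qed measurable
  then show ?thesis by (simp add: L2_def)
qed

lemma L2_diff: "f \<in> L2 S \<Longrightarrow> g \<in> L2 S \<Longrightarrow> (\<lambda>x. f x - g x) \<in> L2 S"
  using L2_add[of f S "\<lambda>x. -1 * g x"] L2_cmult[of g S "-1"] by simp

lemma L2_norm_square: "(L2_norm S f)\<^sup>2 = (LINT x|lborel_on S. (cmod (f x))\<^sup>2)"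
  by (simp add: L2_norm_def)

text \<open>On a set of total mass one the L2 norm dominates the L1 norm without a constant. Both
  unit squares and the parameter interval of the traces are of this kind.\<close>

definition unit_measure :: "'a::euclidean_space set \<Rightarrow> bool"
  where "unit_measure S \<longleftrightarrow> S \<in> sets borel \<and> emeasure lborel S = 1"

lemma unit_measure_const:
  fixes c :: "'b::{banach, second_countable_topology}"
  assumes "unit_measure S"
  shows "integrable (lborel_on S) (\<lambda>x. c)" "(LINT x|lborel_on S. c) = c"
  using assms by (auto simp: unit_measure_def integrable_restrict_space integral_restrict_space
      emeasure_restrict_space measure_def intro!: integrable_scaleR_left integrable_real_indicator)

lemma L2_integrable_norm:
  assumes S: "unit_measure S" and f: "f \<in> L2 S"
  shows "integrable (lborel_on S) (\<lambda>x. cmod (f x))" "(LINT x|lborel_on S. cmod (f x)) \<le> L2_norm S f"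
proof -
  have [measurable]: "f \<in> borel_measurable (lborel_on S)" using f by (simp add: L2_def)
  have f2: "integrable (lborel_on S) (\<lambda>x. (cmod (f x))\<^sup>2)" using f by (simp add: L2_def)
  show i: "integrable (lborel_on S) (\<lambda>x. cmod (f x))"
  proof (rule Bochner_Integration.integrable_bound)
    show "integrable (lborel_on S) (\<lambda>x. 1 + (cmod (f x))\<^sup>2)"
      by (intro Bochner_Integration.integrable_add f2 unit_measure_const(1)[OF S])
    show "AE x in lborel_on S. norm (cmod (f x)) \<le> norm (1 + (cmod (f x))\<^sup>2)"
    proof (rule AE_I2)
      fix x
      have "0 \<le> (cmod (f x) - 1)\<^sup>2" by simp
      then have "2 * cmod (f x) \<le> (cmod (f x))\<^sup>2 + 1" by (simp add: power2_diff)
      then have "cmod (f x) \<le> 1 + (cmod (f x))\<^sup>2" using norm_ge_zero[of "f x"] by linarith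
      then show "norm (cmod (f x)) \<le> norm (1 + (cmod (f x))\<^sup>2)" by simp
    qed
  qed measurable
  \<comment> \<open>\<open>c\<close> is the mean of |f|, and the claim is that the variance of |f|
    is nonnegative.\<close>
  define c where "c = (LINT x|lborel_on S. cmod (f x))"
  have "0 \<le> (LINT x|lborel_on S. (cmod (f x) - c)\<^sup>2)" by simp
  also have "\<dots> = (LINT x|lborel_on S. (cmod (f x))\<^sup>2 - 2 * c * cmod (f x) + c\<^sup>2)"
    by (intro Bochner_Integration.integral_cong) (auto simp: power2_eq_square algebra_simps)
  also have "\<dots> = (LINT x|lborel_on S. (cmod (f x))\<^sup>2) - 2 * c * c + c\<^sup>2"
    using f2 i unit_measure_const[OF S, of "c\<^sup>2"] by (simp add: c_def)
  finally have "c\<^sup>2 \<le> (LINT x|lborel_on S. (cmod (f x))\<^sup>2)"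
    by (simp add: power2_eq_square)
  then show "(LINT x|lborel_on S. cmod (f x)) \<le> L2_norm S f"
    unfolding L2_norm_def c_def by (rule real_le_rsqrt)
qed

lemma L2_integrable:
  assumes "unit_measure S" "f \<in> L2 S"
  shows "integrable (lborel_on S) f"
  using L2_integrable_norm(1)[OF assms] L2_measurable[OF assms(2)] integrable_norm_iff by blast

lemma L2_mult_bounded:
  assumes S: "unit_measure S" and f: "f \<in> L2 S" and g: "g \<in> borel_measurable (lborel_on S)" "\<forall>x\<in>S. cmod (g x) \<le> B"
  shows "integrable (lborel_on S) (\<lambda>x. f x * g x)" "cmod (LINT x|lborel_on S. f x * g x) \<le> B * L2_norm S f"
proof -
  have [measurable]: "f \<in> borel_measurable (lborel_on S)" "g \<in> borel_measurable (lborel_on S)" using f g by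
      (auto simp: L2_def)
  have "S \<noteq> {}" using S by (auto simp: unit_measure_def)
  then obtain x where "x \<in> S" by blast
  then have B: "0 \<le> B" using g(2) order_trans[OF norm_ge_zero, of "g x" B] by blast
  have iB: "integrable (lborel_on S) (\<lambda>x. B * cmod (f x))"
    using L2_integrable_norm[OF S f] by auto
  have le: "norm (f x * g x) \<le> B * cmod (f x)" if "x \<in> S" for x
    using g(2)[rule_format, OF that] by (simp add: norm_mult mult.commute[of B] mult_left_mono)
  show i: "integrable (lborel_on S) (\<lambda>x. f x * g x)"
  proof (rule Bochner_Integration.integrable_bound[OF iB])
    show "AE x in lborel_on S. norm (f x * g x) \<le> norm (B * cmod (f x))"
      using le B by (intro AE_I2) (auto simp: space_restrict_space abs_mult)
  qed measurable
  have "cmod (LINT x|lborel_on S. f x * g x) \<le> (LINT x|lborel_on S. norm (f x * g x))"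
    by (rule integral_norm_bound)
  also have "\<dots> \<le> (LINT x|lborel_on S. B * cmod (f x))"
    using le i iB by (intro integral_mono) (auto simp: space_restrict_space)
  also have "\<dots> \<le> B * L2_norm S f"
    using L2_integrable_norm[OF S f] B by (simp add: mult_left_mono)
  finally show "cmod (LINT x|lborel_on S. f x * g x) \<le> B * L2_norm S f" .
qed

lemma continuous_measurable_on:
  assumes "continuous_on UNIV f"
  shows "f \<in> borel_measurable (lborel_on S)"
proof -
  have "f \<in> borel_measurable lborel"
    using borel_measurable_continuous_onI[OF assms] by simp
  then show ?thesis by (rule measurable_restrict_space1)
qed

lemma continuous_bounded_on:
  fixes f :: "'a::euclidean_space \<Rightarrow> complex"
  assumes "continuous_on UNIV f" "bounded S"
  obtains B where "\<forall>x\<in>S. cmod (f x) \<le> B"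
proof -
  have "compact (f ` closure S)"
    using assms by (intro compact_continuous_image) (auto intro: continuous_on_subset)
  then obtain B where "\<And>x. x \<in> closure S \<Longrightarrow> cmod (f x) \<le> B"
    using compact_imp_bounded by (force simp: bounded_iff)
  then show ?thesis using that closure_subset[of S] by blast
qed

lemma continuous_L2:
  assumes S: "unit_measure S" "bounded S" and f: "continuous_on UNIV f"
  shows "f \<in> L2 S"
proof -
  obtain B where B: "\<forall>x\<in>S. cmod (f x) \<le> B"
    using continuous_bounded_on[OF f S(2)] by blast
  have fm[measurable]: "f \<in> borel_measurable (lborel_on S)" by (rule continuous_measurable_on[OF f])
  have "integrable (lborel_on S) (\<lambda>x. (cmod (f x))\<^sup>2)"
  proof (rule Bochner_Integration.integrable_bound[OF unit_measure_const(1)[OF S(1)]])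
    show "AE x in lborel_on S. norm ((cmod (f x))\<^sup>2) \<le> norm (B\<^sup>2)"
      using B by (intro AE_I2) (auto simp: space_restrict_space intro!: power_mono)
  qed measurable
  then show ?thesis by (simp add: L2_def)
qed

text \<open>Both halves of the domain are translates of one square: \<open>strip (-1)\<close>
  carries the wave equation and \<open>strip 0\<close> the heat equation, so each fact is proved
  once.\<close>

definition strip :: "real \<Rightarrow> (real \<times> real) set"
  where "strip a = {a<..<a + 1} \<times> {0<..<1}"

lemma strip_measure: "unit_measure (strip a)" and strip_bounded: "bounded (strip a)" and strip_open: "open (strip a)"
proof -
  have "emeasure lborel (strip a) = emeasure lborel {a<..<a + 1} * emeasure lborel {0<..<1::real}"
    unfolding strip_def by (subst lborel_prod[symmetric], subst lborel.emeasure_pair_measure_Times) auto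
  then show "unit_measure (strip a)"
    by (auto simp: unit_measure_def strip_def intro!: borel_open open_Times)
  show "bounded (strip a)" "open (strip a)"
    by (auto simp: strip_def intro!: bounded_Times open_Times)
qed

lemma Icc_measure: "unit_measure {0..1::real}"
  by (simp add: unit_measure_def)

lemma strip_AE_unique:
  assumes f: "f \<in> L2 (strip a)" and g: "g \<in> L2 (strip a)"
    and test: "\<And>\<phi>. \<phi> \<in> test_functions (strip a) \<Longrightarrow> (LINT x|lborel_on (strip a). f x * \<phi> x) = (LINT x|lborel_on
        (strip a). g x * \<phi> x)"
  shows "AE x in lborel_on (strip a). f x = g x"
proof -
  let ?d = "\<lambda>x. f x - g x"
  have S: "strip a \<in> sets borel" using strip_open by auto
  have "AE x in lborel. indicator (strip a) x *\<^sub>R ?d x = 0"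
  proof (rule AE_eq_0_rectangle[where a=a and b="a+1" and c=0 and d=1])
    show "integrable lborel (\<lambda>x. indicator (strip a) x *\<^sub>R ?d x)"
      using L2_integrable[OF strip_measure L2_diff[OF f g]] S by (simp add: integrable_restrict_space)
    show "indicator (strip a) z *\<^sub>R ?d z = 0" if "z \<notin> {a<..<a+1} \<times> {0<..<1}" for z
      using that by (simp add: strip_def)
    fix \<phi> :: "real \<times> real \<Rightarrow> complex" assume "\<phi> \<in> test_functions ({a<..<a+1} \<times> {0<..<1})"
    then have \<phi>: "\<phi> \<in> test_functions (strip a)" by (simp add: strip_def)
    then have c: "continuous_on UNIV \<phi>" by (auto simp: test_functions_def intro: smooth_continuous)
    obtain B where B: "\<forall>x\<in>strip a. cmod (\<phi> x) \<le> B"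
      using continuous_bounded_on[OF c strip_bounded] by blast
    have i: "integrable (lborel_on (strip a)) (\<lambda>x. f x * \<phi> x)" "integrable (lborel_on (strip a)) (\<lambda>x. g x * \<phi> x)"
      using L2_mult_bounded(1)[OF strip_measure _ continuous_measurable_on[OF c] B] f g by blast+
    have "(LINT z|lborel. indicator (strip a) z *\<^sub>R ?d z * \<phi> z) = (LINT x|lborel_on (strip a). ?d x * \<phi> x)"
      using S by (simp add: integral_restrict_space)
    also have "\<dots> = 0"
      using test[OF \<phi>] i by (simp add: left_diff_distrib)
    finally show "(LINT z|lborel. indicator (strip a) z *\<^sub>R ?d z * \<phi> z) = 0" .
  qed
  then show ?thesis
    using S by (simp add: AE_restrict_space_iff) (auto elim!: eventually_mono simp: indicator_def)
qed

lemma integral_strip_cong_AE: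
  assumes "AE x in M. f x = g x" "f \<in> borel_measurable M" "g \<in> borel_measurable M" "h \<in> borel_measurable M"
  shows "(LINT x|M. f x * h x) = (LINT x|M. g x * (h x :: complex))"
  using assms by (intro integral_cong_AE borel_measurable_times) auto

lemma test_function_continuous: "\<phi> \<in> test_functions S \<Longrightarrow> continuous_on UNIV \<phi>"
  by (auto simp: test_functions_def intro: smooth_continuous)

lemma test_function_dderiv_continuous: "\<phi> \<in> test_functions S \<Longrightarrow> e \<in> Basis \<Longrightarrow> continuous_on UNIV (dderiv e \<phi>)"
  by (auto simp: test_functions_def intro: smooth_continuous smooth_dderiv)

text \<open>\<open>weak_deriv\<close> is an arbitrary choice. This lemma compares it with any
  derivative known explicitly, also for another representative of the same function.\<close>

lemma has_weak_deriv_unique: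
  assumes "has_weak_deriv (strip a) e u g" "has_weak_deriv (strip a) e u' g'" "e \<in> Basis"
    and u: "u \<in> L2 (strip a)" "u' \<in> L2 (strip a)" "AE x in lborel_on (strip a). u x = u' x"
  shows "AE x in lborel_on (strip a). g x = g' x"
proof (rule strip_AE_unique)
  show "g \<in> L2 (strip a)" "g' \<in> L2 (strip a)"
    using assms by (auto simp: has_weak_deriv_def)
  fix \<phi> assume \<phi>: "\<phi> \<in> test_functions (strip a)"
  have "(LINT x|lborel_on (strip a). u x * dderiv e \<phi> x) = (LINT x|lborel_on (strip a). u' x * dderiv e \<phi> x)"
    by (intro integral_strip_cong_AE u L2_measurable continuous_measurable_on test_function_dderiv_continuous[OF
        \<phi>] assms)
  then show "(LINT x|lborel_on (strip a). g x * \<phi> x) = (LINT x|lborel_on (strip a). g' x * \<phi> x)"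
    using assms(1,2) \<phi> by (auto simp: has_weak_deriv_def)
qed

lemma has_weak_deriv_lincomb:
  assumes g: "has_weak_deriv (strip a) e u g" "has_weak_deriv (strip a) e u' g'" and e: "e \<in> Basis"
    and u: "u \<in> L2 (strip a)" "u' \<in> L2 (strip a)"
  shows "has_weak_deriv (strip a) e (\<lambda>x. c * u x - u' x) (\<lambda>x. c * g x - g' x)"
  unfolding has_weak_deriv_def
proof (intro conjI ballI)
  have gL: "g \<in> L2 (strip a)" "g' \<in> L2 (strip a)" using g by (auto simp: has_weak_deriv_def)
  then show "(\<lambda>x. c * g x - g' x) \<in> L2 (strip a)"
    by (intro L2_diff L2_cmult)
  fix \<phi> assume \<phi>: "\<phi> \<in> test_functions (strip a)"
  note c1 = test_function_continuous[OF \<phi>] and c2 = test_function_dderiv_continuous[OF \<phi> e]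
  obtain B1 where B1: "\<forall>x\<in>strip a. cmod (\<phi> x) \<le> B1"
    using continuous_bounded_on[OF c1 strip_bounded] by blast
  obtain B2 where B2: "\<forall>x\<in>strip a. cmod (dderiv e \<phi> x) \<le> B2"
    using continuous_bounded_on[OF c2 strip_bounded] by blast
  note i1 = L2_mult_bounded(1)[OF strip_measure _ continuous_measurable_on[OF c1] B1]
  note i2 = L2_mult_bounded(1)[OF strip_measure _ continuous_measurable_on[OF c2] B2]
  have "(LINT x|lborel_on (strip a). (c * u x - u' x) * dderiv e \<phi> x) =
     c * (LINT x|lborel_on (strip a). u x * dderiv e \<phi> x) - (LINT x|lborel_on (strip a). u' x * dderiv e \<phi> x)"
    using i2[OF u(1)] i2[OF u(2)] by (simp add: left_diff_distrib mult.assoc)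
  also have "\<dots> = - (c * (LINT x|lborel_on (strip a). g x * \<phi> x) - (LINT x|lborel_on (strip a). g' x * \<phi> x))"
    using g \<phi> by (simp add: has_weak_deriv_def)
  also have "c * (LINT x|lborel_on (strip a). g x * \<phi> x) - (LINT x|lborel_on (strip a). g' x * \<phi> x) =
      (LINT x|lborel_on (strip a). (c * g x - g' x) * \<phi> x)"
    using i1[OF gL(1)] i1[OF gL(2)] by (simp add: left_diff_distrib mult.assoc)
  finally show "(LINT x|lborel_on (strip a). (c * u x - u' x) * dderiv e \<phi> x) = - (LINT x|lborel_on (strip a).
      (c * g x - g' x) * \<phi> x)" .
qed

lemma has_weak_deriv_weak_deriv: "has_weak_deriv S e u g \<Longrightarrow> has_weak_deriv S e u (weak_deriv S e u)"
  unfolding weak_deriv_def by (rule someI[where P="has_weak_deriv S e u"])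

lemma H1_weak_deriv: "u \<in> H1 S \<Longrightarrow> e \<in> Basis \<Longrightarrow> has_weak_deriv S e u (weak_deriv S e u)"
  by (auto simp: H1_def intro: has_weak_deriv_weak_deriv)

lemma integral_strip_Fubini:
  fixes h :: "real \<times> real \<Rightarrow> complex"
  assumes "integrable (lborel_on (strip a)) h"
  shows "(LINT z|lborel_on (strip a). h z) = (LINT x:{a<..<a+1}|lborel. (LINT y:{0<..<1}|lborel. h (x, y)))"
    "(LINT z|lborel_on (strip a). h z) = (LINT y:{0<..<1}|lborel. (LINT x:{a<..<a+1}|lborel. h (x, y)))"
proof -
  have S: "strip a \<in> sets borel" using strip_open by auto
  have i: "integrable (lborel \<Otimes>\<^sub>M lborel) (\<lambda>z. indicator (strip a) z *\<^sub>R h z)"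
    using assms S by (simp add: integrable_restrict_space lborel_prod)
  have e: "indicator (strip a) (x, y) *\<^sub>R h (x, y) = indicator {a<..<a+1} x *\<^sub>R (indicator {0<..<1} y *\<^sub>R h
      (x, y))" for x y
    by (auto simp: strip_def indicator_def)
  have e': "indicator (strip a) (x, y) *\<^sub>R h (x, y) = indicator {0<..<1} y *\<^sub>R (indicator {a<..<a+1} x *\<^sub>R h
      (x, y))" for x y
    by (auto simp: strip_def indicator_def)
  have "(LINT z|lborel_on (strip a). h z) = (LINT z|(lborel \<Otimes>\<^sub>M lborel). indicator (strip a) z *\<^sub>R h z)"
    using S by (simp add: integral_restrict_space lborel_prod)
  also have "\<dots> = (LINT x|lborel. (LINT y|lborel. indicator (strip a) (x, y) *\<^sub>R h (x, y)))"
    by (rule lborel_pair.integral_fst'[OF i, symmetric])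
  finally show "(LINT z|lborel_on (strip a). h z) = (LINT x:{a<..<a+1}|lborel. (LINT y:{0<..<1}|lborel. h (x, y)))"
    unfolding e set_lebesgue_integral_def by (simp del: scaleR_scaleR)
  have "(LINT z|lborel_on (strip a). h z) = (LINT z|(lborel \<Otimes>\<^sub>M lborel). indicator (strip a) z *\<^sub>R h z)"
    using S by (simp add: integral_restrict_space lborel_prod)
  also have "\<dots> = (LINT y|lborel. (LINT x|lborel. indicator (strip a) (x, y) *\<^sub>R h (x, y)))"
    using lborel_pair.integral_snd[of "\<lambda>x y. indicator (strip a) (x, y) *\<^sub>R h (x, y)"] i by
        (simp add: case_prod_beta')
  finally show "(LINT z|lborel_on (strip a). h z) = (LINT y:{0<..<1}|lborel. (LINT x:{a<..<a+1}|lborel. h (x, y)))"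
    unfolding e' set_lebesgue_integral_def by (simp del: scaleR_scaleR)
qed

lemma set_integral_open_closed:
  fixes f :: "real \<Rightarrow> complex"
  assumes "f \<in> borel_measurable borel"
  shows "(LINT x:{a<..<b}|lborel. f x) = (LINT x:{a..b}|lborel. f x)"
  unfolding set_lebesgue_integral_def
proof (rule integral_cong_AE)
  show "AE x in lborel. indicator {a<..<b} x *\<^sub>R f x = indicator {a..b} x *\<^sub>R f x"
    using AE_lborel_singleton[of a] AE_lborel_singleton[of b]
    by eventually_elim (auto simp: indicator_def)
qed (use assms in measurable)

lemma set_integral_FTC_open:
  fixes F f :: "real \<Rightarrow> complex"
  assumes "a \<le> b" "\<And>x. x \<in> {a..b} \<Longrightarrow> (F has_vector_derivative f x) (at x within {a..b})" "continuous_on UNIV f"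
  shows "(LINT x:{a<..<b}|lborel. f x) = F b - F a"
proof -
  have "(LINT x:{a<..<b}|lborel. f x) = (LINT x:{a..b}|lborel. f x)"
    by (rule set_integral_open_closed[OF borel_measurable_continuous_onI[OF assms(3)]])
  also have "\<dots> = F b - F a"
    unfolding set_lebesgue_integral_def
    using integral_FTC_Icc[OF assms(1,2) continuous_on_subset[OF assms(3)]] by simp
  finally show ?thesis .
qed

lemma Green_x:
  fixes H h :: "real \<times> real \<Rightarrow> complex"
  assumes H: "\<And>x y. x \<in> {a..a+1} \<Longrightarrow> ((\<lambda>x. H (x, y)) has_vector_derivative h (x, y)) (at x within {a..a+1})"
    and h: "continuous_on UNIV h"
  shows "(LINT z|lborel_on (strip a). h z) = (LINT y:{0<..<1}|lborel. H (a + 1, y) - H (a, y))"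
proof -
  have "(LINT z|lborel_on (strip a). h z) = (LINT y:{0<..<1}|lborel. (LINT x:{a<..<a+1}|lborel. h (x, y)))"
    by (rule integral_strip_Fubini(2)[OF L2_integrable[OF strip_measure continuous_L2[OF strip_measure
        strip_bounded h]]])
  moreover have "(LINT x:{a<..<a+1}|lborel. h (x, y)) = H (a + 1, y) - H (a, y)" for y
    by (rule set_integral_FTC_open) (auto intro!: H continuous_on_compose2[OF h] continuous_intros)
  ultimately show ?thesis by simp
qed

lemma Green_y:
  fixes H h :: "real \<times> real \<Rightarrow> complex"
  assumes H: "\<And>x y. y \<in> {0..1} \<Longrightarrow> ((\<lambda>y. H (x, y)) has_vector_derivative h (x, y)) (at y within {0..1})"
    and h: "continuous_on UNIV h"
  shows "(LINT z|lborel_on (strip a). h z) = (LINT x:{a<..<a+1}|lborel. H (x, 1) - H (x, 0))"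
proof -
  have "(LINT z|lborel_on (strip a). h z) = (LINT x:{a<..<a+1}|lborel. (LINT y:{0<..<1}|lborel. h (x, y)))"
    by (rule integral_strip_Fubini(1)[OF L2_integrable[OF strip_measure continuous_L2[OF strip_measure
        strip_bounded h]]])
  moreover have "(LINT y:{0<..<1}|lborel. h (x, y)) = H (x, 1) - H (x, 0)" for x
    by (rule set_integral_FTC_open) (auto intro!: H continuous_on_compose2[OF h] continuous_intros)
  ultimately show ?thesis by simp
qed

lemma smooth_partial_x:
  assumes "smooth f"
  shows "((\<lambda>x. f (x, y)) has_vector_derivative dderiv (1, 0) f (x, y)) (at x within S)"
proof -
  let ?D = "frechet_derivative f (at (x, y))"
  have "((\<lambda>x. (x, y)) has_derivative (\<lambda>e. (e, 0))) (at x within S)"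
    by (auto intro!: derivative_eq_intros)
  from has_derivative_compose[OF this smooth_has_derivative[OF assms]]
  have "((\<lambda>x. f (x, y)) has_derivative (\<lambda>e. ?D (e, 0))) (at x within S)" .
  moreover have eq: "(\<lambda>e. ?D (e, 0)) = (\<lambda>e. e *\<^sub>R ?D (1, 0))"
  proof
    show "?D (e, 0) = e *\<^sub>R ?D (1, 0)" for e
    using linear_scale[OF has_derivative_linear[OF smooth_has_derivative[OF assms]], of "(x, y)" e "(1, 0)"] by simp
  qed
  ultimately show ?thesis
    unfolding has_vector_derivative_def dderiv_def by argo
qed

lemma smooth_partial_y:
  assumes "smooth f"
  shows "((\<lambda>y. f (x, y)) has_vector_derivative dderiv (0, 1) f (x, y)) (at y within S)"
proof -
  let ?D = "frechet_derivative f (at (x, y))"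
  have "((\<lambda>y. (x, y)) has_derivative (\<lambda>e. (0, e))) (at y within S)"
    by (auto intro!: derivative_eq_intros)
  from has_derivative_compose[OF this smooth_has_derivative[OF assms]]
  have "((\<lambda>y. f (x, y)) has_derivative (\<lambda>e. ?D (0, e))) (at y within S)" .
  moreover have eq: "(\<lambda>e. ?D (0, e)) = (\<lambda>e. e *\<^sub>R ?D (0, 1))"
  proof
    show "?D (0, e) = e *\<^sub>R ?D (0, 1)" for e
    using linear_scale[OF has_derivative_linear[OF smooth_has_derivative[OF assms]], of "(x, y)" e "(0, 1)"] by simp
  qed
  ultimately show ?thesis
    unfolding has_vector_derivative_def dderiv_def by argo
qed

lemma Basis_plane: "(Basis :: (real \<times> real) set) = {(1, 0), (0, 1)}"
  by (auto simp: Basis_prod_def)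

lemma smooth_has_weak_deriv:
  fixes f :: "real \<times> real \<Rightarrow> complex"
  assumes f: "smooth f" and e: "e \<in> Basis"
  shows "has_weak_deriv (strip a) e f (dderiv e f)"
  unfolding has_weak_deriv_def
proof (intro conjI ballI)
  have cf: "continuous_on UNIV f" "continuous_on UNIV (dderiv e f)"
    using f e by (auto intro: smooth_continuous smooth_dderiv)
  then show "dderiv e f \<in> L2 (strip a)"
    by (intro continuous_L2 strip_measure strip_bounded)
  fix \<phi> :: "real \<times> real \<Rightarrow> complex" assume \<phi>: "\<phi> \<in> test_functions (strip a)"
  then have sm: "smooth \<phi>" by (simp add: test_functions_def)
  have c\<phi>: "continuous_on UNIV \<phi>" "continuous_on UNIV (dderiv e \<phi>)"
    using sm e by (auto intro: smooth_continuous smooth_dderiv)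
  have zero: "\<phi> z = 0" if "z \<notin> strip a" for z
    using \<phi> that closure_subset[of "{x. \<phi> x \<noteq> 0}"] by (auto simp: test_functions_def)
  have i: "integrable (lborel_on (strip a)) (\<lambda>z. f z * dderiv e \<phi> z)" "integrable (lborel_on (strip a))
      (\<lambda>z. dderiv e f z * \<phi> z)"
    using cf c\<phi> by (auto intro!: L2_integrable[OF strip_measure] continuous_L2 strip_measure strip_bounded
        continuous_intros)
  have ch: "continuous_on UNIV (\<lambda>z. f z * dderiv e \<phi> z + dderiv e f z * \<phi> z)"
    by (intro continuous_intros cf c\<phi>)
  have "(LINT z|lborel_on (strip a). f z * dderiv e \<phi> z + dderiv e f z * \<phi> z) = 0"
  proof -
    consider "e = (1, 0)" | "e = (0, 1)" using e by (auto simp: Basis_plane)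
    then show ?thesis
    proof cases
      case 1
      have "(LINT z|lborel_on (strip a). f z * dderiv e \<phi> z + dderiv e f z * \<phi> z) = (LINT y:{0<..<1}|lborel. f
          (a + 1, y) * \<phi> (a + 1, y) - f (a, y) * \<phi> (a, y))"
        by (rule Green_x[where H="\<lambda>z. f z * \<phi> z", OF _ ch])
          (auto simp: 1 intro!: has_vector_derivative_mult smooth_partial_x f sm)
      then show ?thesis by (simp add: zero strip_def set_lebesgue_integral_def)
    next
      case 2
      have "(LINT z|lborel_on (strip a). f z * dderiv e \<phi> z + dderiv e f z * \<phi> z) = (LINT x:{a<..<a+1}|lborel. f
          (x, 1) * \<phi> (x, 1) - f (x, 0) * \<phi> (x, 0))"
        by (rule Green_y[where H="\<lambda>z. f z * \<phi> z", OF _ ch])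
          (auto simp: 2 intro!: has_vector_derivative_mult smooth_partial_y f sm)
      then show ?thesis by (simp add: zero strip_def set_lebesgue_integral_def)
    qed
  qed
  then show "(LINT x|lborel_on (strip a). f x * dderiv e \<phi> x) = - (LINT x|lborel_on (strip a). dderiv e f x * \<phi> x)"
    using i by (simp add: add_eq_0_iff2)
qed

lemma L2_norm_le_H1_norm: "L2_norm S u \<le> H1_norm S u"
  unfolding H1_norm_def by (rule real_le_rsqrt) simp

lemma weak_deriv_norm_le_H1_norm:
  assumes "e \<in> Basis"
  shows "L2_norm S (weak_deriv S e u) \<le> H1_norm S u"
  unfolding H1_norm_def
proof (rule real_le_rsqrt)
  have "(L2_norm S (weak_deriv S e u))\<^sup>2 \<le> (\<Sum>e\<in>Basis. (L2_norm S (weak_deriv S e u))\<^sup>2)"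
    by (rule member_le_sum[OF assms]) auto
  also have "\<dots> = (grad_norm S u)\<^sup>2"
    unfolding grad_norm_def by (simp add: sum_nonneg)
  finally show "(L2_norm S (weak_deriv S e u))\<^sup>2 \<le> (L2_norm S u)\<^sup>2 + (grad_norm S u)\<^sup>2"
    by (simp add: add_increasing)
qed

text \<open>A Green formula for smooth functions passes to every function with a trace: the left
  side is continuous in the H1 norm and the right side in the L2 norm of the trace, and the
  approximating sequence in \<open>has_trace\<close> converges in both. How \<open>\<phi>\<close>,
  \<open>\<phi>'\<close> and \<open>\<kappa>\<close> are related is encoded in \<open>Green\<close>
  alone.\<close>

lemma trace_Green:
  fixes u :: "real \<times> real \<Rightarrow> complex"
  assumes tr: "has_trace (strip a) p q u g" and e: "e \<in> Basis"
    and \<phi>: "continuous_on UNIV \<phi>" and \<phi>': "continuous_on UNIV \<phi>'" and \<kappa>: "continuous_on UNIV \<kappa>"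
    and Green: "\<And>f. smooth f \<Longrightarrow> (LINT z|lborel_on (strip a). dderiv e f z * \<phi> z + f z * \<phi>' z) =
      (LINT t|lborel_on {0..1}. f (linepath p q t) * \<kappa> t)"
  shows "(LINT z|lborel_on (strip a). weak_deriv (strip a) e u z * \<phi> z + u z * \<phi>' z) =
      (LINT t|lborel_on {0..1}. g t * \<kappa> t)"
proof -
  let ?M = "lborel_on (strip a)"
  obtain f where f: "\<And>n. smooth (f n)" and H1: "(\<lambda>n::nat. H1_norm (strip a) (\<lambda>x. f n x - u x)) \<longlonglongrightarrow> 0"
    and g: "(\<lambda>n. L2_norm {0..1} (\<lambda>t. f n (linepath p q t) - g t)) \<longlonglongrightarrow> 0"
    and u: "u \<in> H1 (strip a)" and gL: "g \<in> L2 {0..1}"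
    using tr unfolding has_trace_def by blast
  have uL: "u \<in> L2 (strip a)" using u by (simp add: H1_def)
  have du: "has_weak_deriv (strip a) e u (weak_deriv (strip a) e u)" by (rule H1_weak_deriv[OF u e])
  then have duL: "weak_deriv (strip a) e u \<in> L2 (strip a)" by (simp add: has_weak_deriv_def)
  have fL: "f n \<in> L2 (strip a)" for n
    by (intro continuous_L2 strip_measure strip_bounded smooth_continuous f)
  have dfL: "dderiv e (f n) \<in> L2 (strip a)" for n
    by (intro continuous_L2 strip_measure strip_bounded smooth_continuous smooth_dderiv f e)
  define D where "D = (\<lambda>n. weak_deriv (strip a) e (\<lambda>x. f n x - u x))"
  have hd: "has_weak_deriv (strip a) e (\<lambda>x. f n x - u x) (\<lambda>x. dderiv e (f n) x - weak_deriv (strip a) e u x)" for n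
    using has_weak_deriv_lincomb[OF smooth_has_weak_deriv[OF f e] du e fL uL, of 1] by simp
  then have hD: "has_weak_deriv (strip a) e (\<lambda>x. f n x - u x) (D n)" for n
    unfolding D_def by (rule has_weak_deriv_weak_deriv)
  then have DL: "D n \<in> L2 (strip a)" for n by (simp add: has_weak_deriv_def)
  \<comment> \<open>The H1 norm of the difference contains a chosen derivative \<open>D n\<close>;
    it has to be identified with the difference of the derivatives before it can control the
    integrals.\<close>
  have AE: "AE x in ?M. D n x = dderiv e (f n) x - weak_deriv (strip a) e u x" for n
    by (rule has_weak_deriv_unique[OF hD hd e]) (auto intro: L2_diff fL uL)
  obtain B where B: "\<forall>x\<in>strip a. cmod (\<phi> x) \<le> B"
    using continuous_bounded_on[OF \<phi> strip_bounded] by blast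
  obtain B' where B': "\<forall>x\<in>strip a. cmod (\<phi>' x) \<le> B'"
    using continuous_bounded_on[OF \<phi>' strip_bounded] by blast
  obtain K where K: "\<forall>x\<in>{0..1}. cmod (\<kappa> x) \<le> K"
    using continuous_bounded_on[OF \<kappa> bounded_closed_interval] by blast
  note b = L2_mult_bounded[OF strip_measure _ continuous_measurable_on[OF \<phi>] B]
  note b' = L2_mult_bounded[OF strip_measure _ continuous_measurable_on[OF \<phi>'] B']
  note bK = L2_mult_bounded[OF Icc_measure _ continuous_measurable_on[OF \<kappa>] K]
  let ?T = "\<lambda>du u. LINT z|?M. du z * \<phi> z + u z * \<phi>' z"
  have cl: "continuous_on UNIV (\<lambda>t. f n (linepath p q t))" for n
    by (rule continuous_on_compose2[OF smooth_continuous[OF f]]) (auto intro: continuous_intros)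
  have flL: "(\<lambda>t. f n (linepath p q t)) \<in> L2 {0..1}" for n
    by (rule continuous_L2[OF Icc_measure _ cl]) simp
  have nonneg: "0 \<le> B" "0 \<le> B'"
  proof -
    have z: "(a + 1/2, 1/2) \<in> strip a" by (simp add: strip_def)
    show "0 \<le> B" "0 \<le> B'"
      using B[rule_format, OF z] B'[rule_format, OF z] by (meson norm_ge_zero order_trans)+
  qed
  have "(\<lambda>n. ?T (dderiv e (f n)) (f n)) \<longlonglongrightarrow> ?T (weak_deriv (strip a) e u) u"
  proof (rule LIM_zero_cancel, rule Lim_null_comparison)
    have eq: "?T (dderiv e (f n)) (f n) - ?T (weak_deriv (strip a) e u) u = (LINT z|?M. D n z * \<phi> z) +
        (LINT z|?M. (f n z - u z) * \<phi>' z)" for n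
    proof -
      have "(LINT z|?M. D n z * \<phi> z) = (LINT z|?M. (dderiv e (f n) z - weak_deriv (strip a) e u z) * \<phi> z)"
        by (intro integral_strip_cong_AE AE L2_measurable DL L2_diff dfL duL continuous_measurable_on \<phi>)
      then show ?thesis
        using b(1)[OF dfL] b(1)[OF duL] b'(1)[OF fL] b'(1)[OF uL] by (simp add: left_diff_distrib)
    qed
    show "\<forall>\<^sub>F n in sequentially. norm (?T (dderiv e (f n)) (f n) - ?T (weak_deriv (strip a) e u) u) \<le> (B + B') *
        H1_norm (strip a) (\<lambda>x. f n x - u x)"
    proof (rule always_eventually, rule allI)
      fix n
      have "norm (?T (dderiv e (f n)) (f n) - ?T (weak_deriv (strip a) e u) u) \<le> B * L2_norm (strip a) (D n) +
          B' * L2_norm (strip a) (\<lambda>x. f n x - u x)"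
        unfolding eq by (intro order_trans[OF norm_triangle_ineq] add_mono b(2)[OF DL] b'(2)[OF L2_diff[OF fL uL]])
      also have "\<dots> \<le> B * H1_norm (strip a) (\<lambda>x. f n x - u x) + B' * H1_norm (strip a) (\<lambda>x. f n x - u x)"
        unfolding D_def using nonneg by (intro add_mono mult_left_mono weak_deriv_norm_le_H1_norm[OF e]
            L2_norm_le_H1_norm)
      finally show "norm (?T (dderiv e (f n)) (f n) - ?T (weak_deriv (strip a) e u) u) \<le> (B + B') * H1_norm
          (strip a) (\<lambda>x. f n x - u x)"
        by (simp add: distrib_right)
    qed
    show "(\<lambda>n. (B + B') * H1_norm (strip a) (\<lambda>x. f n x - u x)) \<longlonglongrightarrow> 0"
      using tendsto_mult_left[OF H1, of "B + B'"] by simp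
  qed
  moreover have "(\<lambda>n. LINT t|lborel_on {0..1}. f n (linepath p q t) * \<kappa> t) \<longlonglongrightarrow> (LINT t|lborel_on {0..1}. g t * \<kappa> t)"
  proof (rule LIM_zero_cancel, rule Lim_null_comparison)
    have eq: "(LINT t|lborel_on {0..1}. f n (linepath p q t) * \<kappa> t) - (LINT t|lborel_on {0..1}. g t * \<kappa> t) =
        (LINT t|lborel_on {0..1}. (f n (linepath p q t) - g t) * \<kappa> t)" for n
      using bK(1)[OF flL] bK(1)[OF gL] by (simp add: left_diff_distrib)
    show "\<forall>\<^sub>F n in sequentially. norm ((LINT t|lborel_on {0..1}. f n (linepath p q t) * \<kappa> t) - (LINT t|lborel_on
        {0..1}. g t * \<kappa> t)) \<le> K * L2_norm {0..1} (\<lambda>t. f n (linepath p q t) - g t)"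
      unfolding eq by (intro always_eventually allI bK(2)[OF L2_diff[OF flL gL]])
    show "(\<lambda>n. K * L2_norm {0..1} (\<lambda>t. f n (linepath p q t) - g t)) \<longlonglongrightarrow> 0"
      using tendsto_mult_left[OF g, of K] by simp
  qed
  ultimately show ?thesis
    unfolding Green[OF f] using LIMSEQ_unique by blast
qed

section \<open>Coefficients of the modes\<close>

text \<open>The integral runs over the whole line with the indicator inside, the shape of
  \<open>strip_Parseval\<close>; as a result the coefficient vanishes for x outside the strip. The
  weight \<open>e\<close> stays arbitrary to cover sines, cosines and their derivatives.\<close>

definition mode_coeff :: "(real \<Rightarrow> real) \<Rightarrow> real \<Rightarrow> (real \<times> real \<Rightarrow> complex) \<Rightarrow> real \<Rightarrow> complex"
  where "mode_coeff e a F x = (LINT y|lborel. (indicator (strip a) (x, y) *\<^sub>R F (x, y)) * complex_of_real (e y))"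

lemma mode_coeff_eq:
  "mode_coeff e a F x = indicator {a<..<a+1} x *\<^sub>R (LINT y:{0<..<1}|lborel. F (x, y) * complex_of_real (e y))"
proof -
  have "(indicator (strip a) (x, y) *\<^sub>R F (x, y)) * complex_of_real (e y) =
     indicator {a<..<a+1} x *\<^sub>R (indicator {0<..<1} y *\<^sub>R (F (x, y) * complex_of_real (e y)))" for y
    by (auto simp: indicator_def strip_def)
  then show ?thesis
    unfolding mode_coeff_def set_lebesgue_integral_def by (simp del: scaleR_scaleR)
qed

lemma mode_coeff_outside: "x \<notin> {a<..<a+1} \<Longrightarrow> mode_coeff e a F x = 0"
  by (simp add: mode_coeff_eq)

text \<open>Fubini: testing with a product \<psi>(x) e(y) on the strip is testing the coefficient
  with \<psi> on the line. This carries every weak identity from the plane to one variable.\<close>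

lemma mode_coeff_pair:
  assumes F: "F \<in> L2 (strip a)" and e: "continuous_on UNIV e" and \<psi>: "continuous_on UNIV \<psi>"
  shows "integrable (lborel_on (strip a)) (\<lambda>z. F z * (\<psi> (fst z) * complex_of_real (e (snd z))))"
    "integrable lborel (\<lambda>x. mode_coeff e a F x * \<psi> x)"
    "(LINT z|lborel_on (strip a). F z * (\<psi> (fst z) * complex_of_real (e (snd z)))) = (LINT x|lborel. mode_coeff
        e a F x * \<psi> x)"
proof -
  let ?h = "\<lambda>z. F z * (\<psi> (fst z) * complex_of_real (e (snd z)))"
  have c: "continuous_on UNIV (\<lambda>z. \<psi> (fst z) * complex_of_real (e (snd z)))"
    by (intro continuous_intros continuous_on_compose2[OF \<psi>] continuous_on_compose2[OF e]) auto
  obtain B where B: "\<forall>z\<in>strip a. cmod (\<psi> (fst z) * complex_of_real (e (snd z))) \<le> B"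
    using continuous_bounded_on[OF c strip_bounded] by blast
  show i: "integrable (lborel_on (strip a)) ?h"
    by (rule L2_mult_bounded(1)[OF strip_measure F continuous_measurable_on[OF c] B])
  have eq: "indicator {a<..<a+1} x *\<^sub>R (LINT y:{0<..<1}|lborel. ?h (x, y)) = mode_coeff e a F x * \<psi> x" for x
  proof -
    have "(LINT y:{0<..<1}|lborel. ?h (x, y)) = (LINT y:{0<..<1}|lborel. F (x, y) * complex_of_real (e y)) * \<psi> x"
      by (simp add: mult_ac flip: set_integral_mult_left)
    then show ?thesis by (simp add: mode_coeff_eq)
  qed
  show "(LINT z|lborel_on (strip a). ?h z) = (LINT x|lborel. mode_coeff e a F x * \<psi> x)"
    unfolding integral_strip_Fubini(1)[OF i] set_lebesgue_integral_def[of _ "{a<..<a+1}"] eq ..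
  have S: "strip a \<in> sets borel" using strip_open by auto
  have i': "integrable (lborel \<Otimes>\<^sub>M lborel) (\<lambda>z. indicator (strip a) z *\<^sub>R ?h z)"
    using i S by (simp add: integrable_restrict_space lborel_prod)
  have "indicator (strip a) (x, y) *\<^sub>R ?h (x, y) = (indicator (strip a) (x, y) *\<^sub>R F (x, y) * complex_of_real
      (e y)) * \<psi> x" for x y
    by simp
  then have "(LINT y|lborel. indicator (strip a) (x, y) *\<^sub>R ?h (x, y)) = mode_coeff e a F x * \<psi> x" for x
    unfolding mode_coeff_def by (simp only: integral_mult_left_zero)
  then show "integrable lborel (\<lambda>x. mode_coeff e a F x * \<psi> x)"
    using lborel_pair.integrable_fst'[OF i'] by simp
qed

lemma mode_coeff_integrable:
  assumes "F \<in> L2 (strip a)" "continuous_on UNIV e"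
  shows "integrable lborel (mode_coeff e a F)"
  using mode_coeff_pair(2)[OF assms, of "\<lambda>x. 1"] by simp

lemma L2_norm_strip:
  assumes "F \<in> L2 (strip a)"
  shows "(\<lambda>z. indicator (strip a) z *\<^sub>R F z) \<in> borel_measurable borel"
    "integrable lborel (\<lambda>z. (cmod (indicator (strip a) z *\<^sub>R F z))\<^sup>2)"
    "(LINT z|lborel. (cmod (indicator (strip a) z *\<^sub>R F z))\<^sup>2) = (L2_norm (strip a) F)\<^sup>2"
proof -
  have S: "strip a \<in> sets borel" using strip_open by auto
  have eq: "(cmod (indicator (strip a) z *\<^sub>R F z))\<^sup>2 = indicator (strip a) z *\<^sub>R (cmod (F z))\<^sup>2" for z
    by (auto simp: indicator_def)
  show "(\<lambda>z. indicator (strip a) z *\<^sub>R F z) \<in> borel_measurable borel"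
    using assms S by (auto simp: L2_def borel_measurable_restrict_space_iff)
  show "integrable lborel (\<lambda>z. (cmod (indicator (strip a) z *\<^sub>R F z))\<^sup>2)"
    unfolding eq using assms S by (auto simp: L2_def integrable_restrict_space)
  show "(LINT z|lborel. (cmod (indicator (strip a) z *\<^sub>R F z))\<^sup>2) = (L2_norm (strip a) F)\<^sup>2"
    unfolding eq L2_norm_square using S by (simp add: integral_restrict_space)
qed

lemma (in l2_basis) mode_coeff_Parseval:
  assumes F: "F \<in> L2 (strip a)"
  shows "integrable lborel (\<lambda>x. (cmod (mode_coeff (e n) a F x))\<^sup>2)"
    "(\<lambda>n. LINT x|lborel. (cmod (mode_coeff (e n) a F x))\<^sup>2) sums (L2_norm (strip a) F)\<^sup>2"
proof -
  have 0: "\<And>z. snd z \<notin> {0<..<1} \<Longrightarrow> indicator (strip a) z *\<^sub>R F z = 0"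
    by (auto simp: strip_def indicator_def)
  note P = strip_Parseval(2,3)[OF L2_norm_strip(1,2)[OF F] 0]
  show "integrable lborel (\<lambda>x. (cmod (mode_coeff (e n) a F x))\<^sup>2)"
    unfolding mode_coeff_def by (rule P(1))
  show "(\<lambda>n. LINT x|lborel. (cmod (mode_coeff (e n) a F x))\<^sup>2) sums (L2_norm (strip a) F)\<^sup>2"
    using P(2) unfolding mode_coeff_def L2_norm_strip(3)[OF F] .
qed

lemma global_antiderivative:
  fixes \<theta> :: "real \<Rightarrow> complex"
  assumes "continuous_on UNIV \<theta>"
  obtains \<psi> where "\<And>x. (\<psi> has_vector_derivative \<theta> x) (at x)" "\<psi> c = 0"
proof
  let ?\<psi> = "\<lambda>u. LBINT y=ereal c..ereal u. \<theta> y"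
  show "(?\<psi> has_vector_derivative \<theta> x) (at x)" for x
  proof -
    have "(?\<psi> has_vector_derivative \<theta> x) (at x within {min c x - 1..max c x + 1})"
      by (rule interval_integral_FTC2) (auto intro: continuous_on_subset[OF assms])
    moreover have "x \<in> interior {min c x - 1..max c x + 1}" by auto
    ultimately show ?thesis by (metis at_within_interior)
  qed
  show "?\<psi> c = 0" by (simp add: interval_integral_endpoints_same)
qed

lemma vector_derivative_continuous:
  assumes "\<And>x. (\<psi> has_vector_derivative \<psi>' x) (at x)"
  shows "continuous_on UNIV \<psi>"
  using assms by (meson continuous_at_imp_continuous_on has_vector_derivative_continuous)

lemma has_vd_compose_fst:
  fixes \<psi> f :: "real \<Rightarrow> complex"
  assumes "(\<psi> has_vector_derivative d) (at x)" "(f has_vector_derivative f') (at x within S)"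
  shows "((\<lambda>x. f x * (\<psi> x * k)) has_vector_derivative f' * (\<psi> x * k) + f x * (d * k)) (at x within S)"
  using assms(2) has_vector_derivative_at_within[OF assms(1)]
  by (auto intro!: derivative_eq_intros)

lemma integral_Icc_open:
  fixes h :: "real \<Rightarrow> complex"
  assumes "continuous_on UNIV h"
  shows "(LINT t|lborel_on {0..1}. h t) = (LINT t:{0<..<1}|lborel. h t)"
proof -
  have "(LINT t|lborel_on {0..1}. h t) = (LINT t:{0..1}|lborel. h t)"
    by (simp add: integral_restrict_space set_lebesgue_integral_def)
  also have "\<dots> = (LINT t:{0<..<1}|lborel. h t)"
    by (rule set_integral_open_closed[OF borel_measurable_continuous_onI[OF assms], symmetric])
  finally show ?thesis .
qed

text \<open>Green's formula in x tested with \<psi>(x) e(y). As \<psi> vanishes at the opposite end,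
  only the trace at \<open>c\<close> is left, and \<open>r\<close> is the sign of the outward normal
  there.\<close>

lemma trace_x:
  fixes u :: "real \<times> real \<Rightarrow> complex"
  assumes tr: "has_trace (strip a) (c, 0) (c, 1) u g"
    and c: "c = a + 1 \<and> \<psi> a = 0 \<and> r = 1 \<or> c = a \<and> \<psi> (a + 1) = 0 \<and> r = -1"
    and \<psi>: "\<And>x. (\<psi> has_vector_derivative \<psi>' x) (at x)" and c\<psi>': "continuous_on UNIV \<psi>'" and e: "continuous_on UNIV e"
  shows "(LINT x|lborel. mode_coeff e a (weak_deriv (strip a) (1, 0) u) x * \<psi> x + mode_coeff e a u x * \<psi>' x) =
    r * \<psi> c * (LINT t|lborel_on {0..1}. g t * complex_of_real (e t))"
proof -
  have u: "u \<in> H1 (strip a)" using tr by (simp add: has_trace_def)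
  have uL: "u \<in> L2 (strip a)" using u by (simp add: H1_def)
  have duL: "weak_deriv (strip a) (1, 0) u \<in> L2 (strip a)"
    using H1_weak_deriv[OF u, of "(1, 0)"] by (simp add: Basis_plane has_weak_deriv_def)
  have c\<psi>: "continuous_on UNIV \<psi>" by (rule vector_derivative_continuous[OF \<psi>])
  let ?e = "\<lambda>y. complex_of_real (e y)"
  have ce: "continuous_on UNIV ?e" by (intro continuous_intros e)
  have c2: "continuous_on UNIV (\<lambda>z. p (fst z) * ?e (snd z))" if "continuous_on UNIV p" for p :: "real \<Rightarrow> complex"
    by (intro continuous_on_mult continuous_on_compose2[OF that] continuous_on_compose2[OF ce] continuous_on_fst
        continuous_on_snd continuous_on_id) auto
  have "(LINT z|lborel_on (strip a). weak_deriv (strip a) (1, 0) u z * (\<psi> (fst z) * ?e (snd z)) + u z *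
      (\<psi>' (fst z) * ?e (snd z))) =
      (LINT t|lborel_on {0..1}. g t * (r * \<psi> c * ?e t))"
  proof (rule trace_Green[OF tr])
    show "continuous_on UNIV (\<lambda>t. r * \<psi> c * ?e t)" by (intro continuous_intros ce)
    fix f :: "real \<times> real \<Rightarrow> complex" assume f: "smooth f"
    have cf: "continuous_on UNIV f" "continuous_on UNIV (dderiv (1, 0) f)"
      using f by (auto intro!: smooth_continuous smooth_dderiv simp: Basis_plane)
    have ces: "continuous_on UNIV (\<lambda>z::real \<times> real. e (snd z))"
      by (rule continuous_on_compose2[OF e]) (auto intro: continuous_intros)
    have "(LINT z|lborel_on (strip a). dderiv (1, 0) f z * (\<psi> (fst z) * ?e (snd z)) + f z * (\<psi>' (fst z) * ?e
        (snd z))) =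
      (LINT y:{0<..<1}|lborel. f (a + 1, y) * (\<psi> (a + 1) * ?e y) - f (a, y) * (\<psi> a * ?e y))"
      by (rule Green_x[where H="\<lambda>z. f z * (\<psi> (fst z) * ?e (snd z))", simplified])
         (auto intro!: has_vd_compose_fst \<psi> smooth_partial_x f continuous_intros cf c2 c\<psi> c\<psi>' ces)
    also have "\<dots> = (LINT y:{0<..<1}|lborel. f (c, y) * (r * \<psi> c * ?e y))"
      using c by auto
    also have "\<dots> = (LINT t|lborel_on {0..1}. f (linepath (c, 0) (c, 1) t) * (r * \<psi> c * ?e t))"
      by (subst integral_Icc_open) (auto intro!: continuous_intros ce continuous_on_compose2[OF cf(1)] simp:
          linepath_def algebra_simps)
    finally show "(LINT z|lborel_on (strip a). dderiv (1, 0) f z * (\<psi> (fst z) * ?e (snd z)) + f z *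
        (\<psi>' (fst z) * ?e (snd z))) =
      (LINT t|lborel_on {0..1}. f (linepath (c, 0) (c, 1) t) * (r * \<psi> c * ?e t))" .
  qed (auto simp: Basis_plane intro!: c2 c\<psi> c\<psi>')
  moreover have "(LINT z|lborel_on (strip a). weak_deriv (strip a) (1, 0) u z * (\<psi> (fst z) * ?e (snd z)) + u z *
      (\<psi>' (fst z) * ?e (snd z))) =
    (LINT x|lborel. mode_coeff e a (weak_deriv (strip a) (1, 0) u) x * \<psi> x + mode_coeff e a u x * \<psi>' x)"
    using mode_coeff_pair[OF uL e c\<psi>'] mode_coeff_pair[OF duL e c\<psi>] by simp
  moreover have "(LINT t|lborel_on {0..1}. g t * (r * \<psi> c * ?e t)) = r * \<psi> c * (LINT t|lborel_on {0..1}. g t * ?e t)"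
    by (simp add: mult_ac flip: integral_mult_right_zero)
  ultimately show ?thesis by simp
qed

text \<open>Integration by parts in y. Both horizontal traces are zero, so \<open>e\<close> may be
  nonzero at the ends; this is needed for the cosines.\<close>

lemma trace_y:
  fixes u :: "real \<times> real \<Rightarrow> complex"
  assumes tr: "has_trace (strip a) (a, 0) (a + 1, 0) u (\<lambda>_. 0)" "has_trace (strip a) (a, 1) (a + 1, 1) u (\<lambda>_. 0)"
    and \<psi>: "continuous_on UNIV \<psi>" and e: "\<And>y. (e has_real_derivative e' y) (at y)" and e': "continuous_on UNIV e'"
  shows "(LINT x|lborel. (mode_coeff e a (weak_deriv (strip a) (0, 1) u) x + mode_coeff e' a u x) * \<psi> x) = 0"
proof -
  have u: "u \<in> H1 (strip a)" using tr by (simp add: has_trace_def)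
  have uL: "u \<in> L2 (strip a)" using u by (simp add: H1_def)
  have duL: "weak_deriv (strip a) (0, 1) u \<in> L2 (strip a)"
    using H1_weak_deriv[OF u, of "(0, 1)"] by (simp add: Basis_plane has_weak_deriv_def)
  have ce: "continuous_on UNIV e"
    using e by (meson DERIV_isCont continuous_at_imp_continuous_on)
  have one: "(LINT z|lborel_on (strip a). weak_deriv (strip a) (0, 1) u z * (\<psi> (fst z) * complex_of_real
      (w (snd z))) + u z * (\<psi> (fst z) * complex_of_real (w' (snd z)))) = 0"
    if tr: "has_trace (strip a) (a, d) (a + 1, d) u (\<lambda>_. 0)" and d: "d = 1 \<and> w 0 = 0 \<and> r = 1 \<or> d = 0 \<and> w 1 = 0 \<and>
        r = -1"
      and w: "\<And>y. (w has_real_derivative w' y) (at y)" and w': "continuous_on UNIV w'" for d r :: real and w w'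
  proof -
    have cw: "continuous_on UNIV w"
      using w by (meson DERIV_isCont continuous_at_imp_continuous_on)
    have c2: "continuous_on UNIV (\<lambda>z. \<psi> (fst z) * complex_of_real (p (snd z)))" if "continuous_on UNIV p" for p
        :: "real \<Rightarrow> real"
      by (intro continuous_intros continuous_on_compose2[OF that] continuous_on_compose2[OF \<psi>]) auto
    have cs: "continuous_on UNIV (\<lambda>t. \<psi> (a + t))"
      by (intro continuous_on_compose2[OF \<psi>] continuous_intros) auto
    have "(LINT z|lborel_on (strip a). weak_deriv (strip a) (0, 1) u z * (\<psi> (fst z) * complex_of_real
        (w (snd z))) + u z * (\<psi> (fst z) * complex_of_real (w' (snd z)))) =
      (LINT t|lborel_on {0..1}. 0 * (of_real (r * w d) * \<psi> (a + t)))"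
    proof (rule trace_Green[OF tr])
      show "continuous_on UNIV (\<lambda>t. of_real (r * w d) * \<psi> (a + t))" by (intro continuous_intros cs)
      fix f :: "real \<times> real \<Rightarrow> complex" assume f: "smooth f"
      have cf: "continuous_on UNIV f" "continuous_on UNIV (dderiv (0, 1) f)"
        using f by (auto intro!: smooth_continuous smooth_dderiv simp: Basis_plane)
      have D: "((\<lambda>y. f (x, y) * (\<psi> x * of_real (w y))) has_vector_derivative dderiv (0, 1) f (x, y) *
          (\<psi> x * of_real (w y)) + f (x, y) * (\<psi> x * of_real (w' y))) (at y within S)" for x y S
        by (auto intro!: derivative_eq_intros smooth_partial_y f w[THEN has_field_derivative_at_within])
      have "(LINT z|lborel_on (strip a). dderiv (0, 1) f z * (\<psi> (fst z) * of_real (w (snd z))) + f z *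
          (\<psi> (fst z) * of_real (w' (snd z)))) =
        (LINT x:{a<..<a+1}|lborel. f (x, 1) * (\<psi> x * of_real (w 1)) - f (x, 0) * (\<psi> x * of_real (w 0)))"
        by (rule Green_y[where H="\<lambda>z. f z * (\<psi> (fst z) * of_real (w (snd z)))", simplified])
           (auto intro!: D continuous_intros cf c2 cw w')
      also have "\<dots> = (LINT x:{a<..<a+1}|lborel. f (x, d) * (of_real (r * w d) * \<psi> x))"
      proof -
        have "f (x, 1) * (\<psi> x * of_real (w 1)) - f (x, 0) * (\<psi> x * of_real (w 0)) = f (x, d) *
            (of_real (r * w d) * \<psi> x)" for x
          using d by (auto simp: mult_ac)
        then show ?thesis by simp
      qed
      also have "\<dots> = (LINT t:{0<..<1}|lborel. f (a + t, d) * (of_real (r * w d) * \<psi> (a + t)))"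
        unfolding set_lebesgue_integral_def
        by (subst lborel_integral_real_affine[of 1 _ a]) (auto intro!: Bochner_Integration.integral_cong simp:
            indicator_def)
      also have "\<dots> = (LINT t|lborel_on {0..1}. f (linepath (a, d) (a + 1, d) t) * (of_real (r * w d) * \<psi> (a + t)))"
      proof -
        have lp: "linepath (a, d) (a + 1, d) t = (a + t, d)" for t
          by (simp add: linepath_def algebra_simps)
        show ?thesis
          unfolding lp by (rule integral_Icc_open[symmetric]) (intro continuous_intros cs
              continuous_on_compose2[OF cf(1)]; simp)
      qed
      finally show "(LINT z|lborel_on (strip a). dderiv (0, 1) f z * (\<psi> (fst z) * of_real (w (snd z))) + f z *
          (\<psi> (fst z) * of_real (w' (snd z)))) =
        (LINT t|lborel_on {0..1}. f (linepath (a, d) (a + 1, d) t) * (of_real (r * w d) * \<psi> (a + t)))" .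
    qed (auto simp: Basis_plane intro!: c2 cw w')
    then show ?thesis by simp
  qed
  \<comment> \<open>Each trace comes with its own approximating sequence, so the two sides cannot be
    treated at once. Writing e = (1 - y) e + y e gives two weights, each vanishing on the side
    opposite to the trace in use.\<close>
  let ?w0 = "\<lambda>y. (1 - y) * e y" and ?w0' = "\<lambda>y. (1 - y) * e' y - e y" and ?w1 = "\<lambda>y. y * e y" and ?w1' = "\<lambda>y. y
      * e' y + e y"
  let ?T = "\<lambda>w w'. LINT z|lborel_on (strip a). weak_deriv (strip a) (0, 1) u z * (\<psi> (fst z) * complex_of_real
      (w (snd z))) + u z * (\<psi> (fst z) * complex_of_real (w' (snd z)))"
  have T: "?T w w' = (LINT x|lborel. mode_coeff w a (weak_deriv (strip a) (0, 1) u) x * \<psi> x) + (LINT x|lborel.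
      mode_coeff w' a u x * \<psi> x)"
    if "continuous_on UNIV w" "continuous_on UNIV w'" for w w'
    using mode_coeff_pair[OF uL that(2) \<psi>] mode_coeff_pair[OF duL that(1) \<psi>] by simp
  have "?T ?w0 ?w0' = 0"
    by (rule one[OF tr(1), where r="-1"]) (auto intro!: derivative_eq_intros e continuous_intros e' ce)
  moreover have "?T ?w1 ?w1' = 0"
    by (rule one[OF tr(2), where r="1"]) (auto intro!: derivative_eq_intros e continuous_intros e' ce)
  moreover have "?T e e' = ?T ?w0 ?w0' + ?T ?w1 ?w1'"
  proof -
    have i: "integrable (lborel_on (strip a)) (\<lambda>z. weak_deriv (strip a) (0, 1) u z *
        (\<psi> (fst z) * complex_of_real (w (snd z))) + u z * (\<psi> (fst z) * complex_of_real (w' (snd z))))"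
      if "continuous_on UNIV w" "continuous_on UNIV w'" for w w'
      using mode_coeff_pair(1)[OF uL that(2) \<psi>] mode_coeff_pair(1)[OF duL that(1) \<psi>] by simp
    show ?thesis
      by (subst Bochner_Integration.integral_add[symmetric]; (intro i continuous_intros ce e')?)
         (auto intro!: Bochner_Integration.integral_cong simp: algebra_simps)
  qed
  ultimately have "(LINT x|lborel. mode_coeff e a (weak_deriv (strip a) (0, 1) u) x * \<psi> x) + (LINT x|lborel.
      mode_coeff e' a u x * \<psi> x) = 0"
    using T[OF ce e'] by simp
  then show ?thesis
    using mode_coeff_pair(2)[OF uL e' \<psi>] mode_coeff_pair(2)[OF duL ce \<psi>] by (simp add: distrib_right)
qed

section \<open>Weak identities in one variable: primitives and the lemma of du Bois-Reymond\<close>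

lemma bump_continuous: "continuous_on UNIV (\<lambda>x. complex_of_real (bump \<alpha> \<beta> m x))"
  by (rule smooth_continuous[OF smooth_bump])

lemma integrable_mult_continuous:
  fixes G q :: "real \<Rightarrow> complex"
  assumes G: "integrable lborel G" "\<And>x. x \<notin> {a<..<b} \<Longrightarrow> G x = 0" and q: "continuous_on UNIV q"
  shows "integrable lborel (\<lambda>x. G x * q x)"
proof -
  have "set_integrable lborel {a..b} G"
    unfolding set_integrable_def by (rule integrable_mult_indicator[OF _ G(1)]) simp
  then have "set_integrable lborel {a..b} (\<lambda>x. G x * q x)"
    by (rule set_integrable_mult_continuous) (rule continuous_on_subset[OF q], simp)
  moreover have "indicator {a..b} x *\<^sub>R (G x * q x) = G x * q x" for x
    using G(2)[of x] by (cases "x \<in> {a..b}") auto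
  ultimately show ?thesis by (simp add: set_integrable_def)
qed

lemma integrable_indicator_ac:
  assumes "ac_deriv a b K P"
  shows "integrable lborel (\<lambda>x. indicator {a<..<b} x *\<^sub>R K x)"
proof -
  have "set_integrable lborel {a..b} K"
    unfolding set_integrable_def by (rule borel_integrable_compact[OF _ ac_deriv_continuous[OF assms]]) simp
  then have "set_integrable lborel {a<..<b} K"
    by (rule set_integrable_subset) auto
  then show ?thesis by (simp add: set_integrable_def)
qed

lemma primitive_by_parts:
  fixes K P :: "real \<Rightarrow> complex"
  assumes P: "integrable lborel P" "\<And>x. x \<notin> {a<..<b} \<Longrightarrow> P x = 0"
    and K: "ac_deriv a b K P" and ab: "a < b"
    and \<psi>: "\<And>x. (\<psi> has_vector_derivative \<theta> x) (at x)" and c\<theta>: "continuous_on UNIV \<theta>"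
  shows "(LINT x|lborel. P x * \<psi> x) + (LINT x|lborel. (indicator {a<..<b} x *\<^sub>R K x) * \<theta> x) = K b * \<psi> b - K a * \<psi> a"
proof -
  note iK = integrable_indicator_ac[OF K]
  have c\<psi>: "continuous_on UNIV \<psi>" by (rule vector_derivative_continuous[OF \<psi>])
  have AC: "ac_deriv a b (\<lambda>x. K x * \<psi> x) (\<lambda>x. P x * \<psi> x + K x * \<theta> x)"
    by (intro ac_deriv_mult[OF K] ac_deriv_C1[OF \<psi>] continuous_on_subset[OF c\<theta>]) simp
  have i: "integrable lborel (\<lambda>x. P x * \<psi> x)" "integrable lborel (\<lambda>x. (indicator {a<..<b} x *\<^sub>R K x) * \<theta> x)"
    using integrable_mult_continuous[OF P c\<psi>] integrable_mult_continuous[OF iK _ c\<theta>, of a b] by auto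
  have "K b * \<psi> b - K a * \<psi> a = (LINT x:{a..b}|lborel. P x * \<psi> x + K x * \<theta> x)"
    using ac_deriv_integral[OF AC] ab by simp
  also have "\<dots> = (LINT x|lborel. P x * \<psi> x + (indicator {a<..<b} x *\<^sub>R K x) * \<theta> x)"
    unfolding set_lebesgue_integral_def
  proof (rule integral_cong_AE)
    show "AE x in lborel. indicator {a..b} x *\<^sub>R (P x * \<psi> x + K x * \<theta> x) = P x * \<psi> x + indicator {a<..<b} x *\<^sub>R
        K x * \<theta> x"
      using AE_lborel_singleton[of a] AE_lborel_singleton[of b]
    proof eventually_elim
      case (elim x)
      then show ?case using P(2)[of x] by (cases "x \<in> {a<..<b}") auto
    qed
    show "(\<lambda>x. indicator {a..b} x *\<^sub>R (P x * \<psi> x + K x * \<theta> x)) \<in> borel_measurable lborel"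
      using AC by (auto simp: ac_deriv_def set_integrable_def)
    show "(\<lambda>x. P x * \<psi> x + (indicator {a<..<b} x *\<^sub>R K x) * \<theta> x) \<in> borel_measurable lborel"
      using i by (intro borel_measurable_add) auto
  qed
  also have "\<dots> = (LINT x|lborel. P x * \<psi> x) + (LINT x|lborel. (indicator {a<..<b} x *\<^sub>R K x) * \<theta> x)"
    by (intro Bochner_Integration.integral_add i)
  finally show ?thesis ..
qed

text \<open>The test function \<psi> is the antiderivative of a bump normalised at \<open>c\<close>,
  and \<open>K\<close> vanishes at the other end, so integration by parts for \<open>K\<close> has
  no boundary term. Hence \<open>U - K\<close> annihilates every bump.\<close>

lemma AE_eq_primitive:
  fixes U K P :: "real \<Rightarrow> complex"
  assumes U: "integrable lborel U" "\<And>x. x \<notin> {a<..<b} \<Longrightarrow> U x = 0" and P: "integrable lborel P" "\<And>x. x \<notin> {a<..<b} \<Longrightarrow>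
      P x = 0"
    and K: "ac_deriv a b K P" and ab: "a < b"
    and c: "c = a \<and> K b = 0 \<or> c = b \<and> K a = 0"
    and test: "\<And>\<psi> \<theta>. continuous_on UNIV \<theta> \<Longrightarrow> (\<And>x. (\<psi> has_vector_derivative \<theta> x) (at x)) \<Longrightarrow> \<psi> c = 0 \<Longrightarrow>
      (LINT x|lborel. P x * \<psi> x + U x * \<theta> x) = 0"
  shows "AE x in lborel. x \<in> {a<..<b} \<longrightarrow> U x = K x"
proof -
  note iK = integrable_indicator_ac[OF K]
  define F where "F = (\<lambda>x. U x - indicator {a<..<b} x *\<^sub>R K x)"
  have "AE x in lborel. F x = 0"
  proof (rule AE_eq_0_interval[where a=a and b=b])
    show "integrable lborel F" unfolding F_def by (intro Bochner_Integration.integrable_diff U iK)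
    show "F x = 0" if "x \<notin> {a<..<b}" for x using U(2)[OF that] that by (simp add: F_def)
    fix \<alpha> \<beta> :: real and m
    define \<theta> where "\<theta> = (\<lambda>x. complex_of_real (bump \<alpha> \<beta> m x))"
    have c\<theta>: "continuous_on UNIV \<theta>" unfolding \<theta>_def by (rule bump_continuous)
    obtain \<psi> where \<psi>: "\<And>x. (\<psi> has_vector_derivative \<theta> x) (at x)" "\<psi> c = 0"
      using global_antiderivative[OF c\<theta>] by blast
    have c\<psi>: "continuous_on UNIV \<psi>" by (rule vector_derivative_continuous[OF \<psi>(1)])
    have 1: "(LINT x|lborel. P x * \<psi> x) + (LINT x|lborel. (indicator {a<..<b} x *\<^sub>R K x) * \<theta> x) = 0"
      using primitive_by_parts[OF P K ab \<psi>(1) c\<theta>] c \<psi>(2) by auto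
    have "(LINT x|lborel. P x * \<psi> x) + (LINT x|lborel. U x * \<theta> x) = 0"
      using test[OF c\<theta> \<psi>] integrable_mult_continuous[OF P c\<psi>] integrable_mult_continuous[OF U c\<theta>] by simp
    with 1 have "(LINT x|lborel. U x * \<theta> x) - (LINT x|lborel. (indicator {a<..<b} x *\<^sub>R K x) * \<theta> x) = 0"
      by (metis add_left_cancel right_minus_eq)
    moreover have "integrable lborel (\<lambda>x. (indicator {a<..<b} x *\<^sub>R K x) * \<theta> x)"
      using integrable_mult_continuous[OF iK _ c\<theta>, of a b] by simp
    ultimately show "(LINT x|lborel. F x * complex_of_real (bump \<alpha> \<beta> m x)) = 0"
      using integrable_mult_continuous[OF U c\<theta>] unfolding F_def \<theta>_def[symmetric, THEN fun_cong]
          left_diff_distrib by simp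
  qed
  then show ?thesis
    by eventually_elim (auto simp: F_def)
qed

text \<open>Here \<psi> must vanish near both ends, so its derivative has mean zero. Only such test
  functions are available, and \<open>R\<close> is therefore determined up to a constant.\<close>

lemma du_Bois_Reymond:
  fixes R T K :: "real \<Rightarrow> complex"
  assumes R: "integrable lborel R" "\<And>x. x \<notin> {-1<..<1} \<Longrightarrow> R x = 0" and T: "integrable lborel T" "\<And>x. x \<notin> {-1<..<1}
      \<Longrightarrow> T x = 0"
    and K: "ac_deriv (-1) 1 K T"
    and test: "\<And>\<psi> r. smooth \<psi> \<Longrightarrow> 0 < r \<Longrightarrow> (\<And>x. \<psi> x \<noteq> 0 \<Longrightarrow> x \<in> {-1 + r..1 - r}) \<Longrightarrow>
      (LINT x|lborel. R x * dderiv 1 \<psi> x + T x * \<psi> x) = 0"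
  shows "\<exists>c. AE x in lborel. x \<in> {-1<..<1} \<longrightarrow> R x = K x + c"
proof -
  note iK = integrable_indicator_ac[OF K]
  have ib: "integrable lborel (bump \<alpha> \<beta> m)" if "-1 \<le> \<alpha>" "\<beta> \<le> 1" for \<alpha> \<beta> m
  proof -
    have "integrable lborel (\<lambda>x. indicator {-1..1} x *\<^sub>R bump \<alpha> \<beta> m x)"
    proof (rule borel_integrable_compact)
      have "continuous_on UNIV (\<lambda>x. Re (complex_of_real (bump \<alpha> \<beta> m x)))" by (intro continuous_intros bump_continuous)
      then show "continuous_on {-1..1} (bump \<alpha> \<beta> m)" by (auto intro: continuous_on_subset)
    qed simp
    moreover have "indicator {-1..1} x *\<^sub>R bump \<alpha> \<beta> m x = bump \<alpha> \<beta> m x" for x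
    proof (cases "bump \<alpha> \<beta> m x = 0")
      case False
      moreover have "0 < 1 / real (Suc m)" by simp
      ultimately have "x \<in> {-1..1}"
        using bump_support[of \<alpha> \<beta> m x] that unfolding atLeastAtMost_iff by linarith
      then show ?thesis by simp
    qed simp
    ultimately show ?thesis by (simp only:)
  qed
  have "(\<lambda>m. LINT x|lborel. bump (-1) 1 m x) \<longlonglongrightarrow> (LINT x::real|lborel. indicator {-1<..<1} x)"
  proof (rule integral_dominated_convergence)
    show "integrable lborel (indicator {-1<..<1::real} :: real \<Rightarrow> real)" by (rule integrable_real_indicator) auto
    show "AE x in lborel. norm (bump (-1) 1 m x) \<le> indicator {-1<..<1} x" for m
    proof (rule AE_I2)
      fix x
      have "x \<in> {-1<..<1}" if "bump (-1) 1 m x \<noteq> 0"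
      proof -
        have "0 < 1 / real (Suc m)" by simp
        then show ?thesis
          using bump_support[OF that] unfolding atLeastAtMost_iff greaterThanLessThan_iff by linarith
      qed
      then show "norm (bump (-1) 1 m x) \<le> indicator {-1<..<1} x"
        using bump_bounds[of "-1" 1 m x] by (cases "bump (-1) 1 m x = 0") auto
    qed
    show "bump (-1) 1 m \<in> borel_measurable lborel" for m using ib[of "-1" 1 m] by auto
  qed (auto intro: bump_tendsto)
  then have "(\<lambda>m. LINT x|lborel. bump (-1) 1 m x) \<longlonglongrightarrow> 2" by simp
  then have "\<forall>\<^sub>F m in sequentially. (LINT x|lborel. bump (-1) 1 m x) > 1"
    by (rule order_tendstoD) simp
  \<comment> \<open>The bumps on (-1,1) have integrals tending to 2, so a late one has a nonzero
    integral and can serve to correct mean values.\<close>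
  then obtain m0 where m0: "(LINT x|lborel. bump (-1) 1 m0 x) > 1"
    by (auto simp: eventually_sequentially)
  define b0 where "b0 = (\<lambda>x. complex_of_real (bump (-1) 1 m0 x))"
  define I where "I = (LINT x|lborel. b0 x)"
  have I: "I \<noteq> 0"
    using m0 ib[of "-1" 1 m0] by (simp add: I_def b0_def)
  define G where "G = (\<lambda>x. R x - indicator {-1<..<1} x *\<^sub>R K x)"
  have G: "integrable lborel G" "\<And>x. x \<notin> {-1<..<1} \<Longrightarrow> G x = 0"
    unfolding G_def using R by (auto intro!: iK)
  \<comment> \<open>The value for which \<open>F\<close> annihilates the reference bump
    \<open>b0\<close>.\<close>
  define c where "c = (LINT x|lborel. G x * b0 x) / I"
  define F where "F = (\<lambda>x. G x - indicator {-1<..<1} x *\<^sub>R c)"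
  have ic: "integrable lborel (\<lambda>x::real. indicator {-1<..<1} x *\<^sub>R c)"
    by (intro integrable_scaleR_left integrable_real_indicator) auto
  have "AE x in lborel. F x = 0"
  proof (rule AE_eq_0_interval[where a="-1" and b=1])
    show "integrable lborel F" unfolding F_def by (intro Bochner_Integration.integrable_diff G ic)
    show "F x = 0" if "x \<notin> {-1<..<1}" for x using G(2)[OF that] that by (simp add: F_def)
    fix \<alpha> \<beta> :: real and m assume ab: "-1 \<le> \<alpha>" "\<beta> \<le> 1"
    define b where "b = (\<lambda>x. complex_of_real (bump \<alpha> \<beta> m x))"
    define J where "J = (LINT x|lborel. b x)"
    \<comment> \<open>The bump \<open>b\<close> minus the multiple of \<open>b0\<close> that makes
      the integral zero; its antiderivative then vanishes at both ends.\<close>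
    define \<theta> where "\<theta> = (\<lambda>x. b x - (J / I) * b0 x)"
    have sm: "smooth b" "smooth b0" "smooth \<theta>"
      unfolding \<theta>_def b_def b0_def by (intro smooth_diff smooth_mult smooth_const smooth_bump)+
    have cont: "continuous_on UNIV b" "continuous_on UNIV b0" "continuous_on UNIV \<theta>"
      using sm by (auto intro: smooth_continuous)
    have ibb: "integrable lborel b" "integrable lborel b0"
      unfolding b_def b0_def using ib ab by auto
    \<comment> \<open>A common distance of both supports from the ends -1 and 1. Beyond it the
      antiderivative is constant, hence zero.\<close>
    define r where "r = min (1 / real (Suc m)) (1 / real (Suc m0))"
    have r: "0 < r" "r \<le> 1" by (auto simp: r_def min_le_iff_disj)
    have \<theta>0: "x \<in> {-1 + r..1 - r}" if "\<theta> x \<noteq> 0" for x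
    proof -
      have "bump \<alpha> \<beta> m x \<noteq> 0 \<or> bump (-1) 1 m0 x \<noteq> 0"
        using that by (auto simp: \<theta>_def b_def b0_def)
      moreover have "r \<le> 1 / real (Suc m)" "r \<le> 1 / real (Suc m0)" by (auto simp: r_def)
      ultimately show ?thesis
        using bump_support[of \<alpha> \<beta> m x] bump_support[of "-1" 1 m0 x] ab unfolding atLeastAtMost_iff by linarith
    qed
    obtain \<psi> where \<psi>: "\<And>x. (\<psi> has_vector_derivative \<theta> x) (at x)" "\<psi> (-1) = 0"
      using global_antiderivative[OF cont(3)] by blast
    have \<psi>s: "smooth \<psi>" by (rule smooth_antideriv[OF sm(3) \<psi>(1)])
    have c\<psi>: "continuous_on UNIV \<psi>" by (rule smooth_continuous[OF \<psi>s])
    have d\<psi>: "dderiv 1 \<psi> = \<theta>"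
      using vector_derivative_unique_at smooth_has_vector_derivative[OF \<psi>s] \<psi>(1) by blast
    have const: "\<psi> x = \<psi> y" if "\<And>t. t \<in> {min x y..max x y} \<Longrightarrow> \<theta> t = 0" for x y
    proof -
      obtain k where k: "\<And>t. t \<in> {min x y..max x y} \<Longrightarrow> \<psi> t = k"
      proof (rule has_vector_derivative_zero_constant)
        show "(\<psi> has_vector_derivative 0) (at t within {min x y..max x y})" if "t \<in> {min x y..max x y}" for t
          using has_vector_derivative_at_within[OF \<psi>(1)[of t]] \<open>\<And>t. t \<in> {min x y..max x y} \<Longrightarrow> \<theta> t = 0\<close>[OF that] by simp
      qed auto
      show ?thesis using k[of x] k[of y] by simp
    qed
    have \<psi>1: "\<psi> 1 = 0"
    proof -
      have "(LINT x:{-1..1}|lborel. \<theta> x) = \<psi> 1 - \<psi> (-1)"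
        by (rule ac_deriv_integral[OF ac_deriv_C1[OF \<psi>(1) continuous_on_subset[OF cont(3)]]]) auto
      moreover have "indicator {-1..1} x *\<^sub>R \<theta> x = \<theta> x" for x
        using \<theta>0[of x] r by (cases "\<theta> x = 0") (auto simp: indicator_def)
      moreover have "(LINT x|lborel. \<theta> x) = J - J / I * I"
        unfolding \<theta>_def J_def I_def using ibb by simp
      ultimately show ?thesis using \<psi>(2) I by (simp add: set_lebesgue_integral_def)
    qed
    have supp: "x \<in> {-1 + r..1 - r}" if "\<psi> x \<noteq> 0" for x
    proof (rule ccontr)
      assume n: "x \<notin> {-1 + r..1 - r}"
      then consider "x < -1 + r" | "x > 1 - r" by fastforce
      then show False
      proof cases
        case 1
        have "\<psi> x = \<psi> (-1)"
          by (rule const) (use \<theta>0 r 1 in \<open>force simp: min_def max_def split: if_splits\<close>)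
        then show False using that \<psi>(2) by simp
      next
        case 2
        have "\<psi> x = \<psi> 1"
          by (rule const) (use \<theta>0 r 2 in \<open>force simp: min_def max_def split: if_splits\<close>)
        then show False using that \<psi>1 by simp
      qed
    qed
    have "(LINT x|lborel. R x * \<theta> x) + (LINT x|lborel. T x * \<psi> x) = 0"
      using test[OF \<psi>s r(1) supp] integrable_mult_continuous[OF R cont(3)] integrable_mult_continuous[OF T c\<psi>]
          by (simp add: d\<psi>)
    moreover have "(LINT x|lborel. T x * \<psi> x) + (LINT x|lborel. (indicator {-1<..<1} x *\<^sub>R K x) * \<theta> x) = 0"
      using primitive_by_parts[OF T K _ \<psi>(1) cont(3)] \<psi>(2) \<psi>1 by simp
    ultimately have "(LINT x|lborel. R x * \<theta> x) - (LINT x|lborel. (indicator {-1<..<1} x *\<^sub>R K x) * \<theta> x) = 0"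
      by (metis add.commute add_left_cancel right_minus_eq)
    moreover have "integrable lborel (\<lambda>x. (indicator {-1<..<1} x *\<^sub>R K x) * \<theta> x)"
      using integrable_mult_continuous[OF iK _ cont(3), of "-1" 1] by simp
    ultimately have "(LINT x|lborel. G x * \<theta> x) = 0"
      using integrable_mult_continuous[OF R cont(3)] unfolding G_def left_diff_distrib by simp
    moreover have "G x * \<theta> x = G x * b x - (J / I) * (G x * b0 x)" for x
      by (simp add: \<theta>_def algebra_simps)
    ultimately have "(LINT x|lborel. G x * b x) = (J / I) * (LINT x|lborel. G x * b0 x)"
      using integrable_mult_continuous[OF G cont(1)] integrable_mult_continuous[OF G cont(2)] by simp
    also have "\<dots> = (LINT x|lborel. (indicator {-1<..<1} x *\<^sub>R c) * b x)"
    proof -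
      have "(indicator {-1<..<1} x *\<^sub>R c) * b x = c * b x" for x
      proof (cases "b x = 0")
        case False
        moreover have "0 < 1 / real (Suc m)" by simp
        ultimately have "x \<in> {-1<..<1}"
          using bump_support[of \<alpha> \<beta> m x] ab unfolding atLeastAtMost_iff greaterThanLessThan_iff b_def
              of_real_eq_0_iff by linarith
        then show ?thesis by simp
      qed simp
      then show ?thesis by (simp add: c_def J_def)
    qed
    finally have "(LINT x|lborel. G x * b x) = (LINT x|lborel. (indicator {-1<..<1} x *\<^sub>R c) * b x)" .
    then have "(LINT x|lborel. F x * b x) = 0"
      using integrable_mult_continuous[OF G cont(1)] integrable_mult_continuous[OF ic _ cont(1), of "-1" 1]
      unfolding F_def left_diff_distrib by simp
    then show "(LINT x|lborel. F x * complex_of_real (bump \<alpha> \<beta> m x)) = 0"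
      by (simp add: b_def)
  qed
  then have "AE x in lborel. x \<in> {-1<..<1} \<longrightarrow> R x = K x + c"
    by eventually_elim (auto simp: F_def G_def)
  then show ?thesis by blast
qed

section \<open>The condition on the normal traces\<close>

definition wavenumber :: "nat \<Rightarrow> real"
  where "wavenumber n = real (Suc n) * pi"

definition sin_basis' :: "nat \<Rightarrow> real \<Rightarrow> real"
  where "sin_basis' n y = sqrt 2 * (wavenumber n * cos (wavenumber n * y))"

lemma wavenumber_ge_1: "1 \<le> wavenumber n"
proof -
  have "1 * 1 \<le> real (Suc n) * pi"
    using pi_ge_two by (intro mult_mono) auto
  then show ?thesis by (simp add: wavenumber_def)
qed

lemma sin_basis_deriv: "(sin_basis n has_real_derivative sin_basis' n y) (at y)"
proof -
  have "((\<lambda>y. sqrt 2 * sin (wavenumber n * y)) has_real_derivative sin_basis' n y) (at y)"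
    unfolding sin_basis'_def by (auto intro!: derivative_eq_intros)
  then show ?thesis by (simp add: sin_basis_def[abs_def] wavenumber_def)
qed

lemma sin_basis'_deriv: "(sin_basis' n has_real_derivative - (wavenumber n)\<^sup>2 * sin_basis n y) (at y)"
proof -
  have "((\<lambda>y. sqrt 2 * (wavenumber n * cos (wavenumber n * y))) has_real_derivative - (wavenumber n)\<^sup>2 *
      (sqrt 2 * sin (wavenumber n * y))) (at y)"
    by (auto intro!: derivative_eq_intros simp: power2_eq_square)
  then show ?thesis by (simp add: sin_basis_def sin_basis'_def[abs_def] wavenumber_def)
qed

lemma sin_basis_continuous: "continuous_on UNIV (sin_basis n)" "continuous_on UNIV (sin_basis' n)"
  unfolding sin_basis_def[abs_def] sin_basis'_def[abs_def] by (intro continuous_intros)+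

lemma smooth_sin_basis: "smooth (\<lambda>y. complex_of_real (sin_basis n y))"
proof -
  let ?I = "\<lambda>h. \<exists>a b. h = (\<lambda>y. complex_of_real (a * sin (wavenumber n * y) + b * cos (wavenumber n * y)))"
  have "smooth (\<lambda>y. (\<lambda>y. complex_of_real (sqrt 2 * sin (wavenumber n * y) + 0 * cos (wavenumber n * y)))
      ((1::real) \<bullet> y + 0))"
  proof (rule smooth_real_induct[where I="?I"])
    fix h assume "?I h"
    then obtain a b where h: "h = (\<lambda>y. complex_of_real (a * sin (wavenumber n * y) + b * cos (wavenumber n *
        y)))" by blast
    let ?h' = "\<lambda>y. complex_of_real ((- b * wavenumber n) * sin (wavenumber n * y) + (a * wavenumber n) * cos
        (wavenumber n * y))"
    have "(h has_vector_derivative ?h' y) (at y)" for y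
      unfolding h by (rule bounded_linear.has_vector_derivative[OF bounded_linear_of_real])
        (auto intro!: derivative_eq_intros simp flip: has_real_derivative_iff_has_vector_derivative)
    then show "\<exists>h'. ?I h' \<and> (\<forall>t. (h has_vector_derivative h' t) (at t))"
      by (intro exI[of _ ?h'] conjI) blast+
  qed blast
  then show ?thesis by (simp add: sin_basis_def wavenumber_def)
qed

text \<open>The last two bounds are the linear decay at the ends of (0,1); there they compensate the
  growing derivative of a cutoff.\<close>

lemma sin_basis_bounds:
  "\<bar>sin_basis n y\<bar> \<le> 2" "\<bar>sin_basis' n y\<bar> \<le> 2 * wavenumber n"
  "0 \<le> y \<Longrightarrow> \<bar>sin_basis n y\<bar> \<le> 2 * wavenumber n * y"
  "y \<le> 1 \<Longrightarrow> \<bar>sin_basis n y\<bar> \<le> 2 * wavenumber n * (1 - y)"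
proof -
  have k: "0 \<le> wavenumber n" using wavenumber_ge_1[of n] by simp
  have s: "sqrt 2 \<le> (2::real)" by (rule real_le_lsqrt) auto
  have m: "sqrt 2 * \<bar>t\<bar> \<le> 2 * c" if "\<bar>t\<bar> \<le> c" for t c :: real
    using s that by (intro mult_mono) auto
  have b: "\<bar>sin_basis n y\<bar> = sqrt 2 * \<bar>sin (wavenumber n * y)\<bar>" for y
    by (simp add: sin_basis_def wavenumber_def abs_mult)
  show "\<bar>sin_basis n y\<bar> \<le> 2" unfolding b using m[of "sin (wavenumber n * y)" 1] by simp
  have "\<bar>wavenumber n * cos (wavenumber n * y)\<bar> \<le> wavenumber n * 1"
    using k unfolding abs_mult by (intro mult_mono) auto
  then show "\<bar>sin_basis' n y\<bar> \<le> 2 * wavenumber n"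
    unfolding sin_basis'_def using m[of "wavenumber n * cos (wavenumber n * y)" "wavenumber n"] by
        (simp add: abs_mult)
  have pos: "\<bar>sin_basis n y\<bar> \<le> 2 * wavenumber n * y" if "0 \<le> y" for y
    unfolding b mult.assoc using that k abs_sin_x_le_abs_x[of "wavenumber n * y"] by (intro m) (simp add: abs_mult)
  show "0 \<le> y \<Longrightarrow> \<bar>sin_basis n y\<bar> \<le> 2 * wavenumber n * y" by (rule pos)
  have "\<bar>sin (wavenumber n * (1 - y))\<bar> = \<bar>sin (wavenumber n * y)\<bar>"
  proof -
    have z: "sin (wavenumber n) = 0" unfolding wavenumber_def by (rule sin_npi)
    then have "\<bar>cos (wavenumber n)\<bar> = 1" using sin_zero_abs_cos_one by blast
    then show ?thesis using z by (simp add: right_diff_distrib sin_diff abs_mult)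
  qed
  then have "\<bar>sin_basis n y\<bar> = \<bar>sin_basis n (1 - y)\<bar>" unfolding b by simp
  then show "y \<le> 1 \<Longrightarrow> \<bar>sin_basis n y\<bar> \<le> 2 * wavenumber n * (1 - y)" using pos[of "1 - y"] by simp
qed

section \<open>Sines cut off near the horizontal sides\<close>

definition dflat :: "real \<Rightarrow> real" where "dflat = flat [:0, 0, 1:]"

lemma flat_1_deriv: "(flat 1 has_real_derivative dflat t) (at t)"
  using flat_has_derivative[of 1 t] by (simp add: dflat_def)

text \<open>With t + 1 = (m + 1) r the second bound says that the derivative of the cutoff at
  distance r from the boundary is at most 2/r, uniformly in m.\<close>

lemma dflat_bounds: "0 \<le> dflat t" "(t + 1) * dflat t \<le> 2"
proof -
  show "0 \<le> dflat t" by (simp add: dflat_def flat_def)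
  show "(t + 1) * dflat t \<le> 2"
  proof (cases "0 < t")
    case True
    \<comment> \<open>In terms of r = 1/t the claim is r + r^2 <= 2 exp r, a consequence of the
      quadratic Taylor bound.\<close>
    let ?r = "1 / t"
    have "0 < ?r" using True by simp
    then have "?r + ?r\<^sup>2 \<le> 2 + 2 * ?r + ?r\<^sup>2" by linarith
    also have "\<dots> = 2 * (1 + ?r + ?r\<^sup>2 / 2)" by simp
    also have "\<dots> \<le> 2 * exp ?r"
      using exp_lower_Taylor_quadratic[of ?r] True by simp
    finally have "(?r + ?r\<^sup>2) * exp (- ?r) \<le> 2"
      by (simp add: exp_minus field_simps)
    moreover have "(t + 1) * dflat t = (?r + ?r\<^sup>2) * exp (- ?r)"
      using True by (simp add: dflat_def flat_def field_simps power2_eq_square)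
    ultimately show ?thesis by simp
  qed (simp add: dflat_def flat_def)
qed

lemma dflat_tendsto:
  assumes "0 < c"
  shows "(\<lambda>m. real (Suc m) * dflat (real (Suc m) * c - 1)) \<longlonglongrightarrow> 0"
proof -
  have "(\<lambda>m. real (Suc m) * ((1 / (real (Suc m) * c - 1))\<^sup>2 * exp (- (1 / (real (Suc m) * c - 1))))) \<longlonglongrightarrow> 0"
    using assms by real_asymp
  moreover have "filterlim (\<lambda>m. real (Suc m) * c - 1) at_top sequentially"
    using assms by real_asymp
  then have "\<forall>\<^sub>F m in sequentially. 0 < real (Suc m) * c - 1"
    by (rule filterlim_at_top_dense[THEN iffD1, rule_format])
  then have "\<forall>\<^sub>F m in sequentially. real (Suc m) * ((1 / (real (Suc m) * c - 1))\<^sup>2 * exp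
      (- (1 / (real (Suc m) * c - 1)))) = real (Suc m) * dflat (real (Suc m) * c - 1)"
    by eventually_elim (simp add: dflat_def flat_def power2_eq_square)
  ultimately show ?thesis by (rule Lim_transform_eventually)
qed

definition dbump :: "nat \<Rightarrow> real \<Rightarrow> real"
  where "dbump m y = real (Suc m) * dflat (real (Suc m) * y - 1) * flat 1 (real (Suc m) * (1 - y) - 1)
    - flat 1 (real (Suc m) * y - 1) * (real (Suc m) * dflat (real (Suc m) * (1 - y) - 1))"

lemma bump_deriv: "(bump 0 1 m has_real_derivative dbump m y) (at y)"
proof -
  have "((\<lambda>t. flat 1 (real (Suc m) * (t - 0) - 1) * flat 1 (real (Suc m) * (1 - t) - 1)) has_real_derivative
      dbump m y) (at y)"
  proof -
    have d1: "((\<lambda>t. flat 1 (real (Suc m) * (t - 0) - 1)) has_real_derivative dflat (real (Suc m) * (y - 0) - 1)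
        * real (Suc m)) (at y)"
      by (rule DERIV_chain2[OF flat_1_deriv]) (auto intro!: derivative_eq_intros)
    have d2: "((\<lambda>t. flat 1 (real (Suc m) * (1 - t) - 1)) has_real_derivative dflat (real (Suc m) * (1 - y) - 1)
        * (- real (Suc m))) (at y)"
      by (rule DERIV_chain2[OF flat_1_deriv]) (auto intro!: derivative_eq_intros)
    show ?thesis
      by (rule DERIV_cong[OF DERIV_mult[OF d1 d2]]) (simp add: dbump_def mult_ac del: of_nat_Suc)
  qed
  then show ?thesis by (simp add: bump_def[abs_def])
qed

definition cutoff_sin :: "nat \<Rightarrow> nat \<Rightarrow> real \<Rightarrow> real"
  where "cutoff_sin n m y = sin_basis n y * bump 0 1 m y"

definition cutoff_sin' :: "nat \<Rightarrow> nat \<Rightarrow> real \<Rightarrow> real"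
  where "cutoff_sin' n m y = sin_basis' n y * bump 0 1 m y + sin_basis n y * dbump m y"

lemma cutoff_sin_deriv: "(cutoff_sin n m has_real_derivative cutoff_sin' n m y) (at y)"
  unfolding cutoff_sin_def[abs_def] cutoff_sin'_def
  by (auto intro!: derivative_eq_intros sin_basis_deriv bump_deriv)

lemma smooth_cutoff_sin: "smooth (\<lambda>y. complex_of_real (cutoff_sin n m y))"
  using smooth_mult[OF smooth_sin_basis smooth_bump] by (simp add: cutoff_sin_def)

text \<open>The bound is uniform in \<open>m\<close>: the derivative of the cutoff is at most of order \<open>1 / dist (y, {0, 1})\<close>, and the
  sine vanishes at \<open>0\<close> and \<open>1\<close>. Hence the test functions may be replaced by the sine itself in the limit.\<close>

lemma cutoff_sin_bounds:
  assumes y: "y \<in> {0<..<1}"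
  shows "\<bar>cutoff_sin n m y\<bar> \<le> 2" "\<bar>cutoff_sin' n m y\<bar> \<le> 10 * wavenumber n"
proof -
  have k: "0 \<le> wavenumber n" using wavenumber_ge_1[of n] by simp
  have "\<bar>cutoff_sin n m y\<bar> \<le> 2 * 1"
    unfolding cutoff_sin_def abs_mult using sin_basis_bounds(1)[of n y] bump_bounds[of 0 1 m y] by
        (intro mult_mono) auto
  then show "\<bar>cutoff_sin n m y\<bar> \<le> 2" by simp
  \<comment> \<open>With r the distance to the end considered, the factor r in the bound for the
    sine meets the factor 1/r of the cutoff derivative; twice 2 gives 4. The two ends and the
    derivative of the sine itself add up to 4 + 4 + 2 = 10.\<close>
  have side: "\<bar>sin_basis n y\<bar> * (real (Suc m) * dflat (real (Suc m) * r - 1)) \<le> 4 * wavenumber n"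
    if "\<bar>sin_basis n y\<bar> \<le> 2 * wavenumber n * r" for r
  proof -
    have "\<bar>sin_basis n y\<bar> * (real (Suc m) * dflat (real (Suc m) * r - 1)) \<le> (2 * wavenumber n * r) *
        (real (Suc m) * dflat (real (Suc m) * r - 1))"
      using that dflat_bounds(1) by (intro mult_right_mono) auto
    also have "\<dots> = 2 * wavenumber n * (((real (Suc m) * r - 1) + 1) * dflat (real (Suc m) * r - 1))"
      by simp
    also have "\<dots> \<le> 2 * wavenumber n * 2"
      by (intro mult_left_mono dflat_bounds(2)) (use k in simp)
    finally show ?thesis by simp
  qed
  have f: "\<bar>p * q\<bar> \<le> \<bar>p\<bar>" if "0 \<le> q" "q \<le> 1" for p q :: real
    using that by (simp add: abs_mult mult_left_le)
  let ?p = "real (Suc m) * dflat (real (Suc m) * y - 1)" and ?q = "real (Suc m) * dflat (real (Suc m) * (1 - y) - 1)"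
  have "0 \<le> ?p" "0 \<le> ?q" using dflat_bounds(1) by auto
  have 1: "\<bar>sin_basis n y * ?p * flat 1 (real (Suc m) * (1 - y) - 1)\<bar> \<le> 4 * wavenumber n"
  proof -
    have "\<bar>sin_basis n y * ?p * flat 1 (real (Suc m) * (1 - y) - 1)\<bar> \<le> \<bar>sin_basis n y * ?p\<bar>"
      by (rule f[OF flat_1_bounds])
    also have "\<dots> = \<bar>sin_basis n y\<bar> * ?p"
      unfolding abs_mult[of "sin_basis n y" ?p] abs_of_nonneg[OF \<open>0 \<le> ?p\<close>] ..
    also have "\<dots> \<le> 4 * wavenumber n"
      by (rule side[OF sin_basis_bounds(3)]) (use y in simp)
    finally show ?thesis .
  qed
  have 2: "\<bar>sin_basis n y * ?q * flat 1 (real (Suc m) * y - 1)\<bar> \<le> 4 * wavenumber n"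
  proof -
    have "\<bar>sin_basis n y * ?q * flat 1 (real (Suc m) * y - 1)\<bar> \<le> \<bar>sin_basis n y * ?q\<bar>"
      by (rule f[OF flat_1_bounds])
    also have "\<dots> = \<bar>sin_basis n y\<bar> * ?q"
      unfolding abs_mult[of "sin_basis n y" ?q] abs_of_nonneg[OF \<open>0 \<le> ?q\<close>] ..
    also have "\<dots> \<le> 4 * wavenumber n"
      by (rule side[OF sin_basis_bounds(4)]) (use y in simp)
    finally show ?thesis .
  qed
  have 3: "\<bar>sin_basis' n y * bump 0 1 m y\<bar> \<le> 2 * wavenumber n"
    using f[OF bump_bounds, of "sin_basis' n y"] sin_basis_bounds(2)[of n y] by (meson order_trans)
  have "cutoff_sin' n m y = sin_basis' n y * bump 0 1 m y + sin_basis n y * ?p * flat 1 (real (Suc m) * (1 - y)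
      - 1) - sin_basis n y * ?q * flat 1 (real (Suc m) * y - 1)"
    by (simp add: cutoff_sin'_def dbump_def algebra_simps)
  then show "\<bar>cutoff_sin' n m y\<bar> \<le> 10 * wavenumber n"
    using 1 2 3 by linarith
qed

lemma cutoff_sin_tendsto:
  assumes y: "y \<in> {0<..<1}"
  shows "(\<lambda>m. cutoff_sin n m y) \<longlonglongrightarrow> sin_basis n y" "(\<lambda>m. cutoff_sin' n m y) \<longlonglongrightarrow> sin_basis' n y"
proof -
  have b: "(\<lambda>m. bump 0 1 m y) \<longlonglongrightarrow> 1" using bump_tendsto[of 0 1 y] y by simp
  show "(\<lambda>m. cutoff_sin n m y) \<longlonglongrightarrow> sin_basis n y"
    unfolding cutoff_sin_def using tendsto_mult_left[OF b, of "sin_basis n y"] by simp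
  have "(\<lambda>m. dbump m y) \<longlonglongrightarrow> 0 * 1 - 1 * 0"
    unfolding dbump_def using y by (intro tendsto_intros dflat_tendsto flat_1_tendsto) auto
  then have "(\<lambda>m. cutoff_sin' n m y) \<longlonglongrightarrow> sin_basis' n y * 1 + sin_basis n y * 0"
    unfolding cutoff_sin'_def by (intro tendsto_intros b) simp
  then show "(\<lambda>m. cutoff_sin' n m y) \<longlonglongrightarrow> sin_basis' n y" by simp
qed

lemma strip_dominated_convergence:
  fixes G :: "nat \<Rightarrow> real \<times> real \<Rightarrow> complex"
  assumes F: "F \<in> L2 (strip a)" and G: "\<And>m. G m \<in> borel_measurable (lborel_on (strip a))" "G' \<in> borel_measurable
      (lborel_on (strip a))"
    and B: "\<And>m z. z \<in> strip a \<Longrightarrow> cmod (G m z) \<le> B" and lim: "\<And>z. z \<in> strip a \<Longrightarrow> (\<lambda>m. G m z) \<longlonglongrightarrow> G' z"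
  shows "(\<lambda>m. LINT z|lborel_on (strip a). F z * G m z) \<longlonglongrightarrow> (LINT z|lborel_on (strip a). F z * G' z)"
proof (rule integral_dominated_convergence)
  have Fm: "F \<in> borel_measurable (lborel_on (strip a))" by (rule L2_measurable[OF F])
  show "(\<lambda>z. F z * G' z) \<in> borel_measurable (lborel_on (strip a))" "(\<lambda>z. F z * G m z) \<in> borel_measurable
      (lborel_on (strip a))" for m
    by (intro borel_measurable_times Fm G)+
  show "integrable (lborel_on (strip a)) (\<lambda>z. B * cmod (F z))"
    using L2_integrable_norm(1)[OF strip_measure F] by simp
  show "AE z in lborel_on (strip a). (\<lambda>m. F z * G m z) \<longlonglongrightarrow> F z * G' z"
    using lim by (intro AE_I2 tendsto_mult tendsto_const) (simp add: space_restrict_space)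
  show "AE z in lborel_on (strip a). norm (F z * G m z) \<le> B * cmod (F z)" for m
    using B by (intro AE_I2) (simp add: space_restrict_space norm_mult mult.commute[of B] mult_left_mono)
qed

section \<open>The full rectangle and its two halves\<close>

lemma Omega_minus_strip: "\<Omega>\<^sub>- = strip (-1)" and Omega_plus_strip: "\<Omega>\<^sub>+ = strip 0"
  by (auto simp: Omega_minus_def Omega_plus_def strip_def)

lemma strip_subset_Omega: "strip (-1) \<subseteq> \<Omega>\<^sub>0" "strip 0 \<subseteq> \<Omega>\<^sub>0"
  by (auto simp: Omega_full_def strip_def)

lemma Omega_borel: "\<Omega>\<^sub>0 \<in> sets borel"
  by (auto simp: Omega_full_def intro!: borel_open open_Times)

lemma AE_off_axis: "AE z in lborel :: (real \<times> real) measure. fst z \<noteq> 0"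
proof (rule AE_I')
  have "emeasure (lborel \<Otimes>\<^sub>M lborel) ({0::real} \<times> (UNIV::real set)) = emeasure lborel {0::real} * emeasure
      lborel (UNIV::real set)"
    by (rule lborel.emeasure_pair_measure_Times) auto
  then have "emeasure lborel ({0::real} \<times> (UNIV::real set)) = 0"
    by (simp add: lborel_prod)
  then show "{0::real} \<times> (UNIV::real set) \<in> null_sets lborel"
    by (auto simp: null_sets_def intro!: borel_closed closed_Times)
qed auto

lemma integral_Omega_split:
  fixes h :: "real \<times> real \<Rightarrow> 'b::{banach, second_countable_topology}"
  assumes h: "integrable (lborel_on \<Omega>\<^sub>0) h"
  shows "(LINT z|lborel_on \<Omega>\<^sub>0. h z) = (LINT z|lborel_on (strip (-1)). h z) + (LINT z|lborel_on (strip 0). h z)"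
proof -
  have S: "strip a \<in> sets borel" for a using strip_open by auto
  have i: "set_integrable lborel \<Omega>\<^sub>0 h"
    using h Omega_borel by (simp add: set_integrable_def integrable_restrict_space)
  have i': "set_integrable lborel (strip (-1)) h" "set_integrable lborel (strip 0) h"
    by (rule set_integrable_subset[OF i]; simp add: S strip_subset_Omega)+
  have "(LINT z|lborel_on \<Omega>\<^sub>0. h z) = (LINT z|lborel. indicator \<Omega>\<^sub>0 z *\<^sub>R h z)"
    using Omega_borel by (simp add: integral_restrict_space)
  also have "\<dots> = (LINT z|lborel. indicator (strip (-1)) z *\<^sub>R h z + indicator (strip 0) z *\<^sub>R h z)"
  proof (rule integral_cong_AE)
    show "AE z in lborel. indicator \<Omega>\<^sub>0 z *\<^sub>R h z = indicator (strip (-1)) z *\<^sub>R h z + indicator (strip 0) z *\<^sub>R h z"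
      using AE_off_axis by eventually_elim (auto simp: Omega_full_def strip_def indicator_def)
  qed (use i i' in \<open>auto simp: set_integrable_def\<close>)
  also have "\<dots> = (LINT z|lborel_on (strip (-1)). h z) + (LINT z|lborel_on (strip 0). h z)"
    using i' S by (simp add: set_integrable_def integral_restrict_space)
  finally show ?thesis .
qed

lemma continuous_integrable_Omega:
  fixes h :: "real \<times> real \<Rightarrow> 'b::{banach, second_countable_topology}"
  assumes "continuous_on UNIV h"
  shows "integrable (lborel_on \<Omega>\<^sub>0) h"
proof -
  have "set_integrable lborel ({-1..1} \<times> {0..1}) h"
    unfolding set_integrable_def
    by (intro borel_integrable_compact compact_Times continuous_on_subset[OF assms]) auto
  then have "set_integrable lborel \<Omega>\<^sub>0 h"
    by (rule set_integrable_subset) (use Omega_borel in \<open>auto simp: Omega_full_def\<close>)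
  then show ?thesis using Omega_borel by (simp add: set_integrable_def integrable_restrict_space)
qed

lemma continuous_L2_Omega:
  assumes "continuous_on UNIV h"
  shows "h \<in> L2 \<Omega>\<^sub>0"
proof -
  have "continuous_on UNIV (\<lambda>z. (cmod (h z))\<^sup>2)" by (intro continuous_intros assms)
  then show ?thesis
    using continuous_measurable_on[OF assms] by (simp add: L2_def continuous_integrable_Omega)
qed

lemma L2_subset:
  assumes "F \<in> L2 T" "S \<subseteq> T" "S \<in> sets borel" "T \<in> sets borel"
  shows "F \<in> L2 S"
proof -
  have "F \<in> borel_measurable (lborel_on S)"
    by (rule measurable_restrict_mono[OF L2_measurable[OF assms(1)] assms(2)])
  moreover have "set_integrable lborel T (\<lambda>x. (cmod (F x))\<^sup>2)"
    using assms by (auto simp: L2_def set_integrable_def integrable_restrict_space)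
  then have "set_integrable lborel S (\<lambda>x. (cmod (F x))\<^sup>2)"
    by (rule set_integrable_subset) (use assms in auto)
  ultimately show ?thesis
    using assms by (auto simp: L2_def set_integrable_def integrable_restrict_space)
qed

lemma test_function_integral_subset:
  fixes h :: "real \<times> real \<Rightarrow> complex"
  assumes "\<And>z. z \<notin> S \<Longrightarrow> h z = 0" "S \<subseteq> T" "S \<in> sets borel" "T \<in> sets borel"
  shows "(LINT z|lborel_on T. h z) = (LINT z|lborel_on S. h z)"
proof -
  have eq: "indicator T z *\<^sub>R h z = indicator S z *\<^sub>R h z" for z
    using assms(1)[of z] assms(2) by (auto simp: indicator_def)
  have "(LINT z|lborel_on T. h z) = (LINT z|lborel. indicator T z *\<^sub>R h z)"
    using assms by (simp add: integral_restrict_space)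
  also have "\<dots> = (LINT z|lborel_on S. h z)"
    unfolding eq using assms by (simp add: integral_restrict_space)
  finally show ?thesis .
qed

lemma test_function_outside:
  assumes "\<phi> \<in> test_functions S" "z \<notin> S"
  shows "\<phi> z = 0" "dderiv e \<phi> z = 0"
proof -
  let ?C = "closure {x. \<phi> x \<noteq> 0}"
  have z: "z \<in> - ?C" using assms by (auto simp: test_functions_def)
  then show "\<phi> z = 0" using closure_subset[of "{x. \<phi> x \<noteq> 0}"] by auto
  have "((\<lambda>x. 0) has_derivative (\<lambda>x. 0)) (at z)" by simp
  then have "(\<phi> has_derivative (\<lambda>x. 0)) (at z)"
  proof (rule has_derivative_transform_within_open)
    show "open (- ?C)" by (intro open_Compl closed_closure)
    show "z \<in> - ?C" by (rule z)
    show "0 = \<phi> x" if "x \<in> - ?C" for x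
      using that closure_subset[of "{x. \<phi> x \<noteq> 0}"] by auto
  qed
  then show "dderiv e \<phi> z = 0"
    unfolding dderiv_def by (metis frechet_derivative_at)
qed

lemma has_weak_deriv_subset:
  fixes u :: "real \<times> real \<Rightarrow> complex"
  assumes "has_weak_deriv T e u g" "S \<subseteq> T" "S \<in> sets borel" "T \<in> sets borel"
  shows "has_weak_deriv S e u g"
  unfolding has_weak_deriv_def
proof (intro conjI ballI)
  show "g \<in> L2 S" using assms L2_subset by (auto simp: has_weak_deriv_def)
  fix \<phi> assume \<phi>: "\<phi> \<in> test_functions S"
  then have "\<phi> \<in> test_functions T" using assms(2) by (auto simp: test_functions_def)
  then have "(LINT x|lborel_on T. u x * dderiv e \<phi> x) = - (LINT x|lborel_on T. g x * \<phi> x)"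
    using assms(1) by (auto simp: has_weak_deriv_def)
  moreover have "(LINT x|lborel_on T. u x * dderiv e \<phi> x) = (LINT x|lborel_on S. u x * dderiv e \<phi> x)"
    "(LINT x|lborel_on T. g x * \<phi> x) = (LINT x|lborel_on S. g x * \<phi> x)"
    by (intro test_function_integral_subset assms; simp add: test_function_outside[OF \<phi>])+
  ultimately show "(LINT x|lborel_on S. u x * dderiv e \<phi> x) = - (LINT x|lborel_on S. g x * \<phi> x)" by simp
qed

lemma smooth_has_weak_deriv_Omega:
  fixes f :: "real \<times> real \<Rightarrow> complex"
  assumes f: "smooth f" and e: "e \<in> Basis"
  shows "has_weak_deriv \<Omega>\<^sub>0 e f (dderiv e f)"
  unfolding has_weak_deriv_def
proof (intro conjI ballI)
  have cf: "continuous_on UNIV f" "continuous_on UNIV (dderiv e f)"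
    using f e by (auto intro: smooth_continuous smooth_dderiv)
  then show "dderiv e f \<in> L2 \<Omega>\<^sub>0" by (intro continuous_L2_Omega)
  fix \<phi> :: "real \<times> real \<Rightarrow> complex" assume \<phi>: "\<phi> \<in> test_functions \<Omega>\<^sub>0"
  then have sm: "smooth \<phi>" by (simp add: test_functions_def)
  have c\<phi>: "continuous_on UNIV \<phi>" "continuous_on UNIV (dderiv e \<phi>)"
    using sm e by (auto intro: smooth_continuous smooth_dderiv)
  note zero = test_function_outside(1)[OF \<phi>]
  let ?h = "\<lambda>z. f z * dderiv e \<phi> z + dderiv e f z * \<phi> z"
  have ch: "continuous_on UNIV ?h" by (intro continuous_intros cf c\<phi>)
  have i: "integrable (lborel_on \<Omega>\<^sub>0) (\<lambda>z. f z * dderiv e \<phi> z)" "integrable (lborel_on \<Omega>\<^sub>0) (\<lambda>z. dderiv e f z * \<phi> z)"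
    by (intro continuous_integrable_Omega continuous_intros cf c\<phi>)+
  have "(LINT z|lborel_on (strip (-1)). ?h z) + (LINT z|lborel_on (strip 0). ?h z) = 0"
  proof -
    consider "e = (1, 0)" | "e = (0, 1)" using e by (auto simp: Basis_plane)
    then show ?thesis
    proof cases
      case 1
      have "(LINT z|lborel_on (strip a). ?h z) = (LINT y:{0<..<1}|lborel. f (a + 1, y) * \<phi> (a + 1, y) - f (a, y)
          * \<phi> (a, y))" for a
        by (rule Green_x[where H="\<lambda>z. f z * \<phi> z", OF _ ch])
          (auto simp: 1 intro!: has_vector_derivative_mult smooth_partial_x f sm)
      \<comment> \<open>The boundary terms at x = 0 from the two squares cancel, and those at x = -1
        and x = 1 vanish with \<phi>.\<close>
      from this[of "-1"] this[of 0] show ?thesis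
        by (simp add: zero Omega_full_def set_lebesgue_integral_def)
    next
      case 2
      have "(LINT z|lborel_on (strip a). ?h z) = (LINT x:{a<..<a+1}|lborel. f (x, 1) * \<phi> (x, 1) - f (x, 0) * \<phi>
          (x, 0))" for a
        by (rule Green_y[where H="\<lambda>z. f z * \<phi> z", OF _ ch])
          (auto simp: 2 intro!: has_vector_derivative_mult smooth_partial_y f sm)
      from this[of "-1"] this[of 0] show ?thesis
        by (simp add: zero Omega_full_def set_lebesgue_integral_def)
    qed
  qed
  then have "(LINT z|lborel_on \<Omega>\<^sub>0. ?h z) = 0"
    using integral_Omega_split[OF continuous_integrable_Omega[OF ch]] by simp
  then show "(LINT x|lborel_on \<Omega>\<^sub>0. f x * dderiv e \<phi> x) = - (LINT x|lborel_on \<Omega>\<^sub>0. dderiv e f x * \<phi> x)"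
    using i by (simp add: add_eq_0_iff2)
qed

text \<open>The chosen weak derivative on the whole rectangle is still a weak derivative on each
  square, where uniqueness identifies it with the classical one.\<close>

lemma weak_deriv_Omega_AE:
  fixes f :: "real \<times> real \<Rightarrow> complex"
  assumes f: "smooth f" and e: "e \<in> Basis" and S: "strip a \<subseteq> \<Omega>\<^sub>0"
  shows "AE z in lborel_on (strip a). weak_deriv \<Omega>\<^sub>0 e f z = dderiv e f z"
proof -
  have Sm: "strip a \<in> sets borel" using strip_open by auto
  have L: "f \<in> L2 (strip a)" by (intro continuous_L2 strip_measure strip_bounded smooth_continuous f)
  note h = smooth_has_weak_deriv_Omega[OF f e]
  show ?thesis
    by (rule has_weak_deriv_unique[OF has_weak_deriv_subset[OF has_weak_deriv_weak_deriv[OF h] S Sm Omega_borel]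
        has_weak_deriv_subset[OF h S Sm Omega_borel] e L L]) simp
qed

text \<open>A test function is approximated by itself. What has to be shown is that zero has H1 norm
  zero: its weak derivative is a choice, known only almost everywhere.\<close>

lemma test_functions_H10:
  assumes \<phi>: "\<phi> \<in> test_functions \<Omega>\<^sub>0"
  shows "\<phi> \<in> H10 \<Omega>\<^sub>0"
proof -
  have sm: "smooth \<phi>" using \<phi> by (simp add: test_functions_def)
  have "\<phi> \<in> H1 \<Omega>\<^sub>0"
    using continuous_L2_Omega[OF smooth_continuous[OF sm]] smooth_has_weak_deriv_Omega[OF sm] by (auto simp: H1_def)
  moreover have "H1_norm \<Omega>\<^sub>0 (\<lambda>x. 0) = 0"
  proof -
    have "L2_norm \<Omega>\<^sub>0 (weak_deriv \<Omega>\<^sub>0 e (\<lambda>x. 0)) = 0" if e: "e \<in> Basis" for e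
    proof -
      let ?g = "weak_deriv \<Omega>\<^sub>0 e (\<lambda>x. 0)"
      have d0: "dderiv e (\<lambda>x::real\<times>real. 0::complex) z = 0" for z
        by (simp add: dderiv_def)
      have "has_weak_deriv \<Omega>\<^sub>0 e (\<lambda>x. 0) ?g"
        by (rule has_weak_deriv_weak_deriv[OF smooth_has_weak_deriv_Omega[OF smooth_const e]])
      then have gL: "?g \<in> L2 \<Omega>\<^sub>0" by (simp add: has_weak_deriv_def)
      have Sm: "strip a \<in> sets borel" for a using strip_open by auto
      have "(LINT z|lborel_on (strip a). (cmod (?g z))\<^sup>2) = 0" if "strip a \<subseteq> \<Omega>\<^sub>0" for a
      proof (rule integral_eq_zero_AE)
        show "AE z in lborel_on (strip a). (cmod (?g z))\<^sup>2 = 0"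
          using weak_deriv_Omega_AE[OF smooth_const e that, of 0] by eventually_elim (simp add: d0)
      qed
      then have "(L2_norm \<Omega>\<^sub>0 ?g)\<^sup>2 = 0"
        unfolding L2_norm_square using gL strip_subset_Omega by (subst integral_Omega_split) (auto simp: L2_def)
      then show ?thesis by simp
    qed
    moreover have "L2_norm \<Omega>\<^sub>0 (\<lambda>x. 0) = 0" by (simp add: L2_norm_def)
    ultimately show ?thesis by (simp add: H1_norm_def grad_norm_def)
  qed
  ultimately show ?thesis
    unfolding H10_def using \<phi> by (auto intro!: exI[of _ "\<lambda>n. \<phi>"])
qed

text \<open>For a test function the chosen weak derivatives in \<open>normal_traces_agree\<close>
  can be replaced by classical ones, so that products of functions of x and y become usable.\<close>

lemma normal_traces_test:
  assumes n: "normal_traces_agree u w" and \<phi>: "\<phi> \<in> test_functions \<Omega>\<^sub>0"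
    and u: "u \<in> H1 (strip (-1))" "has_weak_laplacian (strip (-1)) u lu" and w: "w \<in> H1 (strip 0)"
        "has_weak_laplacian (strip 0) w lw"
  defines "T \<equiv> \<lambda>a u. LINT z|lborel_on (strip a). (weak_deriv (strip a) (1, 0) u z * dderiv (1, 0) \<phi> z
      + weak_deriv (strip a) (0, 1) u z * dderiv (0, 1) \<phi> z) + weak_laplacian (strip a) u z * \<phi> z"
  shows "T (-1) u + T 0 w = 0"
proof -
  have sm: "smooth \<phi>" using \<phi> by (simp add: test_functions_def)
  have eq: "(LINT x|lborel_on (strip a). (\<Sum>e\<in>Basis. weak_deriv (strip a) e v x * weak_deriv \<Omega>\<^sub>0 e \<phi> x) + \<phi> x *
      weak_laplacian (strip a) v x) = T a v"
    if a: "strip a \<subseteq> \<Omega>\<^sub>0" and v: "v \<in> H1 (strip a)" "has_weak_laplacian (strip a) v lv" for a v lv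
    unfolding T_def
  proof (rule integral_cong_AE)
    have Sm: "strip a \<in> sets borel" using strip_open by auto
    have e: "(1, 0) \<in> (Basis :: (real \<times> real) set)" "(0, 1) \<in> (Basis :: (real \<times> real) set)" by
        (auto simp: Basis_plane)
    have "has_weak_laplacian (strip a) v (weak_laplacian (strip a) v)"
      unfolding weak_laplacian_def using v(2) by (rule someI[where P="has_weak_laplacian (strip a) v"])
    then have l: "weak_laplacian (strip a) v \<in> borel_measurable (lborel_on (strip a))"
      by (auto simp: has_weak_laplacian_def L2_def)
    have d: "weak_deriv (strip a) e v \<in> borel_measurable (lborel_on (strip a))" if "e \<in> Basis" for e
      using H1_weak_deriv[OF v(1) that] by (auto simp: has_weak_deriv_def L2_def)
    have "has_weak_deriv (strip a) e \<phi> (weak_deriv \<Omega>\<^sub>0 e \<phi>)" if "e \<in> Basis" for e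
      by (rule has_weak_deriv_subset[OF has_weak_deriv_weak_deriv[OF smooth_has_weak_deriv_Omega[OF sm that]] a
          Sm Omega_borel])
    then have wd: "weak_deriv \<Omega>\<^sub>0 e \<phi> \<in> borel_measurable (lborel_on (strip a))" if "e \<in> Basis" for e
      using that by (auto simp: has_weak_deriv_def L2_def)
    have dd: "dderiv e \<phi> \<in> borel_measurable (lborel_on (strip a))" if "e \<in> Basis" for e
      by (intro continuous_measurable_on smooth_continuous smooth_dderiv sm that)
    have p: "\<phi> \<in> borel_measurable (lborel_on (strip a))"
      by (intro continuous_measurable_on smooth_continuous sm)
    show "(\<lambda>x. (\<Sum>e\<in>Basis. weak_deriv (strip a) e v x * weak_deriv \<Omega>\<^sub>0 e \<phi> x) + \<phi> x * weak_laplacian (strip a) v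
        x) \<in> borel_measurable (lborel_on (strip a))"
      by (intro borel_measurable_add borel_measurable_times borel_measurable_sum d wd p l)
    show "(\<lambda>z. (weak_deriv (strip a) (1, 0) v z * dderiv (1, 0) \<phi> z + weak_deriv (strip a) (0, 1) v z * dderiv
        (0, 1) \<phi> z) + weak_laplacian (strip a) v z * \<phi> z) \<in> borel_measurable (lborel_on (strip a))"
      by (intro borel_measurable_add borel_measurable_times d dd p l e)
    show "AE x in lborel_on (strip a). (\<Sum>e\<in>Basis. weak_deriv (strip a) e v x * weak_deriv \<Omega>\<^sub>0 e \<phi> x) + \<phi> x *
        weak_laplacian (strip a) v x
      = (weak_deriv (strip a) (1, 0) v x * dderiv (1, 0) \<phi> x + weak_deriv (strip a) (0, 1) v x * dderiv (0, 1) \<phi>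
          x) + weak_laplacian (strip a) v x * \<phi> x"
      using weak_deriv_Omega_AE[OF sm e(1) a] weak_deriv_Omega_AE[OF sm e(2) a]
      by eventually_elim (simp add: Basis_plane mult.commute)
  qed
  show ?thesis
    using n test_functions_H10[OF \<phi>] eq[OF strip_subset_Omega(1) u] eq[OF strip_subset_Omega(2) w]
    unfolding normal_traces_agree_def Omega_minus_strip Omega_plus_strip by auto
qed

lemma weak_laplacian_L2:
  assumes "has_weak_laplacian S u g"
  shows "weak_laplacian S u \<in> L2 S"
proof -
  have "has_weak_laplacian S u (weak_laplacian S u)"
    unfolding weak_laplacian_def using assms by (rule someI[where P="has_weak_laplacian S u"])
  then show ?thesis by (simp add: has_weak_laplacian_def)
qed

lemma H1_weak_deriv_L2:
  assumes "u \<in> H1 (strip a)"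
  shows "u \<in> L2 (strip a)" "weak_deriv (strip a) (1, 0) u \<in> L2 (strip a)" "weak_deriv (strip a) (0, 1) u \<in> L2
      (strip a)"
  using assms H1_weak_deriv[OF assms, of "(1, 0)"] H1_weak_deriv[OF assms, of "(0, 1)"]
  by (auto simp: H1_def has_weak_deriv_def Basis_plane)

text \<open>The contribution of one square to the condition on the normal traces, for a test
  function \<eta>(x) q(y). The derivatives are separate arguments, so the limit of the cutoffs can
  be taken in \<open>q\<close> and \<open>q'\<close> independently.\<close>

definition side_form :: "(real \<Rightarrow> real) \<Rightarrow> (real \<Rightarrow> real) \<Rightarrow> real \<Rightarrow> (real \<times> real \<Rightarrow> complex) \<Rightarrow> (real \<Rightarrow> complex) \<Rightarrow>
    (real \<Rightarrow> complex) \<Rightarrow> complex"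
  where "side_form q q' a u \<eta> \<eta>' = (LINT z|lborel_on (strip a). weak_deriv (strip a) (1, 0) u z * (\<eta>' (fst z) *
      complex_of_real (q (snd z))))
      + (LINT z|lborel_on (strip a). weak_deriv (strip a) (0, 1) u z * (\<eta> (fst z) * complex_of_real (q' (snd z))))
      + (LINT z|lborel_on (strip a). weak_laplacian (strip a) u z * (\<eta> (fst z) * complex_of_real (q (snd z))))"

lemma cutoff_sin_continuous: "continuous_on UNIV (cutoff_sin n m)" "continuous_on UNIV (cutoff_sin' n m)"
proof -
  have b: "continuous_on UNIV (bump 0 1 m)"
    using bump_deriv by (meson DERIV_isCont continuous_at_imp_continuous_on)
  show "continuous_on UNIV (cutoff_sin n m)"
    using cutoff_sin_deriv by (meson DERIV_isCont continuous_at_imp_continuous_on)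
  have f: "continuous_on UNIV (flat p)" for p
    using flat_has_derivative by (meson DERIV_isCont continuous_at_imp_continuous_on)
  have "continuous_on UNIV (dbump m)"
    unfolding dbump_def[abs_def] dflat_def
    by (intro continuous_intros continuous_on_compose2[OF f]) auto
  then show "continuous_on UNIV (cutoff_sin' n m)"
    unfolding cutoff_sin'_def[abs_def] by (intro continuous_intros b sin_basis_continuous)
qed

lemma side_form_tendsto:
  assumes u: "u \<in> H1 (strip a)" "has_weak_laplacian (strip a) u lu"
    and \<eta>: "continuous_on UNIV \<eta>" and \<eta>': "continuous_on UNIV \<eta>'"
  shows "(\<lambda>m. side_form (cutoff_sin n m) (cutoff_sin' n m) a u \<eta> \<eta>') \<longlonglongrightarrow> side_form (sin_basis n) (sin_basis' n) a
      u \<eta> \<eta>'"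
proof -
  have c: "continuous_on UNIV (\<lambda>z. p (fst z) * complex_of_real (q (snd z)))" if "continuous_on UNIV p"
      "continuous_on UNIV q" for p :: "real \<Rightarrow> complex" and q :: "real \<Rightarrow> real"
    by (intro continuous_on_mult continuous_on_of_real continuous_on_compose2[OF that(1)]
        continuous_on_compose2[OF that(2)] continuous_on_fst continuous_on_snd continuous_on_id) auto
  have lim: "(\<lambda>m. LINT z|lborel_on (strip a). F z * (p (fst z) * complex_of_real (q m (snd z)))) \<longlonglongrightarrow>
      (LINT z|lborel_on (strip a). F z * (p (fst z) * complex_of_real (q' (snd z))))"
    if F: "F \<in> L2 (strip a)" and p: "continuous_on UNIV p" and q: "\<And>m. continuous_on UNIV (q m)" "continuous_on
        UNIV q'"
      and B: "\<And>m y. y \<in> {0<..<1} \<Longrightarrow> \<bar>q m y\<bar> \<le> B" and l: "\<And>y. y \<in> {0<..<1} \<Longrightarrow> (\<lambda>m. q m y) \<longlonglongrightarrow> q' y"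
    for F and p :: "real \<Rightarrow> complex" and q :: "nat \<Rightarrow> real \<Rightarrow> real" and q' B
  proof -
    have "continuous_on UNIV (\<lambda>z::real\<times>real. p (fst z))"
      by (rule continuous_on_compose2[OF p]) (auto intro: continuous_intros)
    then obtain C where C: "\<forall>z\<in>strip a. cmod (p (fst z)) \<le> C"
      using continuous_bounded_on[OF _ strip_bounded] by blast
    show ?thesis
    proof (rule strip_dominated_convergence[OF F])
      show "(\<lambda>z. p (fst z) * complex_of_real (q m (snd z))) \<in> borel_measurable (lborel_on (strip a))" for m
        by (intro continuous_measurable_on c p q)
      show "(\<lambda>z. p (fst z) * complex_of_real (q' (snd z))) \<in> borel_measurable (lborel_on (strip a))"
        by (intro continuous_measurable_on c p q)
      fix z :: "real \<times> real" assume z: "z \<in> strip a"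
      then have y: "snd z \<in> {0<..<1}" by (auto simp: strip_def)
      show "cmod (p (fst z) * complex_of_real (q m (snd z))) \<le> C * B" for m
        using C z B[OF y, of m] order_trans[OF norm_ge_zero C[rule_format, OF z]] unfolding norm_mult norm_of_real
        by (intro mult_mono) auto
      show "(\<lambda>m. p (fst z) * complex_of_real (q m (snd z))) \<longlonglongrightarrow> p (fst z) * complex_of_real (q' (snd z))"
        by (intro tendsto_intros l y)
    qed
  qed
  show ?thesis
    unfolding side_form_def
    by (intro tendsto_add lim H1_weak_deriv_L2(2,3)[OF u(1)] weak_laplacian_L2[OF u(2)] \<eta> \<eta>'
        cutoff_sin_continuous sin_basis_continuous cutoff_sin_tendsto)
       (auto intro: cutoff_sin_bounds)
qed

text \<open>The profile \<eta> vanishes near x = -1 and x = 1 but is free at x = 0, so the identity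
  sees the interface. The full sine in y is reached as the limit of admissible cut-off
  sines.\<close>

lemma normal_traces_mode:
  assumes n: "normal_traces_agree u w"
    and u: "u \<in> H1 (strip (-1))" "has_weak_laplacian (strip (-1)) u lu" and w: "w \<in> H1 (strip 0)"
        "has_weak_laplacian (strip 0) w lw"
    and \<eta>: "smooth \<eta>" "0 < r" "\<And>x. \<eta> x \<noteq> 0 \<Longrightarrow> x \<in> {-1 + r..1 - r}"
  shows "side_form (sin_basis n) (sin_basis' n) (-1) u \<eta> (dderiv 1 \<eta>) + side_form (sin_basis n) (sin_basis' n) 0
      w \<eta> (dderiv 1 \<eta>) = 0"
proof -
  have c\<eta>: "continuous_on UNIV \<eta>" "continuous_on UNIV (dderiv 1 \<eta>)"
    using \<eta>(1) by (auto intro!: smooth_continuous smooth_dderiv)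
  have "side_form (cutoff_sin n m) (cutoff_sin' n m) (-1) u \<eta> (dderiv 1 \<eta>) + side_form (cutoff_sin n m)
      (cutoff_sin' n m) 0 w \<eta> (dderiv 1 \<eta>) = 0" for m
  proof -
    let ?q = "\<lambda>y. complex_of_real (cutoff_sin n m y)" and ?q' = "\<lambda>y. complex_of_real (cutoff_sin' n m y)"
    let ?\<phi> = "\<lambda>z. \<eta> (fst z) * ?q (snd z)"
    have r: "0 < 1 / real (Suc m)" by simp
    have \<phi>: "?\<phi> \<in> test_functions \<Omega>\<^sub>0"
    proof (rule tensor_test_function[OF \<eta>(1) smooth_cutoff_sin \<eta>(3)])
      fix y assume "?q y \<noteq> 0"
      then have "bump 0 1 m y \<noteq> 0" by (simp add: cutoff_sin_def)
      then show "y \<in> {0 + 1 / real (Suc m)..1 - 1 / real (Suc m)}" by (rule bump_support)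
    next
      define r' where "r' = 1 / real (Suc m)"
      have "0 < r'" by (simp add: r'_def)
      then show "{- 1 + r..1 - r} \<times> {0 + 1 / real (Suc m)..1 - 1 / real (Suc m)} \<subseteq> \<Omega>\<^sub>0"
        unfolding r'_def[symmetric] using \<eta>(2) by (auto simp: Omega_full_def)
    qed
    have dq: "(?q has_vector_derivative ?q' y) (at y)" for y
      using cutoff_sin_deriv[of n m y, THEN has_real_derivative_iff_has_vector_derivative[THEN iffD1]]
      by (rule bounded_linear.has_vector_derivative[OF bounded_linear_of_real])
    have d\<phi>: "dderiv (1, 0) ?\<phi> z = dderiv 1 \<eta> (fst z) * ?q (snd z)" "dderiv (0, 1) ?\<phi> z = \<eta> (fst z) * ?q'
        (snd z)" for z
      using dderiv_tensor[OF smooth_has_vector_derivative[OF \<eta>(1)] dq, of z] by simp_all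
    have T: "(LINT z|lborel_on (strip a). (weak_deriv (strip a) (1, 0) v z * dderiv (1, 0) ?\<phi> z
      + weak_deriv (strip a) (0, 1) v z * dderiv (0, 1) ?\<phi> z) + weak_laplacian (strip a) v z * ?\<phi> z) = side_form
          (cutoff_sin n m) (cutoff_sin' n m) a v \<eta> (dderiv 1 \<eta>)"
      if v: "v \<in> H1 (strip a)" "has_weak_laplacian (strip a) v lv" for a v lv
      unfolding d\<phi> side_form_def
      using mode_coeff_pair(1)[OF H1_weak_deriv_L2(2)[OF v(1)] cutoff_sin_continuous(1) c\<eta>(2)]
        mode_coeff_pair(1)[OF H1_weak_deriv_L2(3)[OF v(1)] cutoff_sin_continuous(2) c\<eta>(1)]
        mode_coeff_pair(1)[OF weak_laplacian_L2[OF v(2)] cutoff_sin_continuous(1) c\<eta>(1)]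
      by simp
    show ?thesis
      using normal_traces_test[OF n \<phi> u w] unfolding T[OF u] T[OF w] .
  qed
  then have "(\<lambda>m. 0) \<longlonglongrightarrow> side_form (sin_basis n) (sin_basis' n) (-1) u \<eta> (dderiv 1 \<eta>) + side_form (sin_basis n)
      (sin_basis' n) 0 w \<eta> (dderiv 1 \<eta>)"
    using tendsto_add[OF side_form_tendsto[OF u c\<eta>, of n] side_form_tendsto[OF w c\<eta>, of n]] by simp
  then show ?thesis by (simp add: LIMSEQ_const_iff)
qed

section \<open>The resolvent estimate\<close>

text \<open>An equation valid almost everywhere in the plane is passed to the coefficients by
  testing with bumps in x, which avoids handling null sets slice by slice.\<close>

lemma mode_coeff_AE_lincomb:
  assumes L: "H \<in> L2 (strip a)" "F \<in> L2 (strip a)" "G \<in> L2 (strip a)"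
    and eq: "AE z in lborel_on (strip a). H z = c * F z - G z" and e: "continuous_on UNIV e"
  shows "AE x in lborel. mode_coeff e a H x = c * mode_coeff e a F x - mode_coeff e a G x"
proof -
  note i = L[THEN mode_coeff_integrable[OF _ e]]
  have "AE x in lborel. mode_coeff e a H x - (c * mode_coeff e a F x - mode_coeff e a G x) = 0"
  proof (rule AE_eq_0_interval[where a=a and b="a+1"])
    show "integrable lborel (\<lambda>x. mode_coeff e a H x - (c * mode_coeff e a F x - mode_coeff e a G x))"
      using i by simp
    show "mode_coeff e a H x - (c * mode_coeff e a F x - mode_coeff e a G x) = 0" if "x \<notin> {a<..<a+1}" for x
      using mode_coeff_outside[OF that] by simp
    fix \<alpha> \<beta> :: real and m
    let ?b = "\<lambda>x. complex_of_real (bump \<alpha> \<beta> m x)"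
    note p = mode_coeff_pair[OF L(1) e bump_continuous[of \<alpha> \<beta> m]] mode_coeff_pair[OF L(2) e bump_continuous[of \<alpha> \<beta> m]]
      mode_coeff_pair[OF L(3) e bump_continuous[of \<alpha> \<beta> m]]
    have "(LINT z|lborel_on (strip a). H z * (?b (fst z) * complex_of_real (e (snd z)))) =
      (LINT z|lborel_on (strip a). (c * F z - G z) * (?b (fst z) * complex_of_real (e (snd z))))"
    proof (rule integral_strip_cong_AE[OF eq])
      have "continuous_on UNIV (\<lambda>z::real\<times>real. ?b (fst z) * complex_of_real (e (snd z)))"
      proof (rule continuous_on_mult)
        show "continuous_on UNIV (\<lambda>z::real\<times>real. ?b (fst z))"
          by (rule continuous_on_compose2[OF bump_continuous]) (auto intro: continuous_intros)
        show "continuous_on UNIV (\<lambda>z::real\<times>real. complex_of_real (e (snd z)))"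
          by (intro continuous_on_of_real continuous_on_compose2[OF e] continuous_on_snd continuous_on_id) auto
      qed
      then show "(\<lambda>z. ?b (fst z) * complex_of_real (e (snd z))) \<in> borel_measurable (lborel_on (strip a))"
        by (rule continuous_measurable_on)
    qed (intro L2_measurable L2_diff L2_cmult L)+
    also have "\<dots> = c * (LINT z|lborel_on (strip a). F z * (?b (fst z) * complex_of_real (e (snd z)))) -
        (LINT z|lborel_on (strip a). G z * (?b (fst z) * complex_of_real (e (snd z))))"
      using p(4,7) by (simp add: left_diff_distrib mult.assoc)
    finally have "(LINT x|lborel. mode_coeff e a H x * ?b x) = c * (LINT x|lborel. mode_coeff e a F x * ?b x) -
        (LINT x|lborel. mode_coeff e a G x * ?b x)"
      unfolding p(3,6,9) .
    then show "(LINT x|lborel. (mode_coeff e a H x - (c * mode_coeff e a F x - mode_coeff e a G x)) * ?b x) = 0"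
      using p(2,5,8) by (simp add: left_diff_distrib mult.assoc)
  qed
  then show ?thesis by eventually_elim simp
qed

text \<open>Integration by parts in y inside the coefficient, free of boundary terms by the zero
  traces; \<open>e\<close> with derivative \<open>c * e1\<close> covers all trigonometric
  weights.\<close>

lemma trace_y_mode:
  assumes tr: "has_trace (strip a) (a, 0) (a + 1, 0) u (\<lambda>_. 0)" "has_trace (strip a) (a, 1) (a + 1, 1) u (\<lambda>_. 0)"
    and e: "\<And>y. (e has_real_derivative c * e1 y) (at y)" and e1: "continuous_on UNIV e1"
  shows "AE x in lborel. mode_coeff e a (weak_deriv (strip a) (0, 1) u) x = - of_real c * mode_coeff e1 a u x"
proof -
  have u: "u \<in> H1 (strip a)" using tr by (simp add: has_trace_def)
  have ce: "continuous_on UNIV e" using e by (meson DERIV_isCont continuous_at_imp_continuous_on)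
  have ce1: "continuous_on UNIV (\<lambda>y. c * e1 y)" by (intro continuous_intros e1)
  have m: "mode_coeff (\<lambda>y. c * e1 y) a u x = of_real c * mode_coeff e1 a u x" for x
    unfolding mode_coeff_def by (simp add: mult.left_commute flip: integral_mult_right_zero)
  note i = mode_coeff_integrable[OF H1_weak_deriv_L2(3)[OF u] ce] mode_coeff_integrable[OF
      H1_weak_deriv_L2(1)[OF u] e1]
  have "AE x in lborel. mode_coeff e a (weak_deriv (strip a) (0, 1) u) x + of_real c * mode_coeff e1 a u x = 0"
  proof (rule AE_eq_0_interval[where a=a and b="a+1"])
    show "integrable lborel (\<lambda>x. mode_coeff e a (weak_deriv (strip a) (0, 1) u) x + of_real c * mode_coeff e1 a u x)"
      using i by simp
    show "mode_coeff e a (weak_deriv (strip a) (0, 1) u) x + of_real c * mode_coeff e1 a u x = 0" if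
        "x \<notin> {a<..<a+1}" for x
      using mode_coeff_outside[OF that] by simp
    show "(LINT x|lborel. (mode_coeff e a (weak_deriv (strip a) (0, 1) u) x + of_real c * mode_coeff e1 a u x) *
        of_real (bump \<alpha> \<beta> m x)) = 0" for \<alpha> \<beta> m
      using trace_y[OF tr bump_continuous e ce1] unfolding m .
  qed
  then show ?thesis by eventually_elim (simp add: eq_neg_iff_add_eq_0)
qed

lemma cos_basis_Suc_deriv: "(cos_basis (Suc n) has_real_derivative - wavenumber n * sin_basis n y) (at y)"
proof -
  have "((\<lambda>y. sqrt 2 * cos (wavenumber n * y)) has_real_derivative - wavenumber n * (sqrt 2 * sin (wavenumber n
      * y))) (at y)"
    by (auto intro!: derivative_eq_intros)
  then show ?thesis by (simp add: cos_basis_def[abs_def] sin_basis_def wavenumber_def)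
qed

abbreviation mode_sq :: "nat \<Rightarrow> real \<Rightarrow> (real \<times> real \<Rightarrow> complex) \<Rightarrow> real"
  where "mode_sq n a F \<equiv> (LINT x|lborel. (cmod (mode_coeff (sin_basis n) a F x))\<^sup>2)"

text \<open>The y-derivative is expanded in cosines, whose derivatives are multiples of sines, so
  its cosine coefficients are wavenumbers times the sine coefficients of \<open>u\<close>.\<close>

lemma y_derivative_Parseval:
  assumes tr: "has_trace (strip a) (a, 0) (a + 1, 0) u (\<lambda>_. 0)" "has_trace (strip a) (a, 1) (a + 1, 1) u (\<lambda>_. 0)"
  shows "(\<lambda>n. (wavenumber n)\<^sup>2 * mode_sq n a u) sums (L2_norm (strip a) (weak_deriv (strip a) (0, 1) u))\<^sup>2"
proof -
  have u: "u \<in> H1 (strip a)" using tr by (simp add: has_trace_def)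
  note d = H1_weak_deriv_L2(3)[OF u]
  let ?c = "\<lambda>m. LINT x|lborel. (cmod (mode_coeff (cos_basis m) a (weak_deriv (strip a) (0, 1) u) x))\<^sup>2"
  note P = cos_basis.mode_coeff_Parseval[OF d]
  note S = sin_basis.mode_coeff_Parseval[OF H1_weak_deriv_L2(1)[OF u]]
  have "?c 0 = 0"
  proof (rule integral_eq_zero_AE)
    \<comment> \<open>The constant cosine has derivative zero, so the coefficient vanishes: the
      integral of the y-derivative across the strip is zero. \<open>sin_basis 0\<close> only fills
      the slot multiplied by 0.\<close>
    have "AE x in lborel. mode_coeff (cos_basis 0) a (weak_deriv (strip a) (0, 1) u) x = - of_real 0 *
        mode_coeff (sin_basis 0) a u x"
      by (rule trace_y_mode[OF tr]) (auto simp: cos_basis_def[abs_def] intro: sin_basis_continuous)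
    then show "AE x in lborel. (cmod (mode_coeff (cos_basis 0) a (weak_deriv (strip a) (0, 1) u) x))\<^sup>2 = 0"
      by eventually_elim simp
  qed
  moreover have "?c (Suc n) = (wavenumber n)\<^sup>2 * mode_sq n a u" for n
  proof -
    have "?c (Suc n) = (LINT x|lborel. (wavenumber n)\<^sup>2 * (cmod (mode_coeff (sin_basis n) a u x))\<^sup>2)"
    proof (rule integral_cong_AE)
      have "AE x in lborel. mode_coeff (cos_basis (Suc n)) a (weak_deriv (strip a) (0, 1) u) x = - of_real
          (- wavenumber n) * mode_coeff (sin_basis n) a u x"
        by (rule trace_y_mode[OF tr cos_basis_Suc_deriv sin_basis_continuous(1)])
      then show "AE x in lborel. (cmod (mode_coeff (cos_basis (Suc n)) a (weak_deriv (strip a) (0, 1) u) x))\<^sup>2 =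
          (wavenumber n)\<^sup>2 * (cmod (mode_coeff (sin_basis n) a u x))\<^sup>2"
        by eventually_elim (simp add: norm_mult power_mult_distrib)
    qed (use P(1) S(1) in \<open>auto intro: borel_measurable_integrable\<close>)
    then show ?thesis by simp
  qed
  ultimately show ?thesis
    using P(2) sums_Suc_iff[of ?c] by simp
qed

lemma H1_grad_norm:
  fixes u :: "real \<times> real \<Rightarrow> complex"
  shows "(grad_norm S u)\<^sup>2 = (L2_norm S (weak_deriv S (1, 0) u))\<^sup>2 + (L2_norm S (weak_deriv S (0, 1) u))\<^sup>2"
  by (simp add: grad_norm_def Basis_plane)

lemma ac_deriv_cong_AE:
  assumes F: "ac_deriv a b F F'" and G': "set_integrable lborel {a..b} G'"
    and eq: "AE x in lborel. x \<in> {a<..<b} \<longrightarrow> F' x = G' x"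
  shows "ac_deriv a b F G'"
proof -
  have "(LINT t:{a..x}|lborel. G' t) = (LINT t:{a..x}|lborel. F' t)" if x: "x \<in> {a..b}" for x
    unfolding set_lebesgue_integral_def
  proof (rule integral_cong_AE)
    show "AE t in lborel. indicator {a..x} t *\<^sub>R G' t = indicator {a..x} t *\<^sub>R F' t"
      using eq AE_lborel_singleton[of a] AE_lborel_singleton[of b]
    proof eventually_elim
      case (elim t)
      then show ?case using x by (cases "t \<in> {a..x}") auto
    qed
    have "set_integrable lborel {a..x} G'" "set_integrable lborel {a..x} F'"
      using set_integrable_Icc_sub[of a b _ x] G' F x by (auto simp: ac_deriv_def)
    then show "(\<lambda>t. indicator {a..x} t *\<^sub>R G' t) \<in> borel_measurable lborel" "(\<lambda>t. indicator {a..x} t *\<^sub>R F' t) \<in>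
        borel_measurable lborel"
      by (auto simp: set_integrable_def)
  qed
  then show ?thesis using F G' by (simp add: ac_deriv_def)
qed

lemma ac_deriv_indef:
  fixes P :: "real \<Rightarrow> complex"
  assumes "integrable lborel P" "a \<le> b"
  shows "ac_deriv a b (\<lambda>x. c + (LINT t:{a..x}|lborel. P t)) P"
proof -
  have "(LINT t:{a..a}|lborel. P t) = 0"
    unfolding set_lebesgue_integral_def
  proof (rule integral_eq_zero_AE)
    show "AE t in lborel. indicator {a..a} t *\<^sub>R P t = 0"
      using AE_lborel_singleton[of a] by eventually_elim (simp add: indicator_def)
  qed
  moreover have "set_integrable lborel {a..b} P"
    unfolding set_integrable_def by (rule integrable_mult_indicator[OF _ assms(1)]) simp
  ultimately show ?thesis by (simp add: ac_deriv_def)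
qed

lemma nsq_eq:
  assumes eq: "AE x in lborel. x \<in> {a<..<b} \<longrightarrow> F x = G x" and F: "F \<in> borel_measurable borel" "\<And>x. x \<notin> {a<..<b} \<Longrightarrow>
      F x = 0"
    and G: "set_integrable lborel {a..b} (\<lambda>x. (cmod (G x))\<^sup>2)"
  shows "nsq a b G = (LINT x|lborel. (cmod (F x))\<^sup>2)"
  unfolding set_lebesgue_integral_def
proof (rule integral_cong_AE)
  show "AE x in lborel. indicator {a..b} x *\<^sub>R (cmod (G x))\<^sup>2 = (cmod (F x))\<^sup>2"
    using eq AE_lborel_singleton[of a] AE_lborel_singleton[of b]
  proof eventually_elim
    case (elim x)
    then show ?case using F(2)[of x] by (cases "x \<in> {a<..<b}") auto
  qed
  show "(\<lambda>x. indicator {a..b} x *\<^sub>R (cmod (G x))\<^sup>2) \<in> borel_measurable lborel"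
    using G by (auto simp: set_integrable_def)
  show "(\<lambda>x. (cmod (F x))\<^sup>2) \<in> borel_measurable lborel" using F(1) by measurable
qed

lemma HG_minusD:
  assumes "u \<in> HG_minus"
  shows "u \<in> H1 (strip (-1))" "has_trace (strip (-1)) (-1, 0) (-1, 1) u (\<lambda>_. 0)"
    "has_trace (strip (-1)) (-1, 0) (-1 + 1, 0) u (\<lambda>_. 0)" "has_trace (strip (-1)) (-1, 1) (-1 + 1, 1) u (\<lambda>_. 0)"
  using assms by (auto simp: HG_minus_def H1_zero_on_def Omega_minus_strip)

lemma HG_plusD:
  assumes "u \<in> HG_plus"
  shows "u \<in> H1 (strip 0)" "has_trace (strip 0) (1, 0) (1, 1) u (\<lambda>_. 0)"
    "has_trace (strip 0) (0, 0) (0 + 1, 0) u (\<lambda>_. 0)" "has_trace (strip 0) (0, 1) (0 + 1, 1) u (\<lambda>_. 0)"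
  using assms by (auto simp: HG_plus_def H1_zero_on_def Omega_plus_strip)

text \<open>The zero trace at x = -1 fixes the constant of integration at the left end. The test
  functions vanish at x = 0, where the trace is not prescribed.\<close>

lemma left_primitive:
  fixes n :: nat
  assumes u: "u \<in> HG_minus"
  defines "P \<equiv> mode_coeff (sin_basis n) (-1) (weak_deriv (strip (-1)) (1, 0) u)"
  shows "\<exists>K. ac_deriv (-1) 0 K P \<and> K (-1) = 0 \<and> (AE x in lborel. x \<in> {-1<..<0} \<longrightarrow> mode_coeff (sin_basis n) (-1) u
      x = K x)"
proof -
  define K where "K = (\<lambda>x. LINT t:{-1..x}|lborel. P t)"
  note H = HG_minusD[OF u]
  note e = sin_basis_continuous(1)[of n]
  have iP: "integrable lborel P" unfolding P_def by (rule mode_coeff_integrable[OF H1_weak_deriv_L2(2)[OF H(1)] e])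
  have K: "ac_deriv (-1) 0 K P" using ac_deriv_indef[OF iP, of "-1" 0 0] by (simp add: K_def)
  have "(LINT t:{-1..-1}|lborel. P t) = P (-1) - P (-1)"
    using ac_deriv_indef[OF iP, of "-1" "-1" 0] by (simp add: ac_deriv_def)
  then have K0: "K (-1) = 0" by (simp add: K_def)
  have "AE x in lborel. x \<in> {-1<..<0} \<longrightarrow> mode_coeff (sin_basis n) (-1) u x = K x"
  proof (rule AE_eq_primitive[OF _ _ iP _ K, where c=0])
    show "integrable lborel (mode_coeff (sin_basis n) (-1) u)" by (rule mode_coeff_integrable[OF
        H1_weak_deriv_L2(1)[OF H(1)] e])
    show "mode_coeff (sin_basis n) (-1) u x = 0" "P x = 0" if "x \<notin> {-1<..<0}" for x
      using mode_coeff_outside[of x "-1"] that by (auto simp: P_def)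
    fix \<psi> \<theta> :: "real \<Rightarrow> complex"
    assume "continuous_on UNIV \<theta>" "\<And>x. (\<psi> has_vector_derivative \<theta> x) (at x)" "\<psi> 0 = 0"
    then show "(LINT x|lborel. P x * \<psi> x + mode_coeff (sin_basis n) (-1) u x * \<theta> x) = 0"
      using trace_x[OF H(2), of \<psi> "-1" \<theta> "sin_basis n"] e by (simp add: P_def)
  qed (auto simp: K0)
  with K K0 show ?thesis by blast
qed

text \<open>Here the zero trace is at x = 1, and the additive constant is chosen to make the
  primitive vanish there.\<close>

lemma right_primitive:
  fixes n :: nat
  assumes w: "w \<in> HG_plus"
  defines "Q \<equiv> mode_coeff (sin_basis n) 0 (weak_deriv (strip 0) (1, 0) w)"
  shows "\<exists>K. ac_deriv 0 1 K Q \<and> K 1 = 0 \<and> (AE x in lborel. x \<in> {0<..<1} \<longrightarrow> mode_coeff (sin_basis n) 0 w x = K x)"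
proof -
  define K where "K = (\<lambda>x. - (LINT t:{0..1}|lborel. Q t) + (LINT t:{0..x}|lborel. Q t))"
  note H = HG_plusD[OF w]
  note e = sin_basis_continuous(1)[of n]
  have iQ: "integrable lborel Q" unfolding Q_def by (rule mode_coeff_integrable[OF H1_weak_deriv_L2(2)[OF H(1)] e])
  have K: "ac_deriv 0 1 K Q" unfolding K_def by (rule ac_deriv_indef[OF iQ]) simp
  have K1: "K 1 = 0" by (simp add: K_def)
  have "AE x in lborel. x \<in> {0<..<1} \<longrightarrow> mode_coeff (sin_basis n) 0 w x = K x"
  proof (rule AE_eq_primitive[OF _ _ iQ _ K, where c=0])
    show "integrable lborel (mode_coeff (sin_basis n) 0 w)" by (rule mode_coeff_integrable[OF
        H1_weak_deriv_L2(1)[OF H(1)] e])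
    show "mode_coeff (sin_basis n) 0 w x = 0" "Q x = 0" if "x \<notin> {0<..<1}" for x
      using mode_coeff_outside[of x 0] that by (auto simp: Q_def)
    fix \<psi> \<theta> :: "real \<Rightarrow> complex"
    assume "continuous_on UNIV \<theta>" "\<And>x. (\<psi> has_vector_derivative \<theta> x) (at x)" "\<psi> 0 = 0"
    then show "(LINT x|lborel. Q x * \<psi> x + mode_coeff (sin_basis n) 0 w x * \<theta> x) = 0"
      using trace_x[of 0 1 w "\<lambda>_. 0" \<psi> 1 \<theta> "sin_basis n"] H(2) e by (simp add: Q_def)
  qed (auto simp: K1)
  with K K1 show ?thesis by blast
qed

lemma side_form_mode:
  fixes n :: nat and m :: "(real \<times> real \<Rightarrow> complex) \<Rightarrow> real \<Rightarrow> complex"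
  assumes u: "u \<in> H1 (strip a)" "has_weak_laplacian (strip a) u lu"
    and tr: "has_trace (strip a) (a, 0) (a + 1, 0) u (\<lambda>_. 0)" "has_trace (strip a) (a, 1) (a + 1, 1) u (\<lambda>_. 0)"
    and \<eta>: "continuous_on UNIV \<eta>" "continuous_on UNIV \<eta>'"
  defines "m \<equiv> mode_coeff (sin_basis n) a"
  shows "side_form (sin_basis n) (sin_basis' n) a u \<eta> \<eta>' =
    (LINT x|lborel. m (weak_deriv (strip a) (1, 0) u) x * \<eta>' x) + (LINT x|lborel. ((wavenumber n)\<^sup>2 * m u x + m
        (weak_laplacian (strip a) u) x) * \<eta> x)"
proof -
  note e = sin_basis_continuous[of n]
  note L = H1_weak_deriv_L2[OF u(1)] weak_laplacian_L2[OF u(2)]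
  \<comment> \<open>The second derivative of the sine is -k^2 times the sine, so the term with the
    y-derivatives becomes k^2 times the coefficient of \<open>u\<close>.\<close>
  have "AE x in lborel. mode_coeff (sin_basis' n) a (weak_deriv (strip a) (0, 1) u) x = - of_real
      (- (wavenumber n)\<^sup>2) * m u x"
    unfolding m_def by (rule trace_y_mode[OF tr sin_basis'_deriv e(1)])
  then have "(LINT x|lborel. mode_coeff (sin_basis' n) a (weak_deriv (strip a) (0, 1) u) x * \<eta> x) =
      (LINT x|lborel. ((wavenumber n)\<^sup>2 * m u x) * \<eta> x)"
  proof (intro integral_cong_AE)
    assume "AE x in lborel. mode_coeff (sin_basis' n) a (weak_deriv (strip a) (0, 1) u) x = - of_real
        (- (wavenumber n)\<^sup>2) * m u x"
    then show "AE x in lborel. mode_coeff (sin_basis' n) a (weak_deriv (strip a) (0, 1) u) x * \<eta> x =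
        ((wavenumber n)\<^sup>2 * m u x) * \<eta> x"
      by eventually_elim simp
    show "(\<lambda>x. mode_coeff (sin_basis' n) a (weak_deriv (strip a) (0, 1) u) x * \<eta> x) \<in> borel_measurable lborel"
      by (rule borel_measurable_integrable[OF mode_coeff_pair(2)[OF L(3) e(2) \<eta>(1)]])
    have "integrable lborel (\<lambda>x. (wavenumber n)\<^sup>2 * (m u x * \<eta> x))"
      unfolding m_def by (intro integrable_mult_right mode_coeff_pair(2)[OF L(1) e(1) \<eta>(1)])
    then show "(\<lambda>x. ((wavenumber n)\<^sup>2 * m u x) * \<eta> x) \<in> borel_measurable lborel"
      by (auto simp: mult.assoc)
  qed
  moreover have "integrable lborel (\<lambda>x. ((wavenumber n)\<^sup>2 * m u x) * \<eta> x)" "integrable lborel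
      (\<lambda>x. m (weak_laplacian (strip a) u) x * \<eta> x)"
    using mode_coeff_pair(2)[OF L(1) e(1) \<eta>(1)] mode_coeff_pair(2)[OF L(4) e(1) \<eta>(1)] by (auto simp: m_def mult.assoc)
  ultimately show ?thesis
    unfolding side_form_def mode_coeff_pair(3)[OF L(2) e(1) \<eta>(2)] mode_coeff_pair(3)[OF L(3) e(2) \<eta>(1)]
        mode_coeff_pair(3)[OF L(4) e(1) \<eta>(1)] m_def[symmetric]
    by (simp add: distrib_right)
qed

text \<open>Each coefficient vanishes off its own strip, so the sum is the coefficient of u_x on the
  left and of w_x on the right. The normal trace identity says that \<open>T\<close> is its weak
  derivative across x = 0; hence it has a continuous representative without a jump.\<close>

lemma flux_primitive:
  fixes n :: nat and m :: "real \<Rightarrow> (real \<times> real \<Rightarrow> complex) \<Rightarrow> real \<Rightarrow> complex" and T :: "real \<Rightarrow> complex"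
  assumes u: "u \<in> HG_minus" "has_weak_laplacian (strip (-1)) u lu" and w: "w \<in> HG_plus" "has_weak_laplacian
      (strip 0) w lw"
    and nt: "normal_traces_agree u w"
  defines "m \<equiv> mode_coeff (sin_basis n)"
  defines "T \<equiv> \<lambda>x. ((wavenumber n)\<^sup>2 * m (-1) u x + m (-1) (weak_laplacian (strip (-1)) u) x)
      + ((wavenumber n)\<^sup>2 * m 0 w x + m 0 (weak_laplacian (strip 0) w) x)"
  shows "\<exists>K. ac_deriv (-1) 1 K T \<and> (AE x in lborel. x \<in> {-1<..<1} \<longrightarrow>
     m (-1) (weak_deriv (strip (-1)) (1, 0) u) x + m 0 (weak_deriv (strip 0) (1, 0) w) x = K x)"
proof -
  note Hu = HG_minusD[OF u(1)] and Hw = HG_plusD[OF w(1)]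
  note Lu = H1_weak_deriv_L2[OF Hu(1)] weak_laplacian_L2[OF u(2)]
  note Lw = H1_weak_deriv_L2[OF Hw(1)] weak_laplacian_L2[OF w(2)]
  note e = sin_basis_continuous(1)[of n]
  let ?P = "m (-1) (weak_deriv (strip (-1)) (1, 0) u)" and ?Q = "m 0 (weak_deriv (strip 0) (1, 0) w)"
  let ?Tu = "\<lambda>x. (wavenumber n)\<^sup>2 * m (-1) u x + m (-1) (weak_laplacian (strip (-1)) u) x"
  let ?Tw = "\<lambda>x. (wavenumber n)\<^sup>2 * m 0 w x + m 0 (weak_laplacian (strip 0) w) x"
  have i: "integrable lborel ?P" "integrable lborel ?Q" "integrable lborel ?Tu" "integrable lborel ?Tw"
    unfolding m_def by (intro mode_coeff_integrable Lu Lw e Bochner_Integration.integrable_add integrable_mult_right)+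
  have iT: "integrable lborel T" unfolding T_def by (rule Bochner_Integration.integrable_add[OF i(3,4)])
  have zero: "m a F x = 0" if "x \<notin> {-1<..<1}" "a = -1 \<or> a = 0" for a F x
    unfolding m_def by (rule mode_coeff_outside) (use that in auto)
  define K0 where "K0 = (\<lambda>x. 0 + (LINT t:{-1..x}|lborel. T t))"
  have K0: "ac_deriv (-1) 1 K0 T" unfolding K0_def by (rule ac_deriv_indef[OF iT]) simp
  have "\<exists>c. AE x in lborel. x \<in> {-1<..<1} \<longrightarrow> ?P x + ?Q x = K0 x + c"
  proof (rule du_Bois_Reymond[OF _ _ iT _ K0])
    show "integrable lborel (\<lambda>x. ?P x + ?Q x)" using i by simp
    show "?P x + ?Q x = 0" "T x = 0" if "x \<notin> {-1<..<1}" for x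
      using zero[OF that] by (simp_all add: T_def)
    fix \<eta> :: "real \<Rightarrow> complex" and r :: real
    assume \<eta>: "smooth \<eta>" "0 < r" "\<And>x. \<eta> x \<noteq> 0 \<Longrightarrow> x \<in> {-1 + r..1 - r}"
    have c: "continuous_on UNIV \<eta>" "continuous_on UNIV (dderiv 1 \<eta>)"
      using \<eta>(1) by (auto intro!: smooth_continuous smooth_dderiv)
    have "(LINT x|lborel. ?P x * dderiv 1 \<eta> x) + (LINT x|lborel. ?Tu x * \<eta> x) + ((LINT x|lborel. ?Q x * dderiv 1
        \<eta> x) + (LINT x|lborel. ?Tw x * \<eta> x)) = 0"
      using normal_traces_mode[OF nt Hu(1) u(2) Hw(1) w(2) \<eta>, of n]
      unfolding side_form_mode[OF Hu(1) u(2) Hu(3,4) c] side_form_mode[OF Hw(1) w(2) Hw(3,4) c] m_def .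
    moreover have "integrable lborel (\<lambda>x. ?P x * dderiv 1 \<eta> x)" "integrable lborel (\<lambda>x. ?Q x * dderiv 1 \<eta> x)"
      "integrable lborel (\<lambda>x. ?Tu x * \<eta> x)" "integrable lborel (\<lambda>x. ?Tw x * \<eta> x)"
      using integrable_mult_continuous[OF i(1) _ c(2), of "-1" 1] integrable_mult_continuous[OF i(2) _ c(2), of
          "-1" 1]
        integrable_mult_continuous[OF i(3) _ c(1), of "-1" 1] integrable_mult_continuous[OF i(4) _ c(1), of "-1" 1]
      by (simp_all add: zero)
    moreover have "(?P x + ?Q x) * dderiv 1 \<eta> x + T x * \<eta> x =
      (?P x * dderiv 1 \<eta> x + ?Tu x * \<eta> x) + (?Q x * dderiv 1 \<eta> x + ?Tw x * \<eta> x)" for x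
      by (simp add: T_def algebra_simps)
    ultimately show "(LINT x|lborel. (?P x + ?Q x) * dderiv 1 \<eta> x + T x * \<eta> x) = 0"
      by simp
  qed
  then obtain c where c: "AE x in lborel. x \<in> {-1<..<1} \<longrightarrow> ?P x + ?Q x = K0 x + c" by blast
  have "ac_deriv (-1) 1 (\<lambda>x. K0 x + c) T"
    using ac_deriv_add[OF K0 ac_deriv_const] by simp
  then show ?thesis using c by blast
qed

lemma ac_deriv_left: "ac_deriv a b F F' \<Longrightarrow> c \<le> b \<Longrightarrow> ac_deriv a c F F'"
  unfolding ac_deriv_def using set_integrable_Icc_sub by auto

lemma ac_deriv_right:
  assumes F: "ac_deriv a b F F'" and c: "a \<le> c" "c \<le> b"
  shows "ac_deriv c b F F'"
proof -
  have i: "set_integrable lborel {a..b} F'" using F by (simp add: ac_deriv_def)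
  have "(LINT t:{c..x}|lborel. F' t) = F x - F c" if x: "x \<in> {c..b}" for x
  proof -
    have ix: "set_integrable lborel {a..c} F'" "set_integrable lborel {c<..x} F'"
      by (rule set_integrable_subset[OF i]; use c x in auto)+
    have "{a..x} = {a..c} \<union> {c<..x}" using c x by auto
    then have "(LINT t:{a..x}|lborel. F' t) = (LINT t:{a..c}|lborel. F' t) + (LINT t:{c<..x}|lborel. F' t)"
      using ix by (simp only:) (rule set_integral_Un, auto)
    moreover have "(LINT t:{c<..x}|lborel. F' t) = (LINT t:{c..x}|lborel. F' t)"
      unfolding set_lebesgue_integral_def
    proof (rule integral_cong_AE)
      show "AE t in lborel. indicator {c<..x} t *\<^sub>R F' t = indicator {c..x} t *\<^sub>R F' t"
        using AE_lborel_singleton[of c] by eventually_elim (auto simp: indicator_def)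
      have "set_integrable lborel {c..x} F'"
        by (rule set_integrable_subset[OF i]; use c x in auto)
      then show "(\<lambda>t. indicator {c<..x} t *\<^sub>R F' t) \<in> borel_measurable lborel" "(\<lambda>t. indicator {c..x} t *\<^sub>R F'
          t) \<in> borel_measurable lborel"
        using ix by (auto simp: set_integrable_def)
    qed
    moreover have "(LINT t:{a..x}|lborel. F' t) = F x - F a" "(LINT t:{a..c}|lborel. F' t) = F c - F a"
      using F x c by (auto simp: ac_deriv_def)
    ultimately show ?thesis by simp
  qed
  moreover have "set_integrable lborel {c..b} F'"
    by (rule set_integrable_subset[OF i]) (use c in auto)
  ultimately show ?thesis by (simp add: ac_deriv_def)
qed

lemma continuous_set_integrable:
  fixes F :: "real \<Rightarrow> complex"
  assumes "continuous_on {a..b} F"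
  shows "set_integrable lborel {a..b} F"
  unfolding set_integrable_def by (rule borel_integrable_compact[OF _ assms]) simp

lemma Z_eq_resolvent:
  assumes "Z_eq (shift_A \<mu> (u, v, w)) (f, g, h)"
  shows "AE x in lborel_on (strip (-1)). v x = \<mu> * u x - f x"
    "AE x in lborel_on (strip (-1)). weak_laplacian (strip (-1)) u x = \<mu> * v x - g x"
    "AE x in lborel_on (strip 0). weak_laplacian (strip 0) w x = \<mu> * w x - h x"
proof -
  have *: "AE x in lborel_on (strip (-1)). \<mu> * u x - v x = f x"
    "AE x in lborel_on (strip (-1)). \<mu> * v x - weak_laplacian (strip (-1)) u x = g x"
    "AE x in lborel_on (strip 0). \<mu> * w x - weak_laplacian (strip 0) w x = h x"
    using assms unfolding Z_eq_def shift_A_def A_def Omega_minus_strip Omega_plus_strip by simp_all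
  show "AE x in lborel_on (strip (-1)). v x = \<mu> * u x - f x"
    using *(1) by eventually_elim (simp add: algebra_simps)
  show "AE x in lborel_on (strip (-1)). weak_laplacian (strip (-1)) u x = \<mu> * v x - g x"
    using *(2) by eventually_elim (simp add: algebra_simps)
  show "AE x in lborel_on (strip 0). weak_laplacian (strip 0) w x = \<mu> * w x - h x"
    using *(3) by eventually_elim (simp add: algebra_simps)
qed

text \<open>The coefficients are replaced by absolutely continuous representatives, for which all
  hypotheses of \<open>mode\<close> are verified; the integrals in \<open>energy\<close> and
  \<open>data\<close> do not notice the change.\<close>

lemma mode_sq_estimate:
  fixes n :: nat and s :: real
  assumes z: "(u, v, w) \<in> dom_A" and d: "(f, g, h) \<in> Z" and eq: "Z_eq (shift_A (\<i> * s) (u, v, w)) (f, g, h)"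
    and s: "1 \<le> \<bar>s\<bar>"
  shows "mode_sq n (-1) (weak_deriv (strip (-1)) (1, 0) u) + (wavenumber n)\<^sup>2 * mode_sq n (-1) u
      + mode_sq n (-1) v + mode_sq n 0 w
    \<le> 36000 * s ^ 6 * (mode_sq n (-1) (weak_deriv (strip (-1)) (1, 0) f) + (wavenumber n)\<^sup>2 * mode_sq n (-1) f
      + mode_sq n (-1) g + mode_sq n 0 h)"
proof -
  let ?k = "wavenumber n"
  define m where "m = mode_coeff (sin_basis n)"
  note e = sin_basis_continuous(1)[of n]
  have u: "u \<in> HG_minus" and v: "v \<in> HG_minus" and w: "w \<in> HG_plus"
    and tr: "traces_agree v w" and nt: "normal_traces_agree u w"
    using z by (auto simp: dom_A_def Z0_def Z_def)
  obtain lu lw where lu: "has_weak_laplacian (strip (-1)) u lu" and lw: "has_weak_laplacian (strip 0) w lw"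
    using z by (auto simp: dom_A_def Z0_def Omega_minus_strip Omega_plus_strip)
  have f: "f \<in> HG_minus" and g: "g \<in> L2 (strip (-1))" and h: "h \<in> L2 (strip 0)"
    using d by (auto simp: Z_def Omega_minus_strip Omega_plus_strip)
  note Hu = HG_minusD[OF u] and Hv = HG_minusD[OF v] and Hf = HG_minusD[OF f] and Hw = HG_plusD[OF w]
  note Lu = H1_weak_deriv_L2[OF Hu(1)] weak_laplacian_L2[OF lu]
  note Lw = H1_weak_deriv_L2[OF Hw(1)] weak_laplacian_L2[OF lw]
  note Lv = H1_weak_deriv_L2[OF Hv(1)] and Lf = H1_weak_deriv_L2[OF Hf(1)]
  note R = Z_eq_resolvent[OF eq]
  define P0 where "P0 = m (-1) (weak_deriv (strip (-1)) (1, 0) u)"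
  define Q0 where "Q0 = m 0 (weak_deriv (strip 0) (1, 0) w)"
  define f0' where "f0' = m (-1) (weak_deriv (strip (-1)) (1, 0) f)"
  obtain Ku where Ku: "ac_deriv (-1) 0 Ku P0" "Ku (-1) = 0" "AE x in lborel. x \<in> {-1<..<0} \<longrightarrow> m (-1) u x = Ku x"
    using left_primitive[OF u, of n] unfolding P0_def m_def by blast
  obtain Kf where Kf: "ac_deriv (-1) 0 Kf f0'" "Kf (-1) = 0" "AE x in lborel. x \<in> {-1<..<0} \<longrightarrow> m (-1) f x = Kf x"
    using left_primitive[OF f, of n] unfolding f0'_def m_def by blast
  obtain Kw where Kw: "ac_deriv 0 1 Kw Q0" "Kw 1 = 0" "AE x in lborel. x \<in> {0<..<1} \<longrightarrow> m 0 w x = Kw x"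
    using right_primitive[OF w, of n] unfolding Q0_def m_def by blast
  define T where "T = (\<lambda>x. (?k\<^sup>2 * m (-1) u x + m (-1) (weak_laplacian (strip (-1)) u) x)
      + (?k\<^sup>2 * m 0 w x + m 0 (weak_laplacian (strip 0) w) x))"
  obtain K where K: "ac_deriv (-1) 1 K T" and KPQ: "AE x in lborel. x \<in> {-1<..<1} \<longrightarrow> P0 x + Q0 x = K x"
    using flux_primitive[OF u lu w lw nt, of n] unfolding P0_def Q0_def T_def m_def by blast
  have out: "m (-1) F x = 0" if "x \<notin> {-1<..<0}" for F x
    unfolding m_def by (rule mode_coeff_outside) (use that in auto)
  have out0: "m 0 F x = 0" if "x \<notin> {0<..<1}" for F x
    unfolding m_def by (rule mode_coeff_outside) (use that in auto)
  have P0K: "AE x in lborel. x \<in> {-1<..<0} \<longrightarrow> P0 x = K x"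
    using KPQ by eventually_elim (use out0 in \<open>auto simp: Q0_def\<close>)
  have Q0K: "AE x in lborel. x \<in> {0<..<1} \<longrightarrow> Q0 x = K x"
    using KPQ by eventually_elim (use out in \<open>auto simp: P0_def\<close>)
  have mv: "AE x in lborel. m (-1) v x = \<i> * s * m (-1) u x - m (-1) f x"
    unfolding m_def by (rule mode_coeff_AE_lincomb[OF Lv(1) Lu(1) Lf(1) R(1) e])
  have DU: "AE x in lborel. m (-1) (weak_laplacian (strip (-1)) u) x = \<i> * s * m (-1) v x - m (-1) g x"
    unfolding m_def by (rule mode_coeff_AE_lincomb[OF Lu(4) Lv(1) g R(2) e])
  have DW: "AE x in lborel. m 0 (weak_laplacian (strip 0) w) x = \<i> * s * m 0 w x - m 0 h x"
    unfolding m_def by (rule mode_coeff_AE_lincomb[OF Lw(4) Lw(1) h R(3) e])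
  have Kl: "ac_deriv (-1) 0 K T" by (rule ac_deriv_left[OF K]) simp
  have Kr: "ac_deriv 0 1 K T" by (rule ac_deriv_right[OF K]) auto
  have ig: "integrable lborel (m (-1) g)" and ih: "integrable lborel (m 0 h)"
    unfolding m_def by (intro mode_coeff_integrable g h e)+
  have sg: "set_integrable lborel {a..b} G" if "integrable lborel G" for G :: "real \<Rightarrow> complex" and a b
    unfolding set_integrable_def by (rule integrable_mult_indicator[OF _ that]) simp
  have cKu: "continuous_on {-1..0} Ku" and cKf: "continuous_on {-1..0} Kf" and cKw: "continuous_on {0..1} Kw"
    and cKl: "continuous_on {-1..0} K" and cKr: "continuous_on {0..1} K"
    using ac_deriv_continuous Ku(1) Kf(1) Kw(1) Kl Kr by auto
  have sqm: "set_integrable lborel {a..b} (\<lambda>x. (cmod (m c F x))\<^sup>2)" if "F \<in> L2 (strip c)" for a b c F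
    using integrable_mult_indicator[OF _ sin_basis.mode_coeff_Parseval(1)[OF that], of "{a..b}" n]
    by (simp add: set_integrable_def m_def)
  \<comment> \<open>The first interface condition concerns traces of v and w in the plane. The sine
    coefficient of their common trace is computed from each side as a boundary value of the
    one-dimensional representative.\<close>
  have gluing: "\<i> * s * Ku 0 - Kf 0 = Kw 0"
  proof -
    obtain q where q: "has_trace (strip (-1)) (0, 0) (0, 1) v q" "has_trace (strip 0) (0, 0) (0, 1) w q"
      using tr by (auto simp: traces_agree_def Omega_minus_strip Omega_plus_strip)
    let ?G = "LINT t|lborel_on {0..1}. q t * complex_of_real (sin_basis n t)"
    have dv: "AE x in lborel. m (-1) (weak_deriv (strip (-1)) (1, 0) v) x = \<i> * s * P0 x - f0' x"
      unfolding P0_def f0'_def m_def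
    proof (rule mode_coeff_AE_lincomb[OF Lv(2) Lu(2) Lf(2) _ e])
      have b: "(1, 0) \<in> (Basis :: (real \<times> real) set)" by (simp add: Basis_plane)
      show "AE x in lborel_on (strip (-1)). weak_deriv (strip (-1)) (1, 0) v x = \<i> * s * weak_deriv (strip (-1))
          (1, 0) u x - weak_deriv (strip (-1)) (1, 0) f x"
        by (rule has_weak_deriv_unique[OF H1_weak_deriv[OF Hv(1) b] has_weak_deriv_lincomb[OF H1_weak_deriv[OF
            Hu(1) b] H1_weak_deriv[OF Hf(1) b] b Lu(1) Lf(1)] b Lv(1) _ R(1)])
           (intro L2_diff L2_cmult Lu Lf)
    qed
    let ?D = "\<lambda>x. \<i> * s * P0 x - f0' x" and ?E = "\<lambda>x. \<i> * s * Ku x - Kf x"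
    have iD: "integrable lborel ?D"
      unfolding P0_def f0'_def m_def by (intro Bochner_Integration.integrable_diff integrable_mult_right
          mode_coeff_integrable Lu Lf e)
    have D0: "?D x = 0" if "x \<notin> {-1<..<0}" for x
      using out[OF that] by (simp add: P0_def f0'_def)
    have E: "ac_deriv (-1) 0 ?E ?D"
      using ac_deriv_add[OF ac_deriv_cmult[OF Ku(1), of "\<i> * s"] ac_deriv_cmult[OF Kf(1), of "-1"]] by simp
    have p1: "((\<lambda>x. complex_of_real x + 1) has_vector_derivative 1) (at x)" for x
      by (auto intro!: derivative_eq_intros)
    have c1: "continuous_on UNIV (\<lambda>x. complex_of_real x + 1)" and c2: "continuous_on UNIV (\<lambda>x. 1 - complex_of_real x)"
      by (intro continuous_intros)+
    have p2: "((\<lambda>x. 1 - complex_of_real x) has_vector_derivative -1) (at x)" for x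
      by (auto intro!: derivative_eq_intros)
    \<comment> \<open>The test function x + 1 is 0 at the outer end -1 and 1 at the interface, so it
      isolates the trace of v.\<close>
    have "?G = (LINT x|lborel. m (-1) (weak_deriv (strip (-1)) (1, 0) v) x * (of_real x + 1) + m (-1) v x * 1)"
      using trace_x[OF q(1), of "\<lambda>x. complex_of_real x + 1" 1 "\<lambda>_. 1" "sin_basis n"] p1 e by (simp add: m_def)
    also have "\<dots> = (LINT x|lborel. ?D x * (of_real x + 1) + (indicator {-1<..<0} x *\<^sub>R ?E x) * 1)"
    proof (rule integral_cong_AE)
      show "AE x in lborel. m (-1) (weak_deriv (strip (-1)) (1, 0) v) x * (of_real x + 1) + m (-1) v x * 1 = ?D
          x * (of_real x + 1) + (indicator {-1<..<0} x *\<^sub>R ?E x) * 1"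
        using dv mv Ku(3) Kf(3)
      proof eventually_elim
        case (elim x)
        then show ?case
          using out[of x v] by (cases "x \<in> {-1<..<0}") simp_all
      qed
      show "(\<lambda>x. m (-1) (weak_deriv (strip (-1)) (1, 0) v) x * (of_real x + 1) + m (-1) v x * 1) \<in>
          borel_measurable lborel"
        unfolding m_def by (intro borel_measurable_add borel_measurable_integrable mode_coeff_pair(2) Lv e
            continuous_intros)
      show "(\<lambda>x. ?D x * (of_real x + 1) + (indicator {-1<..<0} x *\<^sub>R ?E x) * 1) \<in> borel_measurable lborel"
        using integrable_mult_continuous[OF iD D0 c1, of "-1" 0] integrable_indicator_ac[OF E]
        by (intro borel_measurable_add borel_measurable_integrable) (auto intro!: continuous_intros)
    qed
    also have "\<dots> = (LINT x|lborel. ?D x * (of_real x + 1)) + (LINT x|lborel. (indicator {-1<..<0} x *\<^sub>R ?E x) * 1)"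
      using integrable_mult_continuous[OF iD D0 c1, of "-1" 0] integrable_indicator_ac[OF E]
      by (intro Bochner_Integration.integral_add) (auto intro!: continuous_intros)
    also have "\<dots> = ?E 0 * (of_real 0 + 1) - ?E (-1) * (of_real (-1) + 1)"
      by (rule primitive_by_parts[OF iD D0 E _ p1]) auto
    finally have G1: "?G = ?E 0" by simp
    have iQ: "integrable lborel Q0"
      unfolding Q0_def m_def by (intro mode_coeff_integrable Lw e)
    have Q00: "Q0 x = 0" if "x \<notin> {0<..<1}" for x
      using out0[OF that] by (simp add: Q0_def)
    \<comment> \<open>On the right 1 - x plays this part; the sign is that of the outward normal,
      which points to the left at x = 0.\<close>
    have "- ?G = (LINT x|lborel. Q0 x * (1 - of_real x) + m 0 w x * (-1))"
      using trace_x[OF q(2), of "\<lambda>x. 1 - complex_of_real x" "-1" "\<lambda>_. -1" "sin_basis n"] p2 e by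
          (simp add: m_def Q0_def)
    also have "\<dots> = (LINT x|lborel. Q0 x * (1 - of_real x) + (indicator {0<..<1} x *\<^sub>R Kw x) * (-1))"
    proof (rule integral_cong_AE)
      show "AE x in lborel. Q0 x * (1 - of_real x) + m 0 w x * (-1) = Q0 x * (1 - of_real x) +
          (indicator {0<..<1} x *\<^sub>R Kw x) * (-1)"
        using Kw(3)
      proof eventually_elim
        case (elim x)
        then show ?case
          using out0[of x w] by (cases "x \<in> {0<..<1}") simp_all
      qed
      show "(\<lambda>x. Q0 x * (1 - of_real x) + m 0 w x * (-1)) \<in> borel_measurable lborel"
        unfolding m_def Q0_def by (intro borel_measurable_add borel_measurable_integrable mode_coeff_pair(2) Lw
            e continuous_intros)
      show "(\<lambda>x. Q0 x * (1 - of_real x) + (indicator {0<..<1} x *\<^sub>R Kw x) * (-1)) \<in> borel_measurable lborel"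
        using integrable_mult_continuous[OF iQ Q00 c2, of 0 1] integrable_indicator_ac[OF Kw(1)]
        by (intro borel_measurable_add borel_measurable_integrable) (auto intro!: continuous_intros)
    qed
    also have "\<dots> = (LINT x|lborel. Q0 x * (1 - of_real x)) + (LINT x|lborel. (indicator {0<..<1} x *\<^sub>R Kw x) * (-1))"
      using integrable_mult_continuous[OF iQ Q00 c2, of 0 1] integrable_indicator_ac[OF Kw(1)]
      by (intro Bochner_Integration.integral_add) (auto intro!: continuous_intros)
    also have "\<dots> = Kw 1 * (1 - of_real 1) - Kw 0 * (1 - of_real 0)"
      by (rule primitive_by_parts[OF iQ Q00 Kw(1) _ p2]) auto
    finally have "?G = Kw 0" by simp
    with G1 show ?thesis by simp
  qed
  \<comment> \<open>The same \<open>K\<close> stands for \<open>P\<close> and for \<open>Q\<close>,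
    so the second coupling condition holds by construction.\<close>
  interpret mode ?k s Ku K Kf f0' "m (-1) g" Kw K "m 0 h"
  proof
    show "1 \<le> ?k" "1 \<le> \<bar>s\<bar>" by (rule wavenumber_ge_1) (rule s)
    \<comment> \<open>\<open>Ku\<close> was built as a primitive of the coefficient
      \<open>P0\<close>, which agrees with \<open>K\<close> almost everywhere.\<close>
    show "ac_deriv (-1) 0 Ku K" by (rule ac_deriv_cong_AE[OF Ku(1) continuous_set_integrable[OF cKl] P0K])
    show "ac_deriv 0 1 Kw K" by (rule ac_deriv_cong_AE[OF Kw(1) continuous_set_integrable[OF cKr] Q0K])
    show "ac_deriv (-1) 0 Kf f0'" by (rule Kf(1))
    show "Ku (-1) = 0" "Kf (-1) = 0" "Kw 1 = 0" by (simp_all add: Ku(2) Kf(2) Kw(2))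
    show "\<i> * s * Ku 0 - Kf 0 = Kw 0" by (rule gluing)
    show "set_integrable lborel {-1..0} (\<lambda>x. (cmod (f0' x))\<^sup>2)" unfolding f0'_def by (rule sqm[OF Lf(2)])
    show "set_integrable lborel {-1..0} (\<lambda>x. (cmod (m (-1) g x))\<^sup>2)" by (rule sqm[OF g])
    show "set_integrable lborel {0..1} (\<lambda>x. (cmod (m 0 h x))\<^sup>2)" by (rule sqm[OF h])
    show "ac_deriv (-1) 0 K (\<lambda>x. (?k\<^sup>2 - s\<^sup>2) * Ku x - (\<i> * s * Kf x + m (-1) g x))"
    proof (rule ac_deriv_cong_AE[OF Kl])
      show "set_integrable lborel {-1..0} (\<lambda>x. (?k\<^sup>2 - s\<^sup>2) * Ku x - (\<i> * s * Kf x + m (-1) g x))"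
        by (intro set_integral_diff set_integral_add set_integrable_mult_right continuous_set_integrable cKu cKf
            sg ig)
      show "AE x in lborel. x \<in> {-1<..<0} \<longrightarrow> T x = (?k\<^sup>2 - s\<^sup>2) * Ku x - (\<i> * s * Kf x + m (-1) g x)"
        using Ku(3) Kf(3) mv DU
      proof eventually_elim
        case (elim x)
        show ?case
        proof
          assume x: "x \<in> {-1<..<0}"
          then have "T x = ?k\<^sup>2 * Ku x + (\<i> * s * (\<i> * s * Ku x - Kf x) - m (-1) g x)"
            using elim out0[of x] by (simp add: T_def)
          then show "T x = (?k\<^sup>2 - s\<^sup>2) * Ku x - (\<i> * s * Kf x + m (-1) g x)"
            by (simp add: algebra_simps power2_eq_square)
        qed
      qed
    qed
    show "ac_deriv 0 1 K (\<lambda>x. (?k\<^sup>2 + \<i> * s) * Kw x - m 0 h x)"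
    proof (rule ac_deriv_cong_AE[OF Kr])
      show "set_integrable lborel {0..1} (\<lambda>x. (?k\<^sup>2 + \<i> * s) * Kw x - m 0 h x)"
        by (intro set_integral_diff set_integral_add set_integrable_mult_right continuous_set_integrable cKw sg ih)
      show "AE x in lborel. x \<in> {0<..<1} \<longrightarrow> T x = (?k\<^sup>2 + \<i> * s) * Kw x - m 0 h x"
        using Kw(3) DW
      proof eventually_elim
        case (elim x)
        show ?case
        proof
          assume x: "x \<in> {0<..<1}"
          then have "T x = ?k\<^sup>2 * Kw x + (\<i> * s * Kw x - m 0 h x)"
            using elim out[of x] by (simp add: T_def)
          then show "T x = (?k\<^sup>2 + \<i> * s) * Kw x - m 0 h x"
            by (simp add: algebra_simps)
        qed
      qed
    qed
  qed auto
  have meas: "m c F \<in> borel_measurable borel" if "F \<in> L2 (strip c)" for c F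
    using borel_measurable_integrable[OF mode_coeff_integrable[OF that e]] by (simp add: m_def)
  have ms: "mode_sq n c F = (LINT x|lborel. (cmod (m c F x))\<^sup>2)" for c F by (simp add: m_def)
  have "energy = mode_sq n (-1) (weak_deriv (strip (-1)) (1, 0) u) + ?k\<^sup>2 * mode_sq n (-1) u + mode_sq n (-1) v
      + mode_sq n 0 w"
  proof -
    have "nsq (-1) 0 K = mode_sq n (-1) (weak_deriv (strip (-1)) (1, 0) u)"
      unfolding ms by (rule nsq_eq[OF P0K[unfolded P0_def] meas[OF Lu(2)] out sq_int(2)])
    moreover have "nsq (-1) 0 Ku = mode_sq n (-1) u"
      unfolding ms by (rule nsq_eq[OF Ku(3) meas[OF Lu(1)] out sq_int(1)])
    moreover have "AE x in lborel. x \<in> {-1<..<0} \<longrightarrow> m (-1) v x = V x"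
      using mv Ku(3) Kf(3) by eventually_elim (simp add: V_def)
    then have "nsq (-1) 0 V = mode_sq n (-1) v"
      unfolding ms by (rule nsq_eq[OF _ meas[OF Lv(1)] out sq_int(4)])
    moreover have "nsq 0 1 Kw = mode_sq n 0 w"
      unfolding ms by (rule nsq_eq[OF Kw(3) meas[OF Lw(1)] out0 sq_int(5)])
    ultimately show ?thesis by (simp add: energy_def)
  qed
  moreover have "data = mode_sq n (-1) (weak_deriv (strip (-1)) (1, 0) f) + ?k\<^sup>2 * mode_sq n (-1) f + mode_sq n
      (-1) g + mode_sq n 0 h"
  proof -
    have "nsq (-1) 0 f0' = mode_sq n (-1) (weak_deriv (strip (-1)) (1, 0) f)"
      unfolding ms f0'_def by (rule nsq_eq[OF _ meas[OF Lf(2)] out sqm[OF Lf(2)]]) simp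
    moreover have "nsq (-1) 0 Kf = mode_sq n (-1) f"
      unfolding ms by (rule nsq_eq[OF Kf(3) meas[OF Lf(1)] out sq_int(3)])
    moreover have "nsq (-1) 0 (m (-1) g) = mode_sq n (-1) g"
      unfolding ms by (rule nsq_eq[OF _ meas[OF g] out sqm[OF g]]) simp
    moreover have "nsq 0 1 (m 0 h) = mode_sq n 0 h"
      unfolding ms by (rule nsq_eq[OF _ meas[OF h] out0 sqm[OF h]]) simp
    ultimately show ?thesis by (simp add: data_def)
  qed
  ultimately show ?thesis using mode_estimate by simp
qed

text \<open>An a priori bound for every solution. Parseval recovers both squared norms from the
  modes, and the constant is the same in each mode, so the estimates are summed term by
  term.\<close>

lemma resolvent_estimate:
  assumes z: "(u, v, w) \<in> dom_A" and d: "(f, g, h) \<in> Z" and eq: "Z_eq (shift_A (\<i> * complex_of_real s)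
      (u, v, w)) (f, g, h)"
    and s: "1 \<le> \<bar>s\<bar>"
  shows "Z_norm (u, v, w) \<le> 190 * \<bar>s\<bar> ^ 3 * Z_norm (f, g, h)"
proof -
  have u: "u \<in> HG_minus" and v: "v \<in> HG_minus" and w: "w \<in> HG_plus"
    using z by (auto simp: dom_A_def Z0_def Z_def)
  have f: "f \<in> HG_minus" and g: "g \<in> L2 (strip (-1))" and h: "h \<in> L2 (strip 0)"
    using d by (auto simp: Z_def Omega_minus_strip Omega_plus_strip)
  note Hu = HG_minusD[OF u] and Hv = HG_minusD[OF v] and Hf = HG_minusD[OF f] and Hw = HG_plusD[OF w]
  note Lu = H1_weak_deriv_L2[OF Hu(1)] and Lf = H1_weak_deriv_L2[OF Hf(1)]
  note S = sin_basis.mode_coeff_Parseval(2)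
  have sq: "(Z_norm (u, v, w))\<^sup>2 = (L2_norm (strip (-1)) (weak_deriv (strip (-1)) (1, 0) u))\<^sup>2 +
      (L2_norm (strip (-1)) (weak_deriv (strip (-1)) (0, 1) u))\<^sup>2
      + (L2_norm (strip (-1)) v)\<^sup>2 + (L2_norm (strip 0) w)\<^sup>2" for u v w
    by (simp add: Z_norm_def Omega_minus_strip Omega_plus_strip H1_grad_norm)
  have "(Z_norm (u, v, w))\<^sup>2 \<le> 36000 * s ^ 6 * (Z_norm (f, g, h))\<^sup>2"
  proof (rule sums_le[OF mode_sq_estimate[OF z d eq s]])
    show "(\<lambda>n. mode_sq n (-1) (weak_deriv (strip (-1)) (1, 0) u) + (wavenumber n)\<^sup>2 * mode_sq n (-1) u
      + mode_sq n (-1) v + mode_sq n 0 w) sums (Z_norm (u, v, w))\<^sup>2"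
      unfolding sq by (intro sums_add S y_derivative_Parseval Hu Lu H1_weak_deriv_L2(1)[OF Hv(1)]
          H1_weak_deriv_L2(1)[OF Hw(1)])
    show "(\<lambda>n. 36000 * s ^ 6 * (mode_sq n (-1) (weak_deriv (strip (-1)) (1, 0) f) + (wavenumber n)\<^sup>2 * mode_sq n
        (-1) f
      + mode_sq n (-1) g + mode_sq n 0 h)) sums (36000 * s ^ 6 * (Z_norm (f, g, h))\<^sup>2)"
      unfolding sq by (intro sums_mult sums_add S y_derivative_Parseval Hf Lf g h)
  qed
  \<comment> \<open>190^2 = 36100 is a square just above 36000, which keeps the final constant an
    integer.\<close>
  also have "\<dots> \<le> (190 * \<bar>s\<bar> ^ 3 * Z_norm (f, g, h))\<^sup>2"
  proof -
    have "(190 * \<bar>s\<bar> ^ 3 * Z_norm (f, g, h))\<^sup>2 = 36100 * s ^ 6 * (Z_norm (f, g, h))\<^sup>2"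
      by (simp add: power_mult_distrib power_even_abs flip: power_mult)
    moreover have "36000 * s ^ 6 * (Z_norm (f, g, h))\<^sup>2 \<le> 36100 * s ^ 6 * (Z_norm (f, g, h))\<^sup>2"
      by (intro mult_right_mono) auto
    ultimately show ?thesis by simp
  qed
  finally show ?thesis
    by (rule power2_le_imp_le) (simp add: Z_norm_def)
qed

lemma H1_norm_zero:
  "H1_norm (strip a) (\<lambda>z. 0) = 0"
proof -
  have "L2_norm (strip a) (weak_deriv (strip a) e (\<lambda>z. 0)) = 0" if e: "e \<in> Basis" for e
  proof -
    note h = smooth_has_weak_deriv[OF smooth_const[of 0] e]
    have z: "(\<lambda>z::real\<times>real. 0) \<in> L2 (strip a)" by (simp add: L2_def)
    have "dderiv e (\<lambda>x::real\<times>real. 0::complex) z = 0" for z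
      by (simp add: dderiv_def)
    then have "AE z in lborel_on (strip a). weak_deriv (strip a) e (\<lambda>z. 0) z = 0"
      using has_weak_deriv_unique[OF has_weak_deriv_weak_deriv[OF h] h e z z] by simp
    then have "(LINT z|lborel_on (strip a). (cmod (weak_deriv (strip a) e (\<lambda>z. 0) z))\<^sup>2) = 0"
      by (intro integral_eq_zero_AE) (auto elim!: eventually_mono)
    then show ?thesis by (simp add: L2_norm_def)
  qed
  then show ?thesis by (simp add: H1_norm_def grad_norm_def L2_norm_def)
qed

text \<open>Supplies a member of \<open>Z\<close>, so that the supremum in \<open>Z_onorm\<close> is
  over a nonempty set.\<close>

lemma zero_in_Z: "(\<lambda>_. 0, \<lambda>_. 0, \<lambda>_. 0) \<in> Z"
proof -
  have H: "(\<lambda>_. 0) \<in> H1 (strip a)" for a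
    using smooth_has_weak_deriv[OF smooth_const[of 0]] by (auto simp: H1_def L2_def)
  have "has_trace (strip a) p q (\<lambda>_. 0) (\<lambda>_. 0)" for a p q
    unfolding has_trace_def
  proof (intro conjI exI[of _ "\<lambda>n z. 0"] allI)
    show "(\<lambda>_. 0) \<in> H1 (strip a)" by (rule H)
    show "(\<lambda>_. 0) \<in> L2 {0..1::real}" by (simp add: L2_def)
    show "smooth (\<lambda>z::real\<times>real. 0::complex)" by (rule smooth_const)
  qed (simp_all add: H1_norm_zero L2_norm_def)
  then show ?thesis
    using H by (auto simp: Z_def HG_minus_def H1_zero_on_def Omega_minus_strip L2_def)
qed

theorem theorem3p1:
  assumes spectrum: "spectrum_A \<subseteq> {\<mu>. Re \<mu> < 0}"
  shows "(\<lambda>s::real. Z_onorm (R_A (\<i> * complex_of_real s))) \<in> O[at_infinity](\<lambda>s. \<bar>s\<bar> ^ 3)"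
proof (rule bigoI)
  show "\<forall>\<^sub>F s in at_infinity. norm (Z_onorm (R_A (\<i> * complex_of_real s))) \<le> 190 * norm (\<bar>s\<bar> ^ 3)"
    unfolding eventually_at_infinity
  proof (intro exI[of _ 1] allI impI)
    fix s :: real assume "1 \<le> norm s"
    then have s: "1 \<le> \<bar>s\<bar>" by simp
    let ?\<mu> = "\<i> * complex_of_real s"
    \<comment> \<open>Points of the imaginary axis have real part 0 and lie outside the spectrum by
      assumption; this provides solvability.\<close>
    have "?\<mu> \<in> resolvent_set_A" using spectrum by (auto simp: spectrum_A_def)
    then have ex: "\<exists>z. z \<in> dom_A \<and> Z_eq (shift_A ?\<mu> z) F" if "F \<in> Z" for F
    proof -
      have "\<forall>f\<in>Z. \<exists>z\<in>dom_A. Z_eq (shift_A ?\<mu> z) f \<and> (\<forall>z'\<in>dom_A. Z_eq (shift_A ?\<mu> z') f \<longrightarrow> Z_eq z' z)"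
        using \<open>?\<mu> \<in> resolvent_set_A\<close> unfolding resolvent_set_A_def by blast
      then show ?thesis using that by blast
    qed
    have R: "R_A ?\<mu> F \<in> dom_A" "Z_eq (shift_A ?\<mu> (R_A ?\<mu> F)) F" if "F \<in> Z" for F
      unfolding R_A_def using someI_ex[OF ex[OF that]] by auto
    have nn: "0 \<le> Z_norm F" for F by (cases F) (simp add: Z_norm_def)
    \<comment> \<open>The a priori estimate applies to whichever solution the choice in
      \<open>R_A\<close> selects.\<close>
    have le: "Z_norm (R_A ?\<mu> F) / Z_norm F \<le> 190 * \<bar>s\<bar> ^ 3" if F: "F \<in> Z" for F
    proof -
      have "Z_norm (R_A ?\<mu> F) \<le> 190 * \<bar>s\<bar> ^ 3 * Z_norm F"
        using resolvent_estimate[of "fst (R_A ?\<mu> F)" "fst (snd (R_A ?\<mu> F))" "snd (snd (R_A ?\<mu> F))" "fst F"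
            "fst (snd F)" "snd (snd F)" s] R[OF F] F s
        by simp
      then show ?thesis
        \<comment> \<open>For data of norm zero the quotient is 0 by the convention on
          division.\<close>
        using nn[of F] by (cases "Z_norm F = 0") (auto simp: pos_divide_le_eq)
    qed
    have ne: "Z \<noteq> {}" using zero_in_Z by blast
    have "0 \<le> Z_onorm (R_A ?\<mu>)"
    proof -
      obtain F where F: "F \<in> Z" using ne by blast
      have "0 \<le> Z_norm (R_A ?\<mu> F) / Z_norm F" using nn by simp
      also have "\<dots> \<le> Z_onorm (R_A ?\<mu>)"
        unfolding Z_onorm_def by (rule cSUP_upper[OF F]) (auto intro!: bdd_aboveI2 le)
      finally show ?thesis .
    qed
    moreover have "Z_onorm (R_A ?\<mu>) \<le> 190 * \<bar>s\<bar> ^ 3"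
      unfolding Z_onorm_def by (rule cSUP_least[OF ne le])
    ultimately show "norm (Z_onorm (R_A ?\<mu>)) \<le> 190 * norm (\<bar>s\<bar> ^ 3)" by simp
  qed
qed

end
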